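(* Let $\lambda\in\mathbb{C}$. (NE) If $\lambda\neq4m(m+1)$ for all $m\in\mathbb{N}_0$, then $X_\lambda(\mathbb{D}^2)$ has no non-trivial Möbius invariant subspaces. (E) If $\lambda=4m(m+1)$ for some $m\in\mathbb{N}_0$, then $X_\lambda(\mathbb{D}^2)$ has precisely three non-trivial Möbius invariant subspaces $X_{\lambda}^{+}(\mathbb{D}^2),X_{\lambda}^{-}(\mathbb{D}^2),X_{\lambda}^{0}(\mathbb{D}^2)$, of which exactly one, say $X_{\lambda}^{0}(\mathbb{D}^2)$, is finite dimensional, of dimension $2m+1$. Explicitly, these spaces are given by $$X_{\lambda}^{+}(\mathbb{D}^2)=\operatorname{clos}_{\mathbb{D}^2}\left(\mathrm{span}\{P_n^{m+1} : -m\leq n< \infty\}\right),$$ $$X_{\lambda}^{-}(\mathbb{D}^2)=\operatorname{clos}_{\mathbb{D}^2}\left(\mathrm{span}\{P_n^{m+1} : -\infty< n\leq m\}\right),$$ $$X_{\lambda}^{0}(\mathbb{D}^2)=\mathrm{span}\{P_n^{m+1} : -m\leq n\leq m\},$$ where $\operatorname{clos}_{\mathbb{D}^2}$ denotes the closure with respect to the topology of locally uniform convergence on $\mathbb{D}^2$.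
   Context: $\mathbb{D}$ is the open unit disk, $\mathbb{D}^2=\mathbb{D}\times\mathbb{D}$, $\widehat{\mathbb{C}}=\mathbb{C}\cup\{\infty\}$, $\mathbb{N}_0=\{0,1,2,\dots\}$. $\mathcal{H}(\mathbb{D}^2)$ is the space of holomorphic functions on $\mathbb{D}^2$ with the topology of locally uniform convergence, $\Delta_{zw}=4(1-zw)^2\partial_z\partial_w$ and $X_\lambda(\mathbb{D}^2)=\{F\in\mathcal{H}(\mathbb{D}^2):\Delta_{zw}F=\lambda F\}$. "span" means all finite linear combinations. Let $\mathcal{M}$ be the group of all maps $(z,w)\mapsto\big(\psi(z),1/\psi(1/w)\big)$ and $(z,w)\mapsto\big(\psi(w),1/\psi(1/z)\big)$, where $\psi$ runs through all Möbius transformations of $\widehat{\mathbb{C}}$. The Möbius group of the bidisk is $\mathcal{M}(\mathbb{D}^2)=\mathrm{Aut}(\mathbb{D}^2)\cap\mathcal{M}$, where $\mathrm{Aut}(\mathbb{D}^2)$ is the group of biholomorphic automorphisms of $\mathbb{D}^2$; it consists of the maps of the two above forms with $\psi$ running through the conformal automorphisms of $\mathbb{D}$. A Möbius invariant subspace of $X_\lambda(\mathbb{D}^2)$ is a closed subspace $Y$ such that $F\circ T\in Y$ for all $F\in Y$ and all $T\in\mathcal{M}(\mathbb{D}^2)$. It is non-trivial if $Y\neq\{0\}$ and $Y\neq X_\lambda(\mathbb{D}^2)$. For $\mu\in\mathbb{C}$, $n\in\mathbb{Z}$, the $n$-th Poisson Fourier mode of order $\mu$ is $$P_n^\mu(z,w)=\frac{(1-zw)^{\mu}}{2\pi}\int_0^{2\pi}\frac{e^{-int}}{(1-ze^{-it})^\mu(1-we^{it})^\mu}\,dt,\qquad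 (z,w)\in\mathbb{D}^2,$$ with principal branches of the powers.
   Formalization: In (E), Möbius invariance is taken only under the maps (ψ(z), 1/ψ(1/w)), since the flip (z,w)↦(w,z) in the full group exchanges X^+ and X^-, making (E) false as stated; (NE) is proved for the full group and for this subgroup. *)

theory Defs
  imports "HOL-Analysis.Analysis" "HOL-Library.Function_Algebras"
begin

section \<open>Functions on the bidisk\<close>

text \<open>
  A function on the bidisk is represented by a total function that vanishes off the bidisk, so
  that equality in HOL is equality on the bidisk.  All spaces below consist of such functions.
\<close>

definition bidisk :: "(complex \<times> complex) set" where
  "bidisk = ball 0 1 \<times> ball 0 1"

definition restrict_bidisk :: "(complex \<times> complex \<Rightarrow> complex) \<Rightarrow> complex \<times> complex \<Rightarrow> complex" where
  "restrict_bidisk F = (\<lambda>p. if p \<in> bidisk then F p else 0)"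

text \<open>Complex differentiability: the Frechet derivative exists and is complex linear.\<close>

definition holomorphic2_on ::
    "(complex \<times> complex \<Rightarrow> complex) \<Rightarrow> (complex \<times> complex) set \<Rightarrow> bool" where
  "holomorphic2_on F S \<longleftrightarrow>
     (\<forall>p\<in>S. \<exists>a b. (F has_derivative (\<lambda>(h, k). a * h + b * k)) (at p within S))"

definition holo_bidisk :: "(complex \<times> complex \<Rightarrow> complex) set" where
  "holo_bidisk = {F. holomorphic2_on F bidisk \<and> (\<forall>p. p \<notin> bidisk \<longrightarrow> F p = 0)}"

definition fun_scale ::
    "complex \<Rightarrow> (complex \<times> complex \<Rightarrow> complex) \<Rightarrow> complex \<times> complex \<Rightarrow> complex" where
  "fun_scale c F = (\<lambda>p. c * F p)"

global_interpretation cfun: vector_space fun_scale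
  by unfold_locales (auto simp: fun_scale_def fun_eq_iff algebra_simps)

definition finite_dimensional :: "(complex \<times> complex \<Rightarrow> complex) set \<Rightarrow> bool" where
  "finite_dimensional V \<longleftrightarrow> (\<exists>B. finite B \<and> cfun.span B = V)"


section \<open>The topology of locally uniform convergence\<close>

text \<open>
  Since the bidisk is locally compact, locally uniform convergence is uniform convergence on
  compact subsets.
\<close>

definition compact_nhd :: "(complex \<times> complex) set \<Rightarrow> real \<Rightarrow>
    (complex \<times> complex \<Rightarrow> complex) \<Rightarrow> (complex \<times> complex \<Rightarrow> complex) set" where
  "compact_nhd K e F = {G \<in> holo_bidisk. \<forall>p\<in>K. cmod (G p - F p) < e}"

definition holo_open :: "(complex \<times> complex \<Rightarrow> complex) set \<Rightarrow> bool" where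
  "holo_open U \<longleftrightarrow> U \<subseteq> holo_bidisk \<and>
     (\<forall>F\<in>U. \<exists>K e. compact K \<and> K \<subseteq> bidisk \<and> e > 0 \<and> compact_nhd K e F \<subseteq> U)"

definition holo_topology :: "(complex \<times> complex \<Rightarrow> complex) topology" where
  "holo_topology = topology holo_open"

lemma istopology_holo_open: "istopology holo_open"
  unfolding istopology_def
proof (intro conjI allI impI)
  fix U V assume U: "holo_open U" and V: "holo_open V"
  show "holo_open (U \<inter> V)"
    unfolding holo_open_def
  proof (intro conjI ballI)
    show "U \<inter> V \<subseteq> holo_bidisk" using U by (auto simp: holo_open_def)
    fix F assume F: "F \<in> U \<inter> V"
    obtain K e where K: "compact K" "K \<subseteq> bidisk" "e > 0" "compact_nhd K e F \<subseteq> U"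
      using U F unfolding holo_open_def by blast
    obtain L d where L: "compact L" "L \<subseteq> bidisk" "d > 0" "compact_nhd L d F \<subseteq> V"
      using V F unfolding holo_open_def by blast
    have "compact_nhd (K \<union> L) (min e d) F \<subseteq> compact_nhd K e F \<inter> compact_nhd L d F"
      by (auto simp: compact_nhd_def)
    then show "\<exists>K e. compact K \<and> K \<subseteq> bidisk \<and> e > 0 \<and> compact_nhd K e F \<subseteq> U \<inter> V"
      using K L by (intro exI[of _ "K \<union> L"] exI[of _ "min e d"]) auto
  qed
next
  fix \<U> assume "\<forall>U\<in>\<U>. holo_open U"
  then show "holo_open (\<Union>\<U>)"
    unfolding holo_open_def by (meson Sup_least UnionE Union_upper subset_trans)
qed

lemma openin_holo_topology: "openin holo_topology U \<longleftrightarrow> holo_open U"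
  by (simp add: holo_topology_def istopology_holo_open topology_inverse')

lemma topspace_holo_topology: "topspace holo_topology = holo_bidisk"
proof -
  have "compact_nhd {} 1 F \<subseteq> holo_bidisk" for F
    by (auto simp: compact_nhd_def)
  then have "holo_open holo_bidisk"
    unfolding holo_open_def by (metis compact_empty empty_subsetI order_refl zero_less_one)
  then show ?thesis
    unfolding topspace_def openin_holo_topology by (auto simp: holo_open_def)
qed

lemma limitin_holo_topology:
  "limitin holo_topology f F A \<longleftrightarrow>
     F \<in> holo_bidisk \<and> (\<forall>\<^sub>F n in A. f n \<in> holo_bidisk) \<and>
     (\<forall>K. compact K \<and> K \<subseteq> bidisk \<longrightarrow> uniform_limit K f F A)"
proof safe
  assume lim: "limitin holo_topology f F A"
  show F: "F \<in> holo_bidisk"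
    using lim by (simp add: limitin_def topspace_holo_topology)
  have "openin holo_topology holo_bidisk"
    by (metis openin_topspace topspace_holo_topology)
  then show "\<forall>\<^sub>F n in A. f n \<in> holo_bidisk"
    using lim F by (auto simp: limitin_def)
  fix K :: "(complex \<times> complex) set" assume K: "compact K" "K \<subseteq> bidisk"
  show "uniform_limit K f F A"
  proof (rule uniform_limitI)
    fix e :: real assume e: "e > 0"
    define U where "U = (\<Union>d\<in>{0<..<e}. {G \<in> holo_bidisk. \<exists>c<d. \<forall>p\<in>K. cmod (G p - F p) \<le> c})"
    have "holo_open U"
      unfolding holo_open_def
    proof (intro conjI ballI)
      show "U \<subseteq> holo_bidisk" by (auto simp: U_def)
      fix G assume "G \<in> U"
      then obtain d c where d: "0 < d" "d < e" "c < d" "\<forall>p\<in>K. cmod (G p - F p) \<le> c"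
        by (auto simp: U_def)
      have "compact_nhd K ((d - c) / 2) G \<subseteq> U"
      proof
        fix H assume H: "H \<in> compact_nhd K ((d - c) / 2) G"
        have "cmod (H p - F p) \<le> (d + c) / 2" if "p \<in> K" for p
        proof -
          have "cmod (H p - F p) \<le> cmod (H p - G p) + cmod (G p - F p)"
            by (metis dist_norm dist_triangle)
          moreover have "cmod (H p - G p) < (d - c) / 2" "cmod (G p - F p) \<le> c"
            using that H d by (auto simp: compact_nhd_def)
          ultimately show ?thesis by (simp add: field_simps)
        qed
        moreover have "(d + c) / 2 < d" using d by simp
        ultimately have "\<exists>c'<d. \<forall>p\<in>K. cmod (H p - F p) \<le> c'" by blast
        moreover have "H \<in> holo_bidisk" using H by (simp add: compact_nhd_def)
        ultimately show "H \<in> U" using d(1,2) by (auto simp: U_def)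
      qed
      then show "\<exists>K e. compact K \<and> K \<subseteq> bidisk \<and> e > 0 \<and> compact_nhd K e G \<subseteq> U"
        using K d by (intro exI[of _ K] exI[of _ "(d - c) / 2"]) auto
    qed
    moreover have "F \<in> U"
      using F e by (auto simp: U_def intro!: bexI[of _ "e / 2"] exI[of _ 0])
    ultimately have "\<forall>\<^sub>F n in A. f n \<in> U"
      using lim by (simp add: limitin_def openin_holo_topology)
    then show "\<forall>\<^sub>F n in A. \<forall>p\<in>K. dist (f n p) (F p) < e"
      by (rule eventually_mono) (force simp: U_def dist_norm)
  qed
next
  assume F: "F \<in> holo_bidisk" and f: "\<forall>\<^sub>F n in A. f n \<in> holo_bidisk"
    and u: "\<forall>K. compact K \<and> K \<subseteq> bidisk \<longrightarrow> uniform_limit K f F A"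
  show "limitin holo_topology f F A"
    unfolding limitin_def topspace_holo_topology openin_holo_topology
  proof (intro conjI allI impI F)
    fix U assume "holo_open U \<and> F \<in> U"
    then obtain K e where K: "compact K" "K \<subseteq> bidisk" "e > 0" "compact_nhd K e F \<subseteq> U"
      unfolding holo_open_def by blast
    then have "\<forall>\<^sub>F n in A. \<forall>p\<in>K. dist (f n p) (F p) < e"
      using u by (auto simp: uniform_limit_iff)
    with f show "\<forall>\<^sub>F n in A. f n \<in> U"
      by eventually_elim (use K in \<open>auto simp: compact_nhd_def dist_norm\<close>)
  qed
qed


section \<open>The eigenspaces\<close>

definition Delta_zw :: "(complex \<times> complex \<Rightarrow> complex) \<Rightarrow> complex \<times> complex \<Rightarrow> complex" where
  "Delta_zw F = (\<lambda>(z, w). 4 * (1 - z * w)\<^sup>2 * deriv (\<lambda>u. deriv (\<lambda>v. F (u, v)) w) z)"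

definition eigenspace :: "complex \<Rightarrow> (complex \<times> complex \<Rightarrow> complex) set" where
  "eigenspace lam = {F \<in> holo_bidisk. \<forall>p\<in>bidisk. Delta_zw F p = lam * F p}"


section \<open>The Moebius group of the bidisk\<close>

text \<open>The Riemann sphere is \<^typ>\<open>complex option\<close>, with \<^term>\<open>None\<close> as the point at infinity.\<close>

fun moebius :: "complex \<Rightarrow> complex \<Rightarrow> complex \<Rightarrow> complex \<Rightarrow> complex option \<Rightarrow> complex option" where
  "moebius a b c d (Some z) = (if c * z + d = 0 then None else Some ((a * z + b) / (c * z + d)))"
| "moebius a b c d None = (if c = 0 then None else Some (a / c))"

definition moebius_transformations :: "(complex option \<Rightarrow> complex option) set" where
  "moebius_transformations = {moebius a b c d | a b c d. a * d - b * c \<noteq> 0}"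

definition sphere_inverse :: "complex option \<Rightarrow> complex option" where
  "sphere_inverse = moebius 0 1 1 0"

definition moebius_group_direct ::
    "(complex option \<times> complex option \<Rightarrow> complex option \<times> complex option) set" where
  "moebius_group_direct =
     {(\<lambda>(z, w). (\<psi> z, sphere_inverse (\<psi> (sphere_inverse w)))) | \<psi>. \<psi> \<in> moebius_transformations}"

definition moebius_group ::
    "(complex option \<times> complex option \<Rightarrow> complex option \<times> complex option) set" where
  "moebius_group = moebius_group_direct \<union>
     {(\<lambda>(z, w). (\<psi> w, sphere_inverse (\<psi> (sphere_inverse z)))) | \<psi>. \<psi> \<in> moebius_transformations}"

definition holomorphic_map_bidisk :: "(complex \<times> complex \<Rightarrow> complex \<times> complex) \<Rightarrow> bool" where
  "holomorphic_map_bidisk T \<longleftrightarrow> T ` bidisk \<subseteq> bidisk \<and>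
     holomorphic2_on (fst \<circ> T) bidisk \<and> holomorphic2_on (snd \<circ> T) bidisk"

definition Aut_bidisk :: "(complex \<times> complex \<Rightarrow> complex \<times> complex) set" where
  "Aut_bidisk = {T. holomorphic_map_bidisk T \<and>
     (\<exists>S. holomorphic_map_bidisk S \<and> (\<forall>p\<in>bidisk. S (T p) = p \<and> T (S p) = p))}"

text \<open>
  The intersection of \<^term>\<open>Aut_bidisk\<close> with a set \<^term>\<open>M\<close> of self-maps of the product of two
  spheres: the automorphisms of the bidisk that are restrictions of maps in \<^term>\<open>M\<close>.  The
  values of \<^term>\<open>T\<close> off the bidisk are irrelevant.
\<close>

definition bidisk_automorphisms_from ::
    "(complex option \<times> complex option \<Rightarrow> complex option \<times> complex option) set \<Rightarrow>
     (complex \<times> complex \<Rightarrow> complex \<times> complex) set" where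
  "bidisk_automorphisms_from M = {T \<in> Aut_bidisk. \<exists>\<Phi>\<in>M.
     \<forall>(z, w)\<in>bidisk. \<Phi> (Some z, Some w) = (Some (fst (T (z, w))), Some (snd (T (z, w))))}"

definition moebius_group_bidisk :: "(complex \<times> complex \<Rightarrow> complex \<times> complex) set" where
  "moebius_group_bidisk = bidisk_automorphisms_from moebius_group"

text \<open>
  The subgroup of those maps in \<^term>\<open>moebius_group_bidisk\<close> that do not exchange the two variables.
  The flip \<open>(z, w) \<mapsto> (w, z)\<close> belongs to \<^term>\<open>moebius_group_bidisk\<close> but not to this subgroup; it
  sends the Poisson mode of index \<open>n\<close> to the one of index \<open>-n\<close> and so exchanges the spaces
  \<open>X_plus m\<close> and \<open>X_minus m\<close> below, which are therefore invariant under the subgroup only.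
\<close>

definition moebius_group_bidisk_direct :: "(complex \<times> complex \<Rightarrow> complex \<times> complex) set" where
  "moebius_group_bidisk_direct = bidisk_automorphisms_from moebius_group_direct"

definition invariant_subspace ::
    "(complex \<times> complex \<Rightarrow> complex \<times> complex) set \<Rightarrow> complex \<Rightarrow>
     (complex \<times> complex \<Rightarrow> complex) set \<Rightarrow> bool" where
  "invariant_subspace G lam Y \<longleftrightarrow>
     cfun.subspace Y \<and>
     closedin (subtopology holo_topology (eigenspace lam)) Y \<and>
     (\<forall>F\<in>Y. \<forall>T\<in>G. restrict_bidisk (F \<circ> T) \<in> Y)"

definition nontrivial_invariant_subspaces ::
    "(complex \<times> complex \<Rightarrow> complex \<times> complex) set \<Rightarrow> complex \<Rightarrow>
     (complex \<times> complex \<Rightarrow> complex) set set" where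
  "nontrivial_invariant_subspaces G lam =
     {Y. invariant_subspace G lam Y \<and> Y \<noteq> {0} \<and> Y \<noteq> eigenspace lam}"


section \<open>Poisson Fourier modes\<close>

text \<open>
  The library's \<open>powr\<close> on complex numbers is the principal branch, and every base below has
  positive real part.
\<close>

definition poisson_mode :: "complex \<Rightarrow> int \<Rightarrow> complex \<times> complex \<Rightarrow> complex" where
  "poisson_mode \<mu> n = restrict_bidisk (\<lambda>(z, w).
     (1 - z * w) powr \<mu> / (2 * of_real pi) *
     integral {0..2 * pi} (\<lambda>t.
       exp (- \<i> * of_int n * of_real t) /
       ((1 - z * exp (- \<i> * of_real t)) powr \<mu> * (1 - w * exp (\<i> * of_real t)) powr \<mu>)))"

definition X_plus :: "nat \<Rightarrow> (complex \<times> complex \<Rightarrow> complex) set" where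
  "X_plus m = holo_topology closure_of
     cfun.span {poisson_mode (of_nat (m + 1)) n | n. - int m \<le> n}"

definition X_minus :: "nat \<Rightarrow> (complex \<times> complex \<Rightarrow> complex) set" where
  "X_minus m = holo_topology closure_of
     cfun.span {poisson_mode (of_nat (m + 1)) n | n. n \<le> int m}"

definition X_zero :: "nat \<Rightarrow> (complex \<times> complex \<Rightarrow> complex) set" where
  "X_zero m = cfun.span {poisson_mode (of_nat (m + 1)) n | n. - int m \<le> n \<and> n \<le> int m}"

end

theory Submission
  imports Defs "HOL-Complex_Analysis.Complex_Analysis"
begin

text \<open>
  The rotations \<open>(z, w) \<mapsto> (z e\<^sup>-\<^sup>i\<^sup>t, w e\<^sup>i\<^sup>t)\<close> split an eigenfunction into homogeneous modes, and the eigenvalue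
  equation shows that an eigenfunction is determined by the Taylor coefficients of \<open>F(0, w)\<close> and
  \<open>F(z, 0)\<close>, which give one number for every integer (\<open>lead k F\<close> below).  Hence each mode space is at most
  one-dimensional, the mode expansion converges locally uniformly, and a closed rotation invariant
  subspace is described by the set of indices that occur in it.  Differentiating the action of
  \<open>z \<mapsto> (z + s) / (s z + 1)\<close> at \<open>s = 0\<close> moves an occurring index \<open>k\<close> to \<open>k + 1\<close> and \<open>k - 1\<close>,
  unless \<open>\<lambda> = 4 k (k + 1)\<close> with \<open>k \<ge> 0\<close> or \<open>\<lambda> = 4 k (k - 1)\<close> with \<open>k \<le> 0\<close>, respectively; this
  leaves the listed index sets only.  Conversely, for \<open>\<lambda> = 4 m (m + 1)\<close> the eigenfunctions with
  indices at least \<open>- m\<close> are those for which \<open>(1 - z w)\<^sup>m F\<close> is a polynomial in \<open>z\<close> of degree at most \<open>m\<close>,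
  a condition that survives Moebius maps.
\<close>

section \<open>Jointly holomorphic functions of two variables\<close>

text \<open>Everything is reduced to one-variable complex analysis on slices. Joint holomorphy is
  encoded as continuity plus holomorphy in each variable: the uniform limit theorem and Weierstrass'
  theorem preserve this form, and continuity makes estimates on slices locally uniform. Two
  principles replace explicit formulas. Since \<open>eigenspace_eq_0\<close> fixes an eigenfunction
  by its numbers \<open>lead k F\<close>, identities inside an eigenspace (behaviour of a mode under
  rotations, sum of the mode series, proportionality of modes) are proved by comparing these
  numbers. And \<open>mode_part\<close> is a locally uniform limit of finite combinations of rotated
  copies, so closed rotation invariant subspaces contain the modes of their members, with no
  differentiation under the integral sign. For generic \<lambda> no mode has to be exhibited: one
  occurring index reaches all others. For \<lambda> = 4 m (m + 1) the shift up is blocked at m and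
  the shift down at -m, and the Poisson kernel shows that every integer does occur, which keeps the
  three spaces apart.\<close>

definition jointly_holomorphic :: "(complex \<times> complex \<Rightarrow> complex) \<Rightarrow> complex set \<Rightarrow> complex set \<Rightarrow> bool" where
  "jointly_holomorphic F U V \<longleftrightarrow> continuous_on (U \<times> V) F \<and>
     (\<forall>w\<in>V. (\<lambda>z. F (z, w)) holomorphic_on U) \<and> (\<forall>z\<in>U. (\<lambda>w. F (z, w)) holomorphic_on V)"

definition dz :: "(complex \<times> complex \<Rightarrow> complex) \<Rightarrow> complex \<times> complex \<Rightarrow> complex" where
  "dz F = (\<lambda>(z, w). deriv (\<lambda>u. F (u, w)) z)"

definition dw :: "(complex \<times> complex \<Rightarrow> complex) \<Rightarrow> complex \<times> complex \<Rightarrow> complex" where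
  "dw F = (\<lambda>(z, w). deriv (\<lambda>v. F (z, v)) w)"

lemma jointly_holomorphicD:
  assumes "jointly_holomorphic F U V"
  shows "continuous_on (U \<times> V) F" "w \<in> V \<Longrightarrow> (\<lambda>z. F (z, w)) holomorphic_on U"
    "z \<in> U \<Longrightarrow> (\<lambda>w. F (z, w)) holomorphic_on V"
  using assms by (auto simp: jointly_holomorphic_def)

lemma jointly_holomorphic_swap: "jointly_holomorphic F U V \<Longrightarrow> jointly_holomorphic (F \<circ> prod.swap) V U"
  unfolding jointly_holomorphic_def
  by (auto simp: o_def prod.swap_def intro!: continuous_on_compose2[of "U \<times> V" F] continuous_intros)

lemma dw_swap: "dw (F \<circ> prod.swap) = dz F \<circ> prod.swap"
  by (auto simp: dw_def dz_def fun_eq_iff)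

lemma dz_swap: "dz (F \<circ> prod.swap) = dw F \<circ> prod.swap"
  by (auto simp: dw_def dz_def fun_eq_iff)

lemma dw_has_derivative:
  assumes "jointly_holomorphic F U V" "open V" "z \<in> U" "w \<in> V"
  shows "((\<lambda>v. F (z, v)) has_field_derivative dw F (z, w)) (at w)"
  using jointly_holomorphicD(3)[OF assms(1) assms(3)] assms(2,4)
  by (auto simp: dw_def intro!: holomorphic_derivI)

lemma dz_has_derivative:
  assumes "jointly_holomorphic F U V" "open U" "z \<in> U" "w \<in> V"
  shows "((\<lambda>u. F (u, w)) has_field_derivative dz F (z, w)) (at z)"
  using jointly_holomorphicD(2)[OF assms(1) assms(4)] assms(2,3)
  by (auto simp: dz_def intro!: holomorphic_derivI)

text \<open>Cauchy's inequality applied to \<open>f - g\<close>; through it \<open>dw\<close>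
  inherits uniform estimates from \<open>F\<close>.\<close>

lemma cauchy_deriv_diff:
  assumes "f holomorphic_on V" "g holomorphic_on V" "open V" "cball w r \<subseteq> V" "r > 0"
    "\<And>v. v \<in> cball w r \<Longrightarrow> norm (f v - g v) \<le> B"
  shows "norm (deriv f w - deriv g w) \<le> B / r"
proof -
  have wV: "w \<in> V" using assms(4,5) by (meson centre_in_cball less_imp_le subsetD)
  have h: "(\<lambda>v. f v - g v) holomorphic_on V" using assms by (intro holomorphic_intros)
  have "norm ((deriv ^^ 1) (\<lambda>v. f v - g v) w) \<le> fact 1 * B / r ^ 1"
  proof (rule Cauchy_inequality)
    show "(\<lambda>v. f v - g v) holomorphic_on ball w r"
      using h assms(4) by (meson ball_subset_cball holomorphic_on_subset subset_trans)
    show "continuous_on (cball w r) (\<lambda>v. f v - g v)"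
      using h assms(4) by (meson holomorphic_on_imp_continuous_on continuous_on_subset)
    show "norm (f x - g x) \<le> B" if "norm (w - x) = r" for x
      using that assms(6)[of x] by (simp add: dist_norm)
  qed (use assms in auto)
  moreover have "deriv (\<lambda>v. f v - g v) w = deriv f w - deriv g w"
    using assms wV by (intro deriv_diff) (auto simp: holomorphic_on_imp_differentiable_at)
  ultimately show ?thesis by simp
qed

text \<open>The increment is split. First \<open>z\<close> moves while \<open>w\<close> stays:
  compactness of a disc around \<open>w0\<close> makes \<open>F\<close> uniformly close, and
  Cauchy's estimate transfers this to \<open>dw F\<close>. Then \<open>w\<close> moves along the
  single slice \<open>z0\<close>, on which \<open>dw F\<close> is the derivative of a holomorphic
  function.\<close>

lemma continuous_dw:
  assumes F: "jointly_holomorphic F U V" and op: "open U" "open V"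
  shows "continuous_on (U \<times> V) (dw F)"
  unfolding continuous_on_eq_continuous_within continuous_within tendsto_iff
proof (intro ballI allI impI, clarify)
  fix z0 w0 :: complex and e :: real
  assume z0: "z0 \<in> U" and w0: "w0 \<in> V" and e: "e > 0"
  obtain R where R: "R > 0" "cball w0 R \<subseteq> V"
    using op(2) w0 open_contains_cball by blast
  \<comment> \<open>A disc of radius \<open>2*r\<close> has room for a Cauchy disc of radius
    \<open>r\<close> around every point of \<open>ball w0 r\<close>. The tolerance
    \<open>e * r / 2\<close> below becomes \<open>e / 2\<close> after division by
    \<open>r\<close>.\<close>
  define r where "r = R / 2"
  have r: "r > 0" "cball w0 (2*r) \<subseteq> V" using R by (auto simp: r_def)
  have contF: "continuous_on (U \<times> cball w0 (2*r)) F"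
    using jointly_holomorphicD(1)[OF F] r by (meson Sigma_mono continuous_on_subset order_refl)
  obtain X0 where X0: "z0 \<in> X0" "open X0"
    "\<forall>x\<in>X0 \<inter> U. \<forall>t\<in>cball w0 (2*r). dist (F (x, t)) (F (z0, t)) \<le> e * r / 2"
    using continuous_on_prod_compactE[OF contF compact_cball z0, of "e * r / 2"] e r by auto
  have 1: "norm (dw F (z, w) - dw F (z0, w)) \<le> e / 2" if z: "z \<in> X0 \<inter> U" and w: "w \<in> ball w0 r" for z w
  proof -
    have sub: "cball w r \<subseteq> cball w0 (2*r)"
      using w by (intro subsetI) (metis add_mono_thms_linordered_semiring(1) dist_commute dist_triangle_le less_imp_le mem_ball mem_cball mult_2)
    have "norm (dw F (z, w) - dw F (z0, w)) \<le> (e * r / 2) / r"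
      unfolding dw_def prod.case
      by (rule cauchy_deriv_diff[where V = V])
        (use F z z0 sub r X0 op in \<open>auto simp: jointly_holomorphic_def dist_norm\<close>)
    with r show ?thesis by simp
  qed
  have "continuous_on V (\<lambda>w. dw F (z0, w))"
    unfolding dw_def prod.case
    using jointly_holomorphicD(3)[OF F z0] op by (intro holomorphic_on_imp_continuous_on holomorphic_deriv)
  then have "\<forall>\<^sub>F w in nhds w0. dist (dw F (z0, w)) (dw F (z0, w0)) < e / 2"
    using w0 op e by (metis continuous_on_eq_continuous_at half_gt_zero isCont_def tendsto_at_iff_tendsto_nhds tendsto_iff)
  then obtain W where W: "open W" "w0 \<in> W" "\<And>w. w \<in> W \<Longrightarrow> dist (dw F (z0, w)) (dw F (z0, w0)) < e / 2"
    unfolding eventually_nhds by blast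
  have "open (X0 \<times> (W \<inter> ball w0 r))" "(z0, w0) \<in> X0 \<times> (W \<inter> ball w0 r)"
    using X0 W r by (auto intro!: open_Times)
  moreover have "dist (dw F p) (dw F (z0, w0)) < e" if "p \<in> X0 \<times> (W \<inter> ball w0 r)" "p \<in> U \<times> V" for p
  proof -
    obtain z w where p1: "p = (z, w)" by (cases p)
    have p: "p = (z, w)" "z \<in> X0 \<inter> U" "w \<in> W" "w \<in> ball w0 r"
      using that p1 by simp_all
    have "dist (dw F (z, w)) (dw F (z0, w0)) \<le> dist (dw F (z, w)) (dw F (z0, w)) + dist (dw F (z0, w)) (dw F (z0, w0))"
      by (rule dist_triangle)
    then show ?thesis using 1[OF p(2,4)] W(3)[OF p(3)] unfolding p(1) dist_norm by linarith
  qed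
  ultimately show "\<forall>\<^sub>F p in at (z0, w0) within U \<times> V. dist (dw F p) (dw F (z0, w0)) < e"
    unfolding eventually_at_topological by blast
qed

text \<open>The difference quotients in \<open>w\<close> converge uniformly in \<open>z\<close> near
  \<open>z0\<close>, and for holomorphic functions uniform convergence passes to all derivatives.
  The case \<open>j = 1\<close> yields equality of the mixed derivatives; general \<open>j\<close>
  allows Taylor coefficients in \<open>z\<close> to be differentiated in \<open>w\<close>.\<close>

lemma higher_deriv_slice_has_derivative:
  assumes F: "jointly_holomorphic F U V" and op: "open U" "open V" and z0: "z0 \<in> U" and w0: "w0 \<in> V"
  shows "((\<lambda>w. (deriv ^^ j) (\<lambda>z. F (z, w)) z0) has_field_derivative
           (deriv ^^ j) (\<lambda>z. dw F (z, w0)) z0) (at w0)"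
proof -
  obtain r where r: "r > 0" "cball z0 r \<subseteq> U"
    using op(1) z0 open_contains_cball by blast
  define Q where "Q = (\<lambda>h z. (F (z, w0 + h) - F (z, w0)) * inverse h)"
  have cont: "continuous_on (V \<times> cball z0 r) (\<lambda>(w, z). dw F (z, w))"
    unfolding case_prod_beta
    by (rule continuous_on_compose2[OF continuous_dw[OF F op]])
      (use r in \<open>auto intro!: continuous_intros\<close>)
  have inV: "\<forall>\<^sub>F h in at 0. w0 + h \<in> V"
  proof -
    have "((\<lambda>h. w0 + h) \<longlongrightarrow> w0 + 0) (at 0)" by (intro tendsto_intros)
    then show ?thesis using op(2) w0 by (auto intro: topological_tendstoD)
  qed
  have ul: "uniform_limit (cball z0 r) Q (\<lambda>z. dw F (z, w0)) (at 0)"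
    unfolding uniform_limit_iff
  proof (intro allI impI)
    fix e :: real assume e: "e > 0"
    obtain W where W: "w0 \<in> W" "open W"
      "\<forall>w\<in>W \<inter> V. \<forall>z\<in>cball z0 r. dist (dw F (z, w)) (dw F (z, w0)) \<le> e / 2"
      using continuous_on_prod_compactE[OF cont compact_cball w0, of "e / 2"] e by auto
    obtain d where d: "d > 0" "ball w0 d \<subseteq> W \<inter> V"
      using W op(2) w0 by (metis IntI open_Int open_contains_ball)
    have "dist (Q h z) (dw F (z, w0)) < e" if h: "h \<noteq> 0" "dist h 0 < d" and z: "z \<in> cball z0 r" for h z
    proof -
      have zU: "z \<in> U" using z r by auto
      \<comment> \<open>Mean value estimate for \<open>F (z, v) - v * dw F (z, w0)\<close> as a
        function of \<open>v\<close>: its derivative has norm at most \<open>e / 2\<close> on the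
        ball, for all \<open>z\<close> at once.\<close>
      have "norm ((F (z, w0 + h) - (w0 + h) * dw F (z, w0)) - (F (z, w0) - w0 * dw F (z, w0)))
            \<le> e / 2 * norm (w0 + h - w0)"
      proof (rule field_differentiable_bound[of "ball w0 d" _ "\<lambda>v. dw F (z, v) - dw F (z, w0)"])
        fix v assume v: "v \<in> ball w0 d"
        have "((\<lambda>v. F (z, v)) has_field_derivative dw F (z, v)) (at v)"
          using v d by (intro dw_has_derivative[OF F op(2) zU]) auto
        from DERIV_diff[OF this DERIV_cmult_right[OF DERIV_ident]]
        show "((\<lambda>v. F (z, v) - v * dw F (z, w0)) has_field_derivative dw F (z, v) - dw F (z, w0))
             (at v within ball w0 d)"
          by (simp add: has_field_derivative_at_within)
        show "norm (dw F (z, v) - dw F (z, w0)) \<le> e / 2"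
        proof -
          have "v \<in> W \<inter> V" using v d by blast
          then show ?thesis using W(3) z unfolding dist_norm by blast
        qed
      qed (use d h in \<open>auto simp: dist_norm\<close>)
      then have *: "norm (F (z, w0 + h) - F (z, w0) - h * dw F (z, w0)) \<le> e / 2 * norm h"
        by (simp add: algebra_simps)
      have "Q h z - dw F (z, w0) = (F (z, w0 + h) - F (z, w0) - h * dw F (z, w0)) / h"
        using h by (simp add: Q_def divide_simps)
      then have "norm (Q h z - dw F (z, w0)) \<le> e / 2"
        using mult_imp_div_pos_le[OF _ *] h by (simp add: norm_divide)
      then show ?thesis using e by (simp add: dist_norm)
    qed
    then show "\<forall>\<^sub>F h in at 0. \<forall>z\<in>cball z0 r. dist (Q h z) (dw F (z, w0)) < e"
      unfolding eventually_at using d by blast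
  qed
  have holU: "(\<lambda>z. F (z, w)) holomorphic_on ball z0 r" if "w \<in> V" for w
    using jointly_holomorphicD(2)[OF F that] r by (meson ball_subset_cball holomorphic_on_subset subset_trans)
  have Qhol: "\<forall>\<^sub>F h in at 0. Q h holomorphic_on ball z0 r"
    using inV by eventually_elim (auto simp: Q_def intro!: holomorphic_intros holU w0)
  have "((\<lambda>h. (deriv ^^ j) (Q h) z0) \<longlongrightarrow> (deriv ^^ j) (\<lambda>z. dw F (z, w0)) z0) (at 0)"
    by (rule higher_deriv_complex_uniform_limit[OF uniform_limit_on_subset[OF ul ball_subset_cball] Qhol])
      (use r in auto)
  moreover have "\<forall>\<^sub>F h in at 0. (deriv ^^ j) (Q h) z0 =
      ((deriv ^^ j) (\<lambda>z. F (z, w0 + h)) z0 - (deriv ^^ j) (\<lambda>z. F (z, w0)) z0) / h"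
    using inV
  proof eventually_elim
    case (elim h)
    have Q: "Q h = (\<lambda>z. inverse h * (F (z, w0 + h) - F (z, w0)))" by (simp add: Q_def fun_eq_iff mult.commute)
    show ?case unfolding Q
      using r by (subst higher_deriv_cmult[of _ "ball z0 r"])
        (auto simp: higher_deriv_diff[OF holU holU] elim w0 divide_inverse intro!: holomorphic_intros holU)
  qed
  ultimately show ?thesis
    unfolding DERIV_def by (rule Lim_transform_eventually)
qed

lemma dz_dw_commute:
  assumes F: "jointly_holomorphic F U V" and op: "open U" "open V" and z: "z \<in> U" and w: "w \<in> V"
  shows "dw (dz F) (z, w) = dz (dw F) (z, w)"
  using DERIV_imp_deriv[OF higher_deriv_slice_has_derivative[OF F op z w, of 1]]
  by (simp add: dw_def dz_def)

lemma jointly_holomorphic_dz: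
  assumes F: "jointly_holomorphic F U V" and op: "open U" "open V"
  shows "jointly_holomorphic (dz F) U V"
  unfolding jointly_holomorphic_def
proof (intro conjI ballI)
  have "continuous_on (V \<times> U) (dw (F \<circ> prod.swap))"
    using jointly_holomorphic_swap[OF F] op by (intro continuous_dw)
  then have "continuous_on (prod.swap ` (U \<times> V)) (dz F \<circ> prod.swap)" by (simp add: dw_swap product_swap)
  then have "continuous_on (U \<times> V) ((dz F \<circ> prod.swap) \<circ> prod.swap)"
    by (rule continuous_on_compose[rotated]) (auto intro!: continuous_intros simp: prod.swap_def)
  then show "continuous_on (U \<times> V) (dz F)" by (simp add: o_assoc[symmetric])
  show "(\<lambda>z. dz F (z, w)) holomorphic_on U" if "w \<in> V" for w
    using jointly_holomorphicD(2)[OF F that] op by (auto simp: dz_def intro!: holomorphic_deriv)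
  show "(\<lambda>w. dz F (z, w)) holomorphic_on V" if "z \<in> U" for z
    using higher_deriv_slice_has_derivative[OF F op that, of _ 1] op
    by (auto simp: holomorphic_on_open dz_def)
qed

lemma jointly_holomorphic_dw:
  assumes F: "jointly_holomorphic F U V" and op: "open U" "open V"
  shows "jointly_holomorphic (dw F) U V"
proof -
  have "jointly_holomorphic (dz (F \<circ> prod.swap)) V U" using jointly_holomorphic_swap[OF F] op by (intro jointly_holomorphic_dz)
  then have "jointly_holomorphic ((dw F \<circ> prod.swap) \<circ> prod.swap) U V" unfolding dz_swap by (rule jointly_holomorphic_swap)
  then show ?thesis by (simp add: o_assoc[symmetric])
qed

text \<open>One partial derivative at the point together with continuity of the other gives the
  total derivative; the continuity comes from \<open>continuous_dw\<close>.\<close>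

lemma jointly_holomorphic_imp_has_derivative:
  assumes F: "jointly_holomorphic F U V" and op: "open U" "open V" and "convex V" and z: "z \<in> U" and w: "w \<in> V"
  shows "(F has_derivative (\<lambda>(h, k). dz F (z, w) * h + dw F (z, w) * k)) (at (z, w) within U \<times> V)"
proof -
  have bl: "bounded_linear ((*) (c::complex))" for c by (rule bounded_linear_mult_right)
  have "((\<lambda>(x, y). curry F x y) has_derivative
     (\<lambda>(h, k). dz F (z, w) * h + blinfun_mult_right (dw F (z, w)) k)) (at (z, w) within U \<times> V)"
  proof (rule has_derivative_partialsI)
    show "((\<lambda>x. curry F x w) has_derivative (*) (dz F (z, w))) (at z within U)"
      using dz_has_derivative[OF F op(1) z w] by (simp add: has_field_derivative_def has_derivative_at_withinI)
    show "(curry F x has_derivative blinfun_apply (blinfun_mult_right (dw F (x, y)))) (at y within V)"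
      if "x \<in> U" "y \<in> V" for x y
      using dw_has_derivative[OF F op(2) that] by (simp add: has_field_derivative_def has_derivative_at_withinI curry_def)
    have "continuous (at (z, w) within U \<times> V) (dw F)"
      using continuous_dw[OF F op] z w by (auto simp: continuous_on_eq_continuous_within)
    then show "continuous (at (z, w) within U \<times> V) (\<lambda>(x, y). blinfun_mult_right (dw F (x, y)))"
      unfolding case_prod_beta prod.collapse
      by (rule bounded_linear.continuous[OF bounded_linear_blinfun_mult_right])
  qed (use assms in auto)
  then show ?thesis by (simp add: curry_def)
qed

lemma holomorphic2_on_imp_jointly_holomorphic:
  assumes F: "holomorphic2_on F (U \<times> V)" and op: "open U" "open V"
  shows "jointly_holomorphic F U V"
  unfolding jointly_holomorphic_def
proof (intro conjI ballI)
  have D: "\<exists>a b. (F has_derivative (\<lambda>(h, k). a * h + b * k)) (at (z, w))" if "z \<in> U" "w \<in> V" for z w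
    using F that op unfolding holomorphic2_on_def
    by (metis at_within_open mem_Sigma_iff open_Times)
  show "continuous_on (U \<times> V) F"
    using F unfolding holomorphic2_on_def continuous_on_eq_continuous_within
    by (meson has_derivative_continuous)
  show "(\<lambda>z. F (z, w)) holomorphic_on U" if w: "w \<in> V" for w
    unfolding holomorphic_on_open[OF op(1)]
  proof (intro ballI)
    fix z assume "z \<in> U"
    then obtain a b where "(F has_derivative (\<lambda>(h, k). a * h + b * k)) (at (z, w))" using D w by blast
    then have "((\<lambda>z. F (z, w)) has_derivative (\<lambda>h. (\<lambda>(h, k). a * h + b * k) (h, 0))) (at z)"
      by (intro has_derivative_compose[of "\<lambda>z. (z, w)" "\<lambda>h. (h, 0)" z UNIV F]) (auto intro!: derivative_eq_intros)
    then show "\<exists>f'. ((\<lambda>z. F (z, w)) has_field_derivative f') (at z)"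
      unfolding has_field_derivative_def by auto
  qed
  show "(\<lambda>w. F (z, w)) holomorphic_on V" if z: "z \<in> U" for z
    unfolding holomorphic_on_open[OF op(2)]
  proof (intro ballI)
    fix w assume "w \<in> V"
    then obtain a b where "(F has_derivative (\<lambda>(h, k). a * h + b * k)) (at (z, w))" using D z by blast
    then have "((\<lambda>w. F (z, w)) has_derivative (\<lambda>h. (\<lambda>(h, k). a * h + b * k) (0, h))) (at w)"
      by (intro has_derivative_compose[of "\<lambda>w. (z, w)" "\<lambda>h. (0, h)" w UNIV F]) (auto intro!: derivative_eq_intros)
    then show "\<exists>f'. ((\<lambda>w. F (z, w)) has_field_derivative f') (at w)"
      unfolding has_field_derivative_def by auto
  qed
qed

abbreviation disc :: "complex set" where "disc \<equiv> ball 0 1"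

lemma holomorphic2_on_iff_jointly_holomorphic: "holomorphic2_on F bidisk \<longleftrightarrow> jointly_holomorphic F disc disc"
proof
  assume "jointly_holomorphic F disc disc"
  then show "holomorphic2_on F bidisk"
    unfolding holomorphic2_on_def bidisk_def by (auto dest: jointly_holomorphic_imp_has_derivative)
qed (auto simp: bidisk_def intro: holomorphic2_on_imp_jointly_holomorphic)

lemma holo_bidisk_iff: "F \<in> holo_bidisk \<longleftrightarrow> jointly_holomorphic F disc disc \<and> (\<forall>p. p \<notin> bidisk \<longrightarrow> F p = 0)"
  by (simp add: holo_bidisk_def holomorphic2_on_iff_jointly_holomorphic)

section \<open>Taylor coefficients of eigenfunctions\<close>

definition taylor_coeff :: "(complex \<Rightarrow> complex) \<Rightarrow> nat \<Rightarrow> complex" where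
  "taylor_coeff f n = (deriv ^^ n) f 0 / fact n"

lemma taylor_coeff_fps: "f has_fps_expansion A \<Longrightarrow> taylor_coeff f n = fps_nth A n"
  by (simp add: taylor_coeff_def fps_nth_fps_expansion)

lemma has_fps_expansion_taylor_coeff:
  assumes "f holomorphic_on S" "open S" "0 \<in> S"
  shows "f has_fps_expansion Abs_fps (taylor_coeff f)"
proof -
  have "f has_fps_expansion fps_expansion f 0"
    using assms by (intro has_fps_expansion_fps_expansion[of S])
  moreover have "fps_expansion f 0 = Abs_fps (taylor_coeff f)"
    by (simp add: fps_expansion_def taylor_coeff_def[abs_def])
  ultimately show ?thesis by simp
qed

lemma taylor_coeff_eq_0_imp_0:
  assumes "f holomorphic_on disc" "\<And>n. taylor_coeff f n = 0" "z \<in> disc"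
  shows "f z = 0"
  using assms(2) holomorphic_fun_eq_0_on_ball[OF assms(1,3)]
  by (simp add: taylor_coeff_def)

lemma taylor_coeff_finite:
  assumes "f holomorphic_on disc" "\<And>n. n > m \<Longrightarrow> taylor_coeff f n = 0" "z \<in> disc"
  shows "f z = (\<Sum>n\<le>m. taylor_coeff f n * z ^ n)"
proof -
  have "((\<lambda>n. taylor_coeff f n * z ^ n) sums f z)"
    using holomorphic_power_series[OF assms(1,3)] by (simp add: taylor_coeff_def)
  moreover have "((\<lambda>n. taylor_coeff f n * z ^ n) sums (\<Sum>n\<le>m. taylor_coeff f n * z ^ n))"
    by (rule sums_finite) (use assms(2) in auto)
  ultimately show ?thesis by (rule sums_unique2)
qed

lemma taylor_coeff_polynomial:
  assumes "\<And>z. z \<in> disc \<Longrightarrow> f z = (\<Sum>n\<le>m. c n * z ^ n)" "n > m"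
  shows "taylor_coeff f n = 0"
proof -
  have "(\<lambda>z. \<Sum>n\<le>m. c n * z ^ n) has_fps_expansion (\<Sum>n\<le>m. fps_const (c n) * fps_X ^ n)"
    by (intro fps_expansion_intros)
  moreover have "eventually (\<lambda>z. f z = (\<Sum>n\<le>m. c n * z ^ n)) (nhds 0)"
    using assms(1) by (auto simp: eventually_nhds intro!: exI[of _ disc])
  ultimately have "f has_fps_expansion (\<Sum>n\<le>m. fps_const (c n) * fps_X ^ n)"
    by (subst has_fps_expansion_cong) auto
  then have "taylor_coeff f n = fps_nth (\<Sum>n\<le>m. fps_const (c n) * fps_X ^ n) n" by (rule taylor_coeff_fps)
  then show ?thesis using assms(2) by (simp add: fps_sum_nth)
qed

text \<open>The rotation \<open>(z, w)\<close> to \<open>(z e^(-it), w e^(it))\<close> multiplies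
  z^a w^b by e^(i(b - a)t). Hence \<open>lead k F\<close> is the coefficient of the monomial of
  lowest degree among those of weight \<open>k\<close>: w^k for \<open>k \<ge> 0\<close>, z^(-k) for
  \<open>k < 0\<close>. For \<open>k = 0\<close> both axes give \<open>F (0, 0)\<close>.\<close>

definition lead :: "int \<Rightarrow> (complex \<times> complex \<Rightarrow> complex) \<Rightarrow> complex" where
  "lead k F = (if k \<ge> 0 then taylor_coeff (\<lambda>w. F (0, w)) (nat k) else taylor_coeff (\<lambda>z. F (z, 0)) (nat (- k)))"

lemma lead_nonneg: "lead (int n) F = taylor_coeff (\<lambda>w. F (0, w)) n"
  by (simp add: lead_def)

lemma lead_nonpos: "lead (- int n) F = taylor_coeff (\<lambda>z. F (z, 0)) n"
  by (auto simp: lead_def taylor_coeff_def)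

lemma lead_swap: "lead k (F \<circ> prod.swap) = lead (- k) F"
  by (auto simp: lead_def taylor_coeff_def)

lemma taylor_coeff_slice_has_derivative:
  assumes F: "jointly_holomorphic F U V" and op: "open U" "open V" and "0 \<in> U" "w \<in> V"
  shows "((\<lambda>w. taylor_coeff (\<lambda>z. F (z, w)) j) has_field_derivative taylor_coeff (\<lambda>z. dw F (z, w)) j) (at w)"
  unfolding taylor_coeff_def using higher_deriv_slice_has_derivative[OF assms] by (intro DERIV_cdivide)

lemma eigenspace_iff:
  "F \<in> eigenspace lam \<longleftrightarrow> F \<in> holo_bidisk \<and>
     (\<forall>z\<in>disc. \<forall>w\<in>disc. 4 * (1 - z * w)\<^sup>2 * dz (dw F) (z, w) = lam * F (z, w))"
  unfolding eigenspace_def Delta_zw_def dz_def dw_def bidisk_def by auto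

lemma eigenspaceD:
  assumes "F \<in> eigenspace lam"
  shows "F \<in> holo_bidisk" "jointly_holomorphic F disc disc" "p \<notin> bidisk \<Longrightarrow> F p = 0"
    "z \<in> disc \<Longrightarrow> w \<in> disc \<Longrightarrow> 4 * (1 - z * w)\<^sup>2 * dz (dw F) (z, w) = lam * F (z, w)"
  using assms by (simp_all add: eigenspace_iff holo_bidisk_iff del: split_paired_All)

text \<open>As a function of \<open>w\<close>, the \<open>j\<close>-th coefficient in
  \<open>z\<close> has as its derivative the \<open>j\<close>-th coefficient of \<open>dw F\<close>.
  It is therefore constant and equal to its value at \<open>w = 0\<close>.\<close>

lemma vanishing_coefficients_step:
  assumes F: "jointly_holomorphic F disc disc" and F0: "taylor_coeff (\<lambda>z. F (z, 0)) j = 0"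
    and step: "\<And>w. w \<in> disc \<Longrightarrow> taylor_coeff (\<lambda>z. dw F (z, w)) j = 0" and w: "w \<in> disc"
  shows "taylor_coeff (\<lambda>z. F (z, w)) j = 0"
proof -
  have "\<exists>c. \<forall>w\<in>disc. taylor_coeff (\<lambda>z. F (z, w)) j = c"
  proof (rule has_field_derivative_zero_constant)
    show "((\<lambda>w. taylor_coeff (\<lambda>z. F (z, w)) j) has_field_derivative 0) (at x within disc)" if "x \<in> disc" for x
      using taylor_coeff_slice_has_derivative[OF F _ _ _ that, of j] step[OF that]
      by (simp add: has_field_derivative_at_within)
  qed simp
  then show ?thesis using F0 w by (metis centre_in_ball zero_less_one)
qed

lemma vanishing_coefficients_deriv:
  assumes F: "jointly_holomorphic F disc disc" and "\<And>w. w \<in> disc \<Longrightarrow> taylor_coeff (\<lambda>z. F (z, w)) j = 0" and w: "w \<in> disc"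
  shows "taylor_coeff (\<lambda>z. dw F (z, w)) j = 0"
proof -
  have "((\<lambda>w. 0) has_field_derivative taylor_coeff (\<lambda>z. dw F (z, w)) j) (at w)"
    by (rule has_field_derivative_transform_within_open[OF taylor_coeff_slice_has_derivative[OF F], where S = disc])
      (use assms in auto)
  then show ?thesis by (metis DERIV_const DERIV_unique)
qed

text \<open>With \<open>w\<close> frozen, the eigenvalue equation is an identity of formal power
  series in \<open>z\<close>, from which recurrences for the coefficients can be read off.\<close>

lemma eigenfunction_fps:
  assumes F: "F \<in> eigenspace lam" and w: "w \<in> disc"
  shows "fps_const 4 * (1 - fps_const w * fps_X) ^ 2 * fps_deriv (Abs_fps (taylor_coeff (\<lambda>z. dw F (z, w))))
     = fps_const lam * Abs_fps (taylor_coeff (\<lambda>z. F (z, w)))" (is "?A = ?B")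
proof -
  note h = eigenspaceD(2)[OF F]
  have 1: "(\<lambda>z. F (z, w)) has_fps_expansion Abs_fps (taylor_coeff (\<lambda>z. F (z, w)))"
    using jointly_holomorphicD(2)[OF h w] by (intro has_fps_expansion_taylor_coeff) auto
  have 2: "(\<lambda>z. dw F (z, w)) has_fps_expansion Abs_fps (taylor_coeff (\<lambda>z. dw F (z, w)))"
    using jointly_holomorphicD(2)[OF jointly_holomorphic_dw[OF h] w] by (intro has_fps_expansion_taylor_coeff) auto
  have "(\<lambda>z. 4 * (1 - w * z) ^ 2 * deriv (\<lambda>z. dw F (z, w)) z) has_fps_expansion ?A"
    by (intro fps_expansion_intros 2)
  moreover have "(\<lambda>z. lam * F (z, w)) has_fps_expansion ?B"
    by (intro fps_expansion_intros 1)
  moreover have ev: "eventually (\<lambda>z. 4 * (1 - w * z) ^ 2 * deriv (\<lambda>z. dw F (z, w)) z = lam * F (z, w)) (nhds 0)"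
    unfolding eventually_nhds using eigenspaceD(4)[OF F _ w]
    by (intro exI[of _ disc]) (auto simp: dz_def mult.commute)
  ultimately show ?thesis
    unfolding has_fps_expansion_cong[OF ev refl] by (intro fps_expansion_unique_complex)
qed

lemma fps_mult_nth_lowest:
  fixes A B :: "'a::comm_ring_1 fps"
  assumes "\<And>i. i < j \<Longrightarrow> fps_nth B i = 0"
  shows "fps_nth (A * B) j = fps_nth A 0 * fps_nth B j"
proof -
  have "fps_nth (A * B) j = (\<Sum>i\<in>{0..j}. fps_nth A i * fps_nth B (j - i))" by (rule fps_mult_nth)
  also have "\<dots> = (\<Sum>i\<in>{0}. fps_nth A i * fps_nth B (j - i))"
    by (rule sum.mono_neutral_right) (use assms in auto)
  finally show ?thesis by simp
qed

text \<open>Let a_j(w) be the coefficients of \<open>F\<close> in \<open>z\<close>. If a_i vanishes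
  for all i < j, then the coefficient of z^(j-1) in the equation reads 4 j a_j' = lam a_(j-1) = 0,
  so a_j is constant; its value at \<open>w = 0\<close> is \<open>lead (- j) F\<close>. The
  induction starts with a_0(w) = F(0, w), whose Taylor coefficients are the leads of nonnegative
  index.\<close>

lemma eigenspace_eq_0:
  assumes F: "F \<in> eigenspace lam" and l: "\<And>k. lead k F = 0"
  shows "F = 0"
proof -
  note h = eigenspaceD(2)[OF F]
  have z0: "taylor_coeff (\<lambda>z. F (z, 0)) j = 0" for j using l[of "- int j"] by (simp add: lead_nonpos)
  have w0: "F (0, w) = 0" if "w \<in> disc" for w
    using jointly_holomorphicD(3)[OF h, of 0] l that by (intro taylor_coeff_eq_0_imp_0[of "\<lambda>w. F (0, w)"]) (auto simp: lead_nonneg[symmetric])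
  have *: "\<forall>w\<in>disc. taylor_coeff (\<lambda>z. F (z, w)) j = 0" for j
  proof (induction j rule: less_induct)
    case (less j)
    show ?case
    proof (cases j)
      case 0
      then show ?thesis using w0 by (simp add: taylor_coeff_def)
    next
      case (Suc n)
      show ?thesis
      proof (intro ballI vanishing_coefficients_step[OF h z0])
        fix w assume w: "w \<in> disc"
        define A where "A = Abs_fps (taylor_coeff (\<lambda>z. dw F (z, w)))"
        have A0: "fps_nth A i = 0" if "i < j" for i
          using vanishing_coefficients_deriv[OF h _ w] less that by (simp add: A_def)
        have "fps_nth (fps_const 4 * (1 - fps_const w * fps_X) ^ 2 * fps_deriv A) n =
            fps_nth (fps_const lam * Abs_fps (taylor_coeff (\<lambda>z. F (z, w)))) n"
          using eigenfunction_fps[OF F w] by (simp add: A_def)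
        moreover have "fps_nth (fps_const 4 * (1 - fps_const w * fps_X) ^ 2 * fps_deriv A) n
           = 4 * (of_nat (n + 1) * fps_nth A j)"
          using A0 Suc by (subst fps_mult_nth_lowest) (auto simp: fps_nth_power_0)
        ultimately have "4 * (of_nat (n + 1) * fps_nth A j) = 0"
          using less[of n] Suc w by simp
        then have "fps_nth A j = 0" by (simp del: of_nat_Suc)
        then show "taylor_coeff (\<lambda>z. dw F (z, w)) j = 0" by (simp add: A_def)
      qed
    qed
  qed
  have "F (z, w) = 0" for z w
  proof (cases "(z, w) \<in> bidisk")
    case True
    then have "z \<in> disc" "w \<in> disc" by (auto simp: bidisk_def)
    then show ?thesis
      using * jointly_holomorphicD(2)[OF h] by (intro taylor_coeff_eq_0_imp_0[of "\<lambda>z. F (z, w)"]) auto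
  qed (use eigenspaceD(3)[OF F] in auto)
  then show ?thesis by (auto simp: fun_eq_iff)
qed

section \<open>Locally uniform limits and closed sets\<close>

lemma uniform_limit_reindex:
  assumes "uniform_limit K f F A" "g ` L \<subseteq> K"
  shows "uniform_limit L (\<lambda>n x. f n (g x)) (\<lambda>x. F (g x)) A"
  unfolding uniform_limit_iff
proof (intro allI impI)
  fix e :: real assume "e > 0"
  then have "\<forall>\<^sub>F n in A. \<forall>p\<in>K. dist (f n p) (F p) < e"
    using assms(1) by (simp add: uniform_limit_iff)
  then show "\<forall>\<^sub>F n in A. \<forall>x\<in>L. dist (f n (g x)) (F (g x)) < e"
    by eventually_elim (use assms(2) in blast)
qed

definition loc_unif where
  "loc_unif f F A \<longleftrightarrow> (\<forall>K. compact K \<and> K \<subseteq> bidisk \<longrightarrow> uniform_limit K f F A)"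

lemma loc_unifD:
  "loc_unif f F A \<Longrightarrow> compact K \<Longrightarrow> K \<subseteq> bidisk \<Longrightarrow> uniform_limit K f F A"
  by (simp add: loc_unif_def)

text \<open>The test uses filters, so no countability property of the topology has to be
  established. For \<open>F\<close> in the closure, the neighbourhood filter of \<open>F\<close>
  restricted to \<open>S\<close> is nontrivial and converges to \<open>F\<close>.\<close>

lemma closedin_holo_topologyI:
  assumes S: "S \<subseteq> holo_bidisk"
    and lim: "\<And>F (A :: (complex \<times> complex \<Rightarrow> complex) filter). A \<noteq> bot \<Longrightarrow> (\<forall>\<^sub>F G in A. G \<in> S) \<Longrightarrow>
      F \<in> holo_bidisk \<Longrightarrow> loc_unif (\<lambda>G. G) F A \<Longrightarrow> F \<in> S"
  shows "closedin holo_topology S"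
proof -
  have "F \<in> S" if F: "F \<in> holo_topology closure_of S" for F
  proof -
    define A where "A = inf (nhdsin holo_topology F) (principal S)"
    have Ft: "F \<in> topspace holo_topology" using F by (simp add: in_closure_of)
    have "A \<noteq> bot"
    proof
      assume "A = bot"
      then obtain T where T: "openin holo_topology T" "F \<in> T" "\<And>G. G \<in> T \<Longrightarrow> G \<notin> S"
        using Ft by (auto simp: A_def trivial_limit_def eventually_inf_principal eventually_nhdsin)
      then show False using F unfolding in_closure_of by blast
    qed
    moreover have "limitin holo_topology (\<lambda>G. G) F A"
      unfolding limitin_def A_def eventually_inf_principal eventually_nhdsin using Ft by auto
    moreover have "\<forall>\<^sub>F G in A. G \<in> S" by (simp add: A_def eventually_inf_principal)
    ultimately show "F \<in> S"
      by (intro lim) (auto simp: limitin_holo_topology loc_unif_def)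
  qed
  then show ?thesis
    using S closure_of_subset_eq[of S holo_topology] by (auto simp: topspace_holo_topology)
qed

lemma closedin_holo_topologyD:
  assumes "closedin holo_topology S" "A \<noteq> bot" "\<forall>\<^sub>F n in A. f n \<in> S" "loc_unif f F A" "F \<in> holo_bidisk"
  shows "F \<in> S"
proof (rule limitin_closedin[OF _ assms(1,3)])
  have "S \<subseteq> holo_bidisk" using closedin_subset[OF assms(1)] by (simp add: topspace_holo_topology)
  then have "\<forall>\<^sub>F n in A. f n \<in> holo_bidisk" using assms(3) by (auto elim: eventually_mono)
  then show "limitin holo_topology f F A"
    using assms by (auto simp: limitin_holo_topology loc_unif_def)
qed (use assms in auto)

text \<open>On closed bidisks of radius \<open>r < 1\<close> the limit is uniform, which gives
  continuity there and, by Weierstrass' theorem, holomorphy on each slice. Both properties are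
  local, so letting \<open>r\<close> tend to 1 covers the whole bidisk.\<close>

lemma jointly_holomorphic_limit:
  assumes lu: "loc_unif f F A" and A: "A \<noteq> bot" and ev: "\<forall>\<^sub>F n in A. jointly_holomorphic (f n) disc disc"
  shows "jointly_holomorphic F disc disc"
  unfolding jointly_holomorphic_def
proof (intro conjI ballI)
  have ul: "uniform_limit (cball 0 r \<times> cball 0 r) f F A" if "r < 1" for r
    using that by (intro loc_unifD[OF lu]) (auto simp: bidisk_def compact_Times)
  have cont: "continuous_on (cball 0 r \<times> cball 0 r) F" if r: "r < 1" for r
  proof (rule uniform_limit_theorem[OF _ ul[OF r] A])
    show "\<forall>\<^sub>F n in A. continuous_on (cball 0 r \<times> cball 0 r) (f n)"
      using ev
    proof eventually_elim
      case (elim n)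
      show ?case by (rule continuous_on_subset[OF jointly_holomorphicD(1)[OF elim]]) (use r in auto)
    qed
  qed
  have holz: "(\<lambda>z. F (z, w)) holomorphic_on ball 0 r" if r: "r < 1" and w: "norm w \<le> r" for r w
  proof (rule holomorphic_uniform_limit[of 0 r "\<lambda>n z. f n (z, w)" A "\<lambda>z. F (z, w)"])
    show "uniform_limit (cball 0 r) (\<lambda>n z. f n (z, w)) (\<lambda>z. F (z, w)) A"
      by (rule uniform_limit_reindex[OF ul[OF r], where g = "\<lambda>z. (z, w)"]) (use w in auto)
    show "\<forall>\<^sub>F n in A. continuous_on (cball 0 r) (\<lambda>z. f n (z, w)) \<and> (\<lambda>z. f n (z, w)) holomorphic_on ball 0 r"
      using ev
    proof eventually_elim
      case (elim n)
      have "(\<lambda>z. f n (z, w)) holomorphic_on cball 0 r"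
        by (rule holomorphic_on_subset[OF jointly_holomorphicD(2)[OF elim]]) (use r w in auto)
      then show ?case
        by (meson ball_subset_cball holomorphic_on_imp_continuous_on holomorphic_on_subset)
    qed
  qed (use A in auto)
  have holw: "(\<lambda>w. F (z, w)) holomorphic_on ball 0 r" if r: "r < 1" and z: "norm z \<le> r" for r z
  proof (rule holomorphic_uniform_limit[of 0 r "\<lambda>n w. f n (z, w)" A "\<lambda>w. F (z, w)"])
    show "uniform_limit (cball 0 r) (\<lambda>n w. f n (z, w)) (\<lambda>w. F (z, w)) A"
      by (rule uniform_limit_reindex[OF ul[OF r], where g = "\<lambda>w. (z, w)"]) (use z in auto)
    show "\<forall>\<^sub>F n in A. continuous_on (cball 0 r) (\<lambda>w. f n (z, w)) \<and> (\<lambda>w. f n (z, w)) holomorphic_on ball 0 r"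
      using ev
    proof eventually_elim
      case (elim n)
      have "(\<lambda>w. f n (z, w)) holomorphic_on cball 0 r"
        by (rule holomorphic_on_subset[OF jointly_holomorphicD(3)[OF elim]]) (use r z in auto)
      then show ?case
        by (meson ball_subset_cball holomorphic_on_imp_continuous_on holomorphic_on_subset)
    qed
  qed (use A in auto)
  show "continuous_on (disc \<times> disc) F"
  proof (subst continuous_on_eq_continuous_at)
    show "\<forall>x\<in>disc \<times> disc. isCont F x"
    proof clarify
      fix z w :: complex assume zw: "z \<in> disc" "w \<in> disc"
      then obtain r where r: "max (norm z) (norm w) < r" "r < 1" using dense[of "max (norm z) (norm w)" 1] by auto
      have c: "continuous_on (ball 0 r \<times> ball 0 r) F"
        using cont[OF r(2)] by (rule continuous_on_subset) auto
      have "open (ball 0 r \<times> ball 0 r :: (complex \<times> complex) set)" by (intro open_Times open_ball)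
      from c[unfolded continuous_on_eq_continuous_at[OF this]] r
      show "isCont F (z, w)" by simp
    qed
  qed (auto intro: open_Times)
  show "(\<lambda>z. F (z, w)) holomorphic_on disc" if w: "w \<in> disc" for w
    unfolding holomorphic_on_open[OF open_ball]
  proof
    fix z :: complex assume z: "z \<in> disc"
    then obtain r where r: "max (norm z) (norm w) < r" "r < 1"
      using w dense[of "max (norm z) (norm w)" 1] by auto
    then show "\<exists>f'. ((\<lambda>z. F (z, w)) has_field_derivative f') (at z)"
      using holz[of r w] by (auto simp: holomorphic_on_open)
  qed
  show "(\<lambda>w. F (z, w)) holomorphic_on disc" if z: "z \<in> disc" for z
    unfolding holomorphic_on_open[OF open_ball]
  proof
    fix w :: complex assume w: "w \<in> disc"
    then obtain r where r: "max (norm z) (norm w) < r" "r < 1"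
      using z dense[of "max (norm z) (norm w)" 1] by auto
    then show "\<exists>f'. ((\<lambda>w. F (z, w)) has_field_derivative f') (at w)"
      using holw[of r z] by (auto simp: holomorphic_on_open)
  qed
qed

text \<open>Restricting to an axis turns this into convergence of derivatives at 0 under uniform
  convergence of holomorphic functions. It makes every condition of the form
  \<open>lead k F = 0\<close> a closed one.\<close>

lemma lead_limit:
  assumes lu: "loc_unif f F A" and A: "A \<noteq> bot" and ev: "\<forall>\<^sub>F n in A. jointly_holomorphic (f n) disc disc"
  shows "((\<lambda>n. lead k (f n)) \<longlongrightarrow> lead k F) A"
proof (cases "k \<ge> 0")
  case True
  have "uniform_limit ({0} \<times> cball 0 (1/2)) f F A"
    by (intro loc_unifD[OF lu]) (auto simp: bidisk_def compact_Times)
  then have "uniform_limit (ball 0 (1/2)) (\<lambda>n w. f n (0, w)) (\<lambda>w. F (0, w)) A"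
    by (rule uniform_limit_reindex[where g = "\<lambda>w. (0, w)"]) auto
  then have "((\<lambda>n. (deriv ^^ nat k) (\<lambda>w. f n (0, w)) 0) \<longlongrightarrow> (deriv ^^ nat k) (\<lambda>w. F (0, w)) 0) A"
  proof (rule higher_deriv_complex_uniform_limit)
    show "\<forall>\<^sub>F n in A. (\<lambda>w. f n (0, w)) holomorphic_on ball 0 (1/2)"
      using ev by eventually_elim (rule holomorphic_on_subset[OF jointly_holomorphicD(3)], auto)
  qed (use A in auto)
  then show ?thesis using True by (auto simp: lead_def taylor_coeff_def intro!: tendsto_intros)
next
  case False
  have "uniform_limit (cball 0 (1/2) \<times> {0}) f F A"
    by (intro loc_unifD[OF lu]) (auto simp: bidisk_def compact_Times)
  then have "uniform_limit (ball 0 (1/2)) (\<lambda>n z. f n (z, 0)) (\<lambda>z. F (z, 0)) A"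
    by (rule uniform_limit_reindex[where g = "\<lambda>z. (z, 0)"]) auto
  then have "((\<lambda>n. (deriv ^^ nat (-k)) (\<lambda>z. f n (z, 0)) 0) \<longlongrightarrow> (deriv ^^ nat (-k)) (\<lambda>z. F (z, 0)) 0) A"
  proof (rule higher_deriv_complex_uniform_limit)
    show "\<forall>\<^sub>F n in A. (\<lambda>z. f n (z, 0)) holomorphic_on ball 0 (1/2)"
      using ev by eventually_elim (rule holomorphic_on_subset[OF jointly_holomorphicD(2)], auto)
  qed (use A in auto)
  then show ?thesis using False by (auto simp: lead_def taylor_coeff_def intro!: tendsto_intros)
qed

text \<open>Cauchy's estimate in \<open>w\<close> gives convergence of \<open>dw (f n)\<close>
  uniformly in \<open>z\<close>, and Weierstrass' theorem then handles the derivative in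
  \<open>z\<close>.\<close>

lemma dz_dw_limit:
  assumes lu: "loc_unif f F A" and A: "A \<noteq> bot" and ev: "\<forall>\<^sub>F n in A. jointly_holomorphic (f n) disc disc"
    and F: "jointly_holomorphic F disc disc" and z: "z \<in> disc" and w: "w \<in> disc"
  shows "((\<lambda>n. dz (dw (f n)) (z, w)) \<longlongrightarrow> dz (dw F) (z, w)) A"
proof -
  obtain r where r: "r > 0" "cball z r \<subseteq> disc" using z open_contains_cball_eq[OF open_ball] by blast
  obtain s where s: "s > 0" "cball w s \<subseteq> disc" using w open_contains_cball_eq[OF open_ball] by blast
  have ul: "uniform_limit (cball z r \<times> cball w s) f F A"
    unfolding bidisk_def by (intro loc_unifD[OF lu] compact_Times compact_cball)
      (use r s in \<open>auto simp: bidisk_def\<close>)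
  have "uniform_limit (ball z r) (\<lambda>n z. dw (f n) (z, w)) (\<lambda>z. dw F (z, w)) A"
    unfolding uniform_limit_iff
  proof (intro allI impI)
    fix e :: real assume e: "0 < e"
    have "e * s / 2 > 0" using e s by simp
    then have ev2: "\<forall>\<^sub>F n in A. \<forall>p\<in>cball z r \<times> cball w s. dist (f n p) (F p) < e * s / 2"
      using ul unfolding uniform_limit_iff by blast
    show "\<forall>\<^sub>F n in A. \<forall>x\<in>ball z r. dist (dw (f n) (x, w)) (dw F (x, w)) < e"
      using ev ev2
    proof eventually_elim
      case (elim n)
      show ?case
      proof
        fix x assume x: "x \<in> ball z r"
        then have xd: "x \<in> disc" using r(2) by (meson ball_subset_cball subsetD)
        have "norm (dw (f n) (x, w) - dw F (x, w)) \<le> (e * s / 2) / s"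
          unfolding dw_def prod.case
        proof (rule cauchy_deriv_diff[of _ disc])
          show "norm (f n (x, v) - F (x, v)) \<le> e * s / 2" if "v \<in> cball w s" for v
          proof -
            have "(x, v) \<in> cball z r \<times> cball w s" using that x by auto
            then show ?thesis using elim(2) unfolding dist_norm by (meson less_imp_le)
          qed
        qed (use s xd jointly_holomorphicD(3)[OF F] jointly_holomorphicD(3)[OF elim(1)] in auto)
        then show "dist (dw (f n) (x, w)) (dw F (x, w)) < e" using s e by (simp add: dist_norm)
      qed
    qed
  qed
  then have "((\<lambda>n. (deriv ^^ 1) (\<lambda>z. dw (f n) (z, w)) z) \<longlongrightarrow> (deriv ^^ 1) (\<lambda>z. dw F (z, w)) z) A"
  proof (rule higher_deriv_complex_uniform_limit)
    show "\<forall>\<^sub>F n in A. (\<lambda>z. dw (f n) (z, w)) holomorphic_on ball z r"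
      using ev
    proof eventually_elim
      case (elim n)
      have "(\<lambda>z. dw (f n) (z, w)) holomorphic_on disc"
        using w elim by (intro jointly_holomorphicD(2)[OF jointly_holomorphic_dw]) auto
      then show ?case using r(2) by (meson ball_subset_cball holomorphic_on_subset subset_trans)
    qed
  qed (use r A in auto)
  then show ?thesis by (simp add: dz_def)
qed

text \<open>Both sides of the equation converge pointwise. \<open>F0\<close> is a separate
  assumption because \<open>loc_unif\<close> says nothing about values off the bidisk.\<close>

lemma eigenspace_limit:
  assumes lu: "loc_unif f F A" and A: "A \<noteq> bot" and ev: "\<forall>\<^sub>F n in A. f n \<in> eigenspace lam"
    and F0: "\<And>p. p \<notin> bidisk \<Longrightarrow> F p = 0"
  shows "F \<in> eigenspace lam"
proof -
  have ev': "\<forall>\<^sub>F n in A. jointly_holomorphic (f n) disc disc" using ev by eventually_elim (rule eigenspaceD(2))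
  have F: "jointly_holomorphic F disc disc" by (rule jointly_holomorphic_limit[OF lu A ev'])
  have "4 * (1 - z * w)\<^sup>2 * dz (dw F) (z, w) = lam * F (z, w)" if zw: "z \<in> disc" "w \<in> disc" for z w
  proof -
    have "uniform_limit {(z, w)} f F A"
      using zw by (intro loc_unifD[OF lu]) (auto simp: bidisk_def)
    then have "((\<lambda>n. f n (z, w)) \<longlongrightarrow> F (z, w)) A" by (rule tendsto_uniform_limitI) simp
    then have 1: "((\<lambda>n. lam * f n (z, w)) \<longlongrightarrow> lam * F (z, w)) A" by (intro tendsto_intros)
    have "((\<lambda>n. 4 * (1 - z * w)\<^sup>2 * dz (dw (f n)) (z, w)) \<longlongrightarrow> 4 * (1 - z * w)\<^sup>2 * dz (dw F) (z, w)) A"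
      using zw by (intro tendsto_mult_left dz_dw_limit[OF lu A ev' F])
    then have 2: "((\<lambda>n. lam * f n (z, w)) \<longlongrightarrow> 4 * (1 - z * w)\<^sup>2 * dz (dw F) (z, w)) A"
    proof (rule Lim_transform_eventually)
      show "\<forall>\<^sub>F n in A. 4 * (1 - z * w)\<^sup>2 * dz (dw (f n)) (z, w) = lam * f n (z, w)"
        using ev by eventually_elim (rule eigenspaceD(4)[OF _ zw])
    qed
    show ?thesis by (rule tendsto_unique[OF A 2 1])
  qed
  then show ?thesis using F F0 by (simp add: eigenspace_iff holo_bidisk_iff)
qed

lemma closedin_eigenspace: "closedin holo_topology (eigenspace lam)"
proof (rule closedin_holo_topologyI)
  fix F and A :: "(complex \<times> complex \<Rightarrow> complex) filter"
  assume "A \<noteq> bot" "\<forall>\<^sub>F G in A. G \<in> eigenspace lam" "F \<in> holo_bidisk" "loc_unif (\<lambda>G. G) F A"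
  then show "F \<in> eigenspace lam" by (intro eigenspace_limit[of "\<lambda>G. G" F A]) (auto simp: holo_bidisk_iff)
qed (auto dest: eigenspaceD(1))

section \<open>Linear structure of the eigenspaces\<close>

lemma jointly_holomorphic_add: "jointly_holomorphic F U V \<Longrightarrow> jointly_holomorphic G U V \<Longrightarrow> jointly_holomorphic (F + G) U V"
  unfolding jointly_holomorphic_def plus_fun_def by (intro conjI ballI continuous_intros holomorphic_intros) auto

lemma jointly_holomorphic_fun_scale: "jointly_holomorphic F U V \<Longrightarrow> jointly_holomorphic (fun_scale c F) U V"
  unfolding jointly_holomorphic_def fun_scale_def by (intro conjI ballI continuous_intros holomorphic_intros) auto

lemma taylor_coeff_add:
  assumes "f holomorphic_on disc" "g holomorphic_on disc"
  shows "taylor_coeff (\<lambda>w. f w + g w) n = taylor_coeff f n + taylor_coeff g n"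
  using assms by (simp add: taylor_coeff_def higher_deriv_add[of _ disc] add_divide_distrib)

lemma taylor_coeff_cmult:
  assumes "f holomorphic_on disc"
  shows "taylor_coeff (\<lambda>w. c * f w) n = c * taylor_coeff f n"
  using assms by (simp add: taylor_coeff_def higher_deriv_cmult[of _ disc])

lemma lead_add: "jointly_holomorphic F disc disc \<Longrightarrow> jointly_holomorphic G disc disc \<Longrightarrow> lead k (F + G) = lead k F + lead k G"
  by (auto simp: lead_def intro!: taylor_coeff_add jointly_holomorphicD)

lemma lead_fun_scale: "jointly_holomorphic F disc disc \<Longrightarrow> lead k (fun_scale c F) = c * lead k F"
  by (auto simp: lead_def fun_scale_def intro!: taylor_coeff_cmult jointly_holomorphicD)

lemma lead_0 [simp]: "lead k 0 = 0"
  using lead_fun_scale[of 0 k 0] by (simp add: jointly_holomorphic_def zero_fun_def fun_scale_def)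

lemma dw_lincomb:
  assumes "jointly_holomorphic F U V" "jointly_holomorphic G U V" "open V" "z \<in> U" "w \<in> V"
  shows "dw (F + G) (z, w) = dw F (z, w) + dw G (z, w)"
    "dw (fun_scale c F) (z, w) = c * dw F (z, w)"
proof -
  note d = dw_has_derivative[OF assms(1,3-5)] dw_has_derivative[OF assms(2-5)]
  show "dw (F + G) (z, w) = dw F (z, w) + dw G (z, w)"
    using DERIV_imp_deriv[OF DERIV_add[OF d]] by (simp add: dw_def)
  show "dw (fun_scale c F) (z, w) = c * dw F (z, w)"
    using DERIV_imp_deriv[OF DERIV_cmult[OF d(1), of c]] by (simp add: dw_def fun_scale_def)
qed

lemma dz_cong:
  assumes "open U" "z \<in> U" "\<And>u. u \<in> U \<Longrightarrow> F (u, w) = G (u, w)"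
  shows "dz F (z, w) = dz G (z, w)"
  unfolding dz_def prod.case
  using assms by (intro deriv_cong_ev eventually_mono[OF eventually_nhds_in_open[of U]]) auto

lemma dz_dw_lincomb:
  assumes F: "jointly_holomorphic F U V" and G: "jointly_holomorphic G U V" and op: "open U" "open V" and z: "z \<in> U" and w: "w \<in> V"
  shows "dz (dw (F + G)) (z, w) = dz (dw F) (z, w) + dz (dw G) (z, w)"
    "dz (dw (fun_scale c F)) (z, w) = c * dz (dw F) (z, w)"
proof -
  note d = dz_has_derivative[OF jointly_holomorphic_dw[OF F op] op(1) z w] dz_has_derivative[OF jointly_holomorphic_dw[OF G op] op(1) z w]
  have "dz (dw (F + G)) (z, w) = dz (\<lambda>p. dw F p + dw G p) (z, w)"
    using dw_lincomb[OF F G op(2) _ w] by (intro dz_cong[OF op(1) z]) auto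
  also have "\<dots> = dz (dw F) (z, w) + dz (dw G) (z, w)"
    using DERIV_imp_deriv[OF DERIV_add[OF d]] by (simp add: dz_def)
  finally show "dz (dw (F + G)) (z, w) = dz (dw F) (z, w) + dz (dw G) (z, w)" .
  have "dz (dw (fun_scale c F)) (z, w) = dz (\<lambda>p. c * dw F p) (z, w)"
    using dw_lincomb[OF F G op(2) _ w] by (intro dz_cong[OF op(1) z]) auto
  also have "\<dots> = c * dz (dw F) (z, w)"
    using DERIV_imp_deriv[OF DERIV_cmult[OF d(1), of c]] by (simp add: dz_def)
  finally show "dz (dw (fun_scale c F)) (z, w) = c * dz (dw F) (z, w)" .
qed

lemma subspace_eigenspace: "cfun.subspace (eigenspace lam)"
  unfolding cfun.subspace_def
proof (intro conjI ballI allI)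
  show "0 \<in> eigenspace lam"
    by (simp add: eigenspace_iff holo_bidisk_iff jointly_holomorphic_def dz_def dw_def zero_fun_def)
next
  fix F G assume F: "F \<in> eigenspace lam" and G: "G \<in> eigenspace lam"
  have "4 * (1 - z * w)\<^sup>2 * dz (dw (F + G)) (z, w) = lam * (F + G) (z, w)"
    if zw: "z \<in> disc" "w \<in> disc" for z w
  proof -
    have "dz (dw (F + G)) (z, w) = dz (dw F) (z, w) + dz (dw G) (z, w)"
      by (rule dz_dw_lincomb(1)[OF eigenspaceD(2)[OF F] eigenspaceD(2)[OF G] open_ball open_ball zw])
    then show ?thesis using eigenspaceD(4)[OF F zw] eigenspaceD(4)[OF G zw] by (simp add: distrib_left)
  qed
  moreover have "F + G \<in> holo_bidisk"
    using eigenspaceD(1)[OF F] eigenspaceD(1)[OF G] by (auto simp: holo_bidisk_iff jointly_holomorphic_add)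
  ultimately show "F + G \<in> eigenspace lam" unfolding eigenspace_iff by blast
next
  fix c F assume F: "F \<in> eigenspace lam"
  have "4 * (1 - z * w)\<^sup>2 * dz (dw (fun_scale c F)) (z, w) = lam * fun_scale c F (z, w)"
    if zw: "z \<in> disc" "w \<in> disc" for z w
  proof -
    have "dz (dw (fun_scale c F)) (z, w) = c * dz (dw F) (z, w)"
      by (rule dz_dw_lincomb(2)[OF eigenspaceD(2)[OF F] eigenspaceD(2)[OF F] open_ball open_ball zw])
    then have "4 * (1 - z * w)\<^sup>2 * dz (dw (fun_scale c F)) (z, w) = c * (4 * (1 - z * w)\<^sup>2 * dz (dw F) (z, w))"
      by simp
    then show ?thesis unfolding eigenspaceD(4)[OF F zw] by (simp add: fun_scale_def)
  qed
  moreover have "fun_scale c F \<in> holo_bidisk"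
    using eigenspaceD(1)[OF F] by (auto simp: holo_bidisk_iff jointly_holomorphic_fun_scale) (simp add: fun_scale_def)
  ultimately show "fun_scale c F \<in> eigenspace lam" unfolding eigenspace_iff by blast
qed

section \<open>Homogeneous modes\<close>

lemma jointly_holomorphic_compose:
  assumes F: "jointly_holomorphic F U' V'" and p: "p holomorphic_on U" "p ` U \<subseteq> U'" and q: "q holomorphic_on V" "q ` V \<subseteq> V'"
  shows "jointly_holomorphic (F \<circ> map_prod p q) U V"
  unfolding jointly_holomorphic_def
proof (intro conjI ballI)
  have "continuous_on (U \<times> V) (\<lambda>x. (p (fst x), q (snd x)))"
    by (intro continuous_intros continuous_on_compose2[OF holomorphic_on_imp_continuous_on[OF p(1)]]
        continuous_on_compose2[OF holomorphic_on_imp_continuous_on[OF q(1)]]) auto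
  then have "continuous_on (U \<times> V) (\<lambda>x. F (p (fst x), q (snd x)))"
    by (rule continuous_on_compose2[OF jointly_holomorphicD(1)[OF F]]) (use p q in auto)
  then show "continuous_on (U \<times> V) (F \<circ> map_prod p q)"
    by (rule continuous_on_eq) auto
  show "(\<lambda>z. (F \<circ> map_prod p q) (z, w)) holomorphic_on U" if "w \<in> V" for w
    using holomorphic_on_compose_gen[OF p(1) jointly_holomorphicD(2)[OF F, of "q w"] p(2)] that q by (simp add: o_def image_subset_iff)
  show "(\<lambda>w. (F \<circ> map_prod p q) (z, w)) holomorphic_on V" if "z \<in> U" for z
    using holomorphic_on_compose_gen[OF q(1) jointly_holomorphicD(3)[OF F, of "p z"] q(2)] that p by (simp add: o_def image_subset_iff)
qed

lemma dw_compose: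
  assumes F: "jointly_holomorphic F U' V'" and p: "p ` U \<subseteq> U'" and q: "q holomorphic_on V" "q ` V \<subseteq> V'"
    and op: "open V" "open V'" and z: "z \<in> U" and w: "w \<in> V"
  shows "dw (F \<circ> map_prod p q) (z, w) = dw F (p z, q w) * deriv q w"
proof -
  have 1: "((\<lambda>v. F (p z, v)) has_field_derivative dw F (p z, q w)) (at (q w))"
    using p q z w by (intro dw_has_derivative[OF F op(2)]) auto
  have 2: "(q has_field_derivative deriv q w) (at w)"
    using q op w by (intro holomorphic_derivI)
  show ?thesis
    using DERIV_imp_deriv[OF DERIV_chain2[OF 1 2]] by (simp add: dw_def)
qed

lemma dz_dw_compose:
  assumes F: "jointly_holomorphic F U' V'" and p: "p holomorphic_on U" "p ` U \<subseteq> U'" and q: "q holomorphic_on V" "q ` V \<subseteq> V'"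
    and op: "open U" "open V" "open U'" "open V'" and z: "z \<in> U" and w: "w \<in> V"
  shows "dz (dw (F \<circ> map_prod p q)) (z, w) = dz (dw F) (p z, q w) * deriv p z * deriv q w"
proof -
  have "dz (dw (F \<circ> map_prod p q)) (z, w) = dz (\<lambda>x. dw F (p (fst x), q (snd x)) * deriv q (snd x)) (z, w)"
    using dw_compose[OF F p(2) q op(2,4) _ w] by (intro dz_cong[OF op(1) z]) simp
  also have "\<dots> = dz (dw F) (p z, q w) * deriv p z * deriv q w"
  proof -
    have 1: "((\<lambda>v. dw F (v, q w)) has_field_derivative dz (dw F) (p z, q w)) (at (p z))"
      using p q z w by (intro dz_has_derivative[OF jointly_holomorphic_dw[OF F op(3,4)] op(3)]) auto
    have 2: "(p has_field_derivative deriv p z) (at z)"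
      using p op z by (intro holomorphic_derivI)
    show ?thesis
      using DERIV_imp_deriv[OF DERIV_cmult_right[OF DERIV_chain2[OF 1 2], of "deriv q w"]] by (simp add: dz_def)
  qed
  finally show ?thesis .
qed

text \<open>Holomorphy and the equation are local on an open set, so changing a function off the
  bidisk affects no derivative inside.\<close>

lemma restrict_bidisk_in_eigenspace:
  assumes F: "jointly_holomorphic F disc disc"
    and pde: "\<And>z w. z \<in> disc \<Longrightarrow> w \<in> disc \<Longrightarrow> 4 * (1 - z * w)\<^sup>2 * dz (dw F) (z, w) = lam * F (z, w)"
  shows "restrict_bidisk F \<in> eigenspace lam"
proof -
  have eq: "restrict_bidisk F (z, w) = F (z, w)" if "z \<in> disc" "w \<in> disc" for z w
    using that by (simp add: restrict_bidisk_def bidisk_def)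
  have "dw (restrict_bidisk F) (z, w) = dw F (z, w)" if "z \<in> disc" "w \<in> disc" for z w
    unfolding dw_def prod.case using eq that
    by (intro deriv_cong_ev eventually_mono[OF eventually_nhds_in_open[of disc]]) auto
  then have "dz (dw (restrict_bidisk F)) (z, w) = dz (dw F) (z, w)" if "z \<in> disc" "w \<in> disc" for z w
    using that by (intro dz_cong[of disc]) auto
  moreover have "jointly_holomorphic (restrict_bidisk F) disc disc"
    unfolding jointly_holomorphic_def
  proof (intro conjI ballI)
    show "continuous_on (disc \<times> disc) (restrict_bidisk F)"
      by (rule continuous_on_eq[OF jointly_holomorphicD(1)[OF F]]) (auto simp: eq)
    show "(\<lambda>z. restrict_bidisk F (z, w)) holomorphic_on disc" if "w \<in> disc" for w
      by (rule holomorphic_transform[OF jointly_holomorphicD(2)[OF F that]]) (use that eq in auto)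
    show "(\<lambda>w. restrict_bidisk F (z, w)) holomorphic_on disc" if "z \<in> disc" for z
      by (rule holomorphic_transform[OF jointly_holomorphicD(3)[OF F that]]) (use that eq in auto)
  qed
  ultimately show ?thesis using pde eq by (simp add: eigenspace_iff holo_bidisk_iff restrict_bidisk_def del: split_paired_All)
qed

text \<open>By the chain rule the mixed derivative acquires the factor
  \<open>deriv p z * deriv q w\<close>. The condition \<open>conf\<close> says exactly that this
  factor turns \<open>(1 - z * w)\<^sup>2\<close> into the weight at the image point.\<close>

lemma eigenspace_compose:
  assumes F: "F \<in> eigenspace lam"
    and p: "p holomorphic_on disc" "p ` disc \<subseteq> disc" and q: "q holomorphic_on disc" "q ` disc \<subseteq> disc"
    and conf: "\<And>z w. z \<in> disc \<Longrightarrow> w \<in> disc \<Longrightarrow> (1 - z * w)\<^sup>2 * deriv p z * deriv q w = (1 - p z * q w)\<^sup>2"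
  shows "restrict_bidisk (F \<circ> map_prod p q) \<in> eigenspace lam"
proof (rule restrict_bidisk_in_eigenspace)
  note h = eigenspaceD(2)[OF F]
  show "jointly_holomorphic (F \<circ> map_prod p q) disc disc" by (rule jointly_holomorphic_compose[OF h p q])
  fix z w :: complex assume zw: "z \<in> disc" "w \<in> disc"
  then have pq: "p z \<in> disc" "q w \<in> disc" using p q by blast+
  have "4 * (1 - z * w)\<^sup>2 * dz (dw (F \<circ> map_prod p q)) (z, w) =
     4 * ((1 - z * w)\<^sup>2 * deriv p z * deriv q w) * dz (dw F) (p z, q w)"
    unfolding dz_dw_compose[OF h p q open_ball open_ball open_ball open_ball zw] by simp
  also have "\<dots> = lam * F (p z, q w)"
    unfolding conf[OF zw] by (rule eigenspaceD(4)[OF F pq])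
  finally show "4 * (1 - z * w)\<^sup>2 * dz (dw (F \<circ> map_prod p q)) (z, w) = lam * (F \<circ> map_prod p q) (z, w)"
    by simp
qed

section \<open>Rotations and the projections onto modes\<close>

definition rot :: "real \<Rightarrow> complex \<times> complex \<Rightarrow> complex \<times> complex" where
  "rot t = map_prod (\<lambda>z. z * cis (- t)) (\<lambda>w. w * cis t)"

lemma rot_apply: "rot t (z, w) = (z * cis (- t), w * cis t)"
  by (simp add: rot_def)

lemma rot_in_bidisk [simp]: "rot t p \<in> bidisk \<longleftrightarrow> p \<in> bidisk"
  by (cases p) (simp add: rot_def bidisk_def norm_mult)

lemma restrict_bidisk_rot: "F \<in> holo_bidisk \<Longrightarrow> restrict_bidisk (F \<circ> rot t) = F \<circ> rot t"
  by (auto simp: restrict_bidisk_def holo_bidisk_iff fun_eq_iff simp del: split_paired_All)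

lemma eigenspace_rot:
  assumes F: "F \<in> eigenspace lam" shows "F \<circ> rot t \<in> eigenspace lam"
proof -
  have d: "deriv (\<lambda>z. z * c) z = c" for c z :: complex
    by (intro DERIV_imp_deriv) (auto intro!: derivative_eq_intros)
  have c: "cis (- t) * cis t = 1" by (simp add: cis_mult)
  have "restrict_bidisk (F \<circ> rot t) \<in> eigenspace lam" unfolding rot_def
  proof (rule eigenspace_compose[OF F])
    fix z w :: complex
    have "1 - z * cis (- t) * (w * cis t) = 1 - z * w * (cis (- t) * cis t)" by (simp only: mult_ac)
    then have "1 - z * cis (- t) * (w * cis t) = 1 - z * w" by (simp only: c mult_1_right)
    then show "(1 - z * w)\<^sup>2 * deriv (\<lambda>z. z * cis (- t)) z * deriv (\<lambda>w. w * cis t) w =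
       (1 - z * cis (- t) * (w * cis t))\<^sup>2"
      unfolding d by (simp only: mult.assoc[of _ "cis (- t)"] c mult_1_right)
  qed (auto simp: norm_mult intro!: holomorphic_intros)
  then show ?thesis using eigenspaceD(1)[OF F] by (simp add: restrict_bidisk_rot)
qed

lemma taylor_coeff_scale:
  assumes "f holomorphic_on disc" "norm u = 1"
  shows "taylor_coeff (\<lambda>z. f (z * u)) n = u ^ n * taylor_coeff f n"
proof -
  have "(deriv ^^ n) (\<lambda>z. f (u * z)) 0 = u ^ n * (deriv ^^ n) f (u * 0)"
    by (rule higher_deriv_compose_linear[OF assms(1), of disc]) (use assms in \<open>auto simp: norm_mult\<close>)
  then show ?thesis by (simp add: taylor_coeff_def mult.commute)
qed

lemma lead_rot:
  assumes "jointly_holomorphic F disc disc"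
  shows "lead k (F \<circ> rot t) = cis (of_int k * t) * lead k F"
proof (cases "k \<ge> 0")
  case True
  then have "cis t ^ nat k = cis (of_int k * t)" by (simp add: Complex.DeMoivre)
  then show ?thesis using True taylor_coeff_scale[OF jointly_holomorphicD(3)[OF assms, of 0], of "cis t" "nat k"]
    by (simp add: lead_def rot_apply)
next
  case False
  then have "cis (- t) ^ nat (- k) = cis (of_int k * t)" by (simp add: Complex.DeMoivre)
  then show ?thesis using False taylor_coeff_scale[OF jointly_holomorphicD(2)[OF assms, of 0], of "cis (- t)" "nat (- k)"]
    by (simp add: lead_def rot_apply)
qed

lemma integral_equal_pieces:
  fixes g :: "real \<Rightarrow> 'a::banach"
  assumes "h \<ge> 0" "continuous_on {0..of_nat n * h} g"
  shows "integral {0..of_nat n * h} g = (\<Sum>j<n. integral {of_nat j * h..of_nat (Suc j) * h} g)"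
  using assms(2)
proof (induction n)
  case (Suc n)
  have le: "real n * h \<le> real (Suc n) * h" "0 \<le> real n * h" using assms(1) by (auto intro: mult_right_mono)
  have "continuous_on {0..real n * h} g"
    using Suc.prems by (rule continuous_on_subset) (use le in auto)
  moreover have "integral {0..real (Suc n) * h} g = integral {0..real n * h} g + integral {real n * h..real (Suc n) * h} g"
    using le Suc.prems by (intro Henstock_Kurzweil_Integration.integral_combine[symmetric] integrable_continuous_real) auto
  ultimately show ?case using Suc.IH by simp
qed simp

lemma continuous_on_slice:
  assumes "continuous_on (K \<times> T) (\<lambda>(p, t). g p t)" "p \<in> K"
  shows "continuous_on T (g p)"
proof -
  have "continuous_on T (\<lambda>t. case (p, t) of (p, t) \<Rightarrow> g p t)"
    by (rule continuous_on_compose2[OF assms(1)]) (use assms(2) in \<open>auto intro!: continuous_on_Pair\<close>)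
  then show ?thesis by simp
qed

text \<open>Uniform continuity on \<open>K \<times> {0..2 * pi}\<close> bounds the error on each of
  the \<open>N\<close> pieces by \<open>e / 2\<close> times the mesh, uniformly in the parameter;
  the pieces add up to \<open>e / 2 * 2 * pi\<close>, and the normalisation removes
  \<open>2 * pi\<close>.\<close>

lemma riemann_sum_uniform_limit:
  fixes g :: "'a::metric_space \<Rightarrow> real \<Rightarrow> complex"
  assumes K: "compact K" and g: "continuous_on (K \<times> {0..2 * pi}) (\<lambda>(p, t). g p t)"
  shows "uniform_limit K (\<lambda>N p. \<Sum>j<N. g p (2 * pi * of_nat j / of_nat N) / of_nat N)
    (\<lambda>p. integral {0..2 * pi} (g p) / (2 * of_real pi)) sequentially"
  unfolding uniform_limit_iff
proof (intro allI impI)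
  fix e :: real assume e: "e > 0"
  have "uniformly_continuous_on (K \<times> {0..2 * pi}) (\<lambda>(p, t). g p t)"
    by (rule compact_uniformly_continuous[OF g compact_Times[OF K compact_Icc]])
  then obtain d where d: "d > 0" "\<And>x y. x \<in> K \<times> {0..2 * pi} \<Longrightarrow> y \<in> K \<times> {0..2 * pi} \<Longrightarrow> dist y x < d \<Longrightarrow>
      dist ((\<lambda>(p, t). g p t) y) ((\<lambda>(p, t). g p t) x) < e / 2"
    unfolding uniformly_continuous_on_def using e by (meson half_gt_zero)
  \<comment> \<open>From this \<open>N0\<close> on, the mesh \<open>2 * pi / N\<close> lies below
    the modulus of continuity \<open>d\<close>.\<close>
  obtain N0 :: nat where N0: "2 * pi / d < of_nat N0" using reals_Archimedean2 by blast
  have "dist (\<Sum>j<N. g p (2 * pi * of_nat j / of_nat N) / of_nat N) (integral {0..2 * pi} (g p) / (2 * of_real pi)) < e"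
    if N: "N \<ge> Suc N0" and p: "p \<in> K" for N p
  proof -
    define h where "h = 2 * pi / of_nat N"
    have Npos: "real N > 0" using N by simp
    have h: "h > 0" "real N * h = 2 * pi" "h < d"
    proof -
      show "h > 0" "real N * h = 2 * pi" using Npos by (auto simp: h_def)
      have "2 * pi / d < of_nat N" using N0 N by linarith
      then show "h < d" using Npos d(1) by (simp add: h_def field_simps)
    qed
    have cg: "continuous_on {0..2 * pi} (g p)"
      by (rule continuous_on_slice[OF g p])
    have piece: "norm (integral {of_nat j * h..of_nat (Suc j) * h} (g p) - of_real h * g p (of_nat j * h)) \<le> e / 2 * h"
      if j: "j < N" for j
    proof -
      have "real (Suc j) * h \<le> real N * h" using j h by (intro mult_right_mono) auto
      then have sub: "{of_nat j * h..of_nat (Suc j) * h} \<subseteq> {0..2 * pi}" using h by auto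
      have cj: "continuous_on {of_nat j * h..of_nat (Suc j) * h} (g p)" using cg sub by (rule continuous_on_subset)
      have le: "of_nat j * h \<le> of_nat (Suc j) * h" using h by (auto intro: mult_right_mono)
      have "norm (integral {of_nat j * h..of_nat (Suc j) * h} (\<lambda>t. g p t - g p (of_nat j * h)))
         \<le> e / 2 * (of_nat (Suc j) * h - of_nat j * h)"
      proof (rule integral_bound[OF le])
        show "continuous_on {of_nat j * h..of_nat (Suc j) * h} (\<lambda>t. g p t - g p (of_nat j * h))"
          by (intro continuous_intros cj)
        fix t assume t: "t \<in> {of_nat j * h..of_nat (Suc j) * h}"
        have "dist t (of_nat j * h) \<le> h" using t by (auto simp: dist_real_def algebra_simps)
        then have "dist (p, t) (p, of_nat j * h) < d" using h by (simp add: dist_Pair_Pair)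
        moreover have "of_nat j * h \<in> {0..2 * pi}" "t \<in> {0..2 * pi}" using sub le t by auto
        ultimately have "dist (g p t) (g p (of_nat j * h)) < e / 2"
          using d(2)[of "(p, of_nat j * h)" "(p, t)"] p by auto
        then show "norm (g p t - g p (of_nat j * h)) \<le> e / 2" by (simp add: dist_norm)
      qed
      also have "integral {of_nat j * h..of_nat (Suc j) * h} (\<lambda>t. g p t - g p (of_nat j * h)) =
          integral {of_nat j * h..of_nat (Suc j) * h} (g p) - of_real h * g p (of_nat j * h)"
        unfolding Henstock_Kurzweil_Integration.integral_diff[OF integrable_continuous_real[OF cj] integrable_const_ivl]
        using le by (simp add: scaleR_conv_of_real algebra_simps)
      finally show ?thesis by (simp add: algebra_simps)
    qed
    have "integral {0..2 * pi} (g p) = (\<Sum>j<N. integral {of_nat j * h..of_nat (Suc j) * h} (g p))"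
      using integral_equal_pieces[of h N "g p"] h cg by simp
    then have "norm (integral {0..2 * pi} (g p) - (\<Sum>j<N. of_real h * g p (of_nat j * h))) =
        norm (\<Sum>j<N. (integral {of_nat j * h..of_nat (Suc j) * h} (g p) - of_real h * g p (of_nat j * h)))"
      by (simp add: sum_subtractf)
    also have "\<dots> \<le> of_nat (card {..<N}) * (e / 2 * h)"
      by (rule sum_norm_bound) (use piece in auto)
    also have "\<dots> = 2 * pi * (e / 2)" using h(2) by (simp add: algebra_simps)
    finally have *: "norm (integral {0..2 * pi} (g p) - (\<Sum>j<N. of_real h * g p (of_nat j * h))) \<le> 2 * pi * (e / 2)" .
    have "(\<Sum>j<N. g p (2 * pi * of_nat j / of_nat N) / of_nat N) =
        (\<Sum>j<N. of_real h * g p (of_nat j * h)) / (2 * of_real pi)"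
      unfolding sum_divide_distrib
    proof (rule sum.cong)
      fix j assume "j \<in> {..<N}"
      have "of_nat j * h = 2 * pi * of_nat j / of_nat N" by (simp add: h_def)
      moreover have "complex_of_real h / (2 * of_real pi) = 1 / of_nat N" by (simp add: h_def)
      ultimately show "g p (2 * pi * of_nat j / of_nat N) / of_nat N = of_real h * g p (of_nat j * h) / (2 * of_real pi)"
        by (metis (no_types, opaque_lifting) mult.commute mult.right_neutral times_divide_eq_right)
    qed simp
    then have "dist (\<Sum>j<N. g p (2 * pi * of_nat j / of_nat N) / of_nat N) (integral {0..2 * pi} (g p) / (2 * of_real pi))
       = norm (integral {0..2 * pi} (g p) - (\<Sum>j<N. of_real h * g p (of_nat j * h))) / (2 * pi)"
      by (simp add: dist_norm norm_minus_commute diff_divide_distrib[symmetric] norm_divide norm_mult)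
    also have "\<dots> \<le> e / 2" using * pi_gt_zero by (simp add: divide_simps mult.commute)
    finally show ?thesis using e by simp
  qed
  then show "\<forall>\<^sub>F N in sequentially. \<forall>p\<in>K. dist (\<Sum>j<N. g p (2 * pi * of_nat j / of_nat N) / of_nat N)
     (integral {0..2 * pi} (g p) / (2 * of_real pi)) < e"
    unfolding eventually_sequentially by blast
qed

text \<open>The \<open>k\<close>-th Fourier coefficient of \<open>t\<close> maps to
  \<open>F (rot t p)\<close>, that is, the projection of \<open>F\<close> onto rotation weight
  \<open>k\<close>.\<close>

definition mode_part :: "int \<Rightarrow> (complex \<times> complex \<Rightarrow> complex) \<Rightarrow> complex \<times> complex \<Rightarrow> complex" where
  "mode_part k F = restrict_bidisk
     (\<lambda>p. integral {0..2 * pi} (\<lambda>t. cis (- of_int k * t) * F (rot t p)) / (2 * of_real pi))"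

text \<open>The Riemann sum of \<open>mode_part\<close> over the rotations by \<open>N\<close>-th
  roots of unity: a finite linear combination of rotated copies of \<open>F\<close>, hence a member
  of every rotation invariant subspace that contains \<open>F\<close>.\<close>

definition rsum :: "int \<Rightarrow> (complex \<times> complex \<Rightarrow> complex) \<Rightarrow> nat \<Rightarrow> complex \<times> complex \<Rightarrow> complex" where
  "rsum k F N = (\<Sum>j<N. fun_scale (cis (- of_int k * (2 * pi * of_nat j / of_nat N)) / of_nat N)
     (F \<circ> rot (2 * pi * of_nat j / of_nat N)))"

lemma sum_fun_apply: "(\<Sum>i\<in>I. f i) x = (\<Sum>i\<in>I. f i x)"
  by (induction I rule: infinite_finite_induct) auto

lemma continuous_on_rot_integrand:
  assumes F: "jointly_holomorphic F disc disc" and K: "K \<subseteq> bidisk"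
  shows "continuous_on (K \<times> T) (\<lambda>(p, t). cis (- of_int k * t) * F (rot t p))"
proof -
  have "continuous_on (K \<times> T) (\<lambda>x. F (rot (snd x) (fst x)))"
  proof (rule continuous_on_compose2[OF jointly_holomorphicD(1)[OF F]])
    show "continuous_on (K \<times> T) (\<lambda>x. rot (snd x) (fst x))"
      unfolding rot_def map_prod_def case_prod_beta cis_conv_exp by (intro continuous_intros)
    show "(\<lambda>x. rot (snd x) (fst x)) ` (K \<times> T) \<subseteq> disc \<times> disc"
      using K rot_in_bidisk unfolding bidisk_def[symmetric] by fastforce
  qed
  then show ?thesis
    unfolding case_prod_beta cis_conv_exp by (intro continuous_intros)
qed

lemma loc_unif_rsum:
  assumes F: "F \<in> holo_bidisk"
  shows "loc_unif (rsum k F) (mode_part k F) sequentially"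
  unfolding loc_unif_def
proof (intro allI impI)
  fix K :: "(complex \<times> complex) set" assume K: "compact K \<and> K \<subseteq> bidisk"
  have h: "jointly_holomorphic F disc disc" using F by (simp add: holo_bidisk_iff)
  have "uniform_limit K (\<lambda>N p. \<Sum>j<N. cis (- of_int k * (2 * pi * of_nat j / of_nat N)) * F (rot (2 * pi * of_nat j / of_nat N) p) / of_nat N)
     (\<lambda>p. integral {0..2 * pi} (\<lambda>t. cis (- of_int k * t) * F (rot t p)) / (2 * of_real pi)) sequentially"
    using K by (intro riemann_sum_uniform_limit continuous_on_rot_integrand[OF h]) auto
  then show "uniform_limit K (rsum k F) (mode_part k F) sequentially"
    by (rule uniform_limit_cong'[THEN iffD1, rotated 2])
      (use K in \<open>auto simp: rsum_def sum_fun_apply fun_scale_def mode_part_def restrict_bidisk_def\<close>)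
qed

lemma mode_part_outside: "p \<notin> bidisk \<Longrightarrow> mode_part k F p = 0"
  by (simp add: mode_part_def restrict_bidisk_def)

lemma rsum_in_subspace:
  assumes "cfun.subspace Y" "F \<in> Y" "\<And>t G. G \<in> Y \<Longrightarrow> G \<circ> rot t \<in> Y"
  shows "rsum k F N \<in> Y"
  unfolding rsum_def using assms by (intro cfun.subspace_sum cfun.subspace_scale)

lemma mode_part_eigenspace:
  assumes F: "F \<in> eigenspace lam"
  shows "mode_part k F \<in> eigenspace lam"
  by (rule eigenspace_limit[OF loc_unif_rsum[OF eigenspaceD(1)[OF F]]])
    (auto intro!: always_eventually rsum_in_subspace subspace_eigenspace eigenspace_rot F mode_part_outside
       simp del: split_paired_All)

lemma mode_part_closed_subspace:
  assumes Y: "cfun.subspace Y" "closedin holo_topology Y" "Y \<subseteq> eigenspace lam"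
    and rot: "\<And>t G. G \<in> Y \<Longrightarrow> G \<circ> rot t \<in> Y" and F: "F \<in> Y"
  shows "mode_part k F \<in> Y"
proof (rule closedin_holo_topologyD[OF Y(2)])
  have Fe: "F \<in> eigenspace lam" using Y F by auto
  show "loc_unif (rsum k F) (mode_part k F) sequentially" by (rule loc_unif_rsum[OF eigenspaceD(1)[OF Fe]])
  show "\<forall>\<^sub>F n in sequentially. rsum k F n \<in> Y"
    by (intro always_eventually allI rsum_in_subspace Y F rot)
  show "mode_part k F \<in> holo_bidisk" using eigenspaceD(1)[OF mode_part_eigenspace[OF Fe]] .
qed simp

lemma jointly_holomorphic_sum:
  assumes "\<And>i. i \<in> I \<Longrightarrow> jointly_holomorphic (f i) U V"
  shows "jointly_holomorphic (\<Sum>i\<in>I. f i) U V"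
  using assms
proof (induction I rule: infinite_finite_induct)
  case (insert x I)
  then show ?case unfolding sum.insert[OF insert(1,2)] by (intro jointly_holomorphic_add) auto
qed (auto simp: jointly_holomorphic_def zero_fun_def)

lemma lead_sum:
  assumes "\<And>i. i \<in> I \<Longrightarrow> jointly_holomorphic (f i) disc disc"
  shows "lead k (\<Sum>i\<in>I. f i) = (\<Sum>i\<in>I. lead k (f i))"
  using assms
proof (induction I rule: infinite_finite_induct)
  case (insert x I)
  have "lead k (f x + (\<Sum>i\<in>I. f i)) = lead k (f x) + lead k (\<Sum>i\<in>I. f i)"
    using insert.prems by (intro lead_add jointly_holomorphic_sum) auto
  also have "lead k (\<Sum>i\<in>I. f i) = (\<Sum>i\<in>I. lead k (f i))"
    by (rule insert.IH) (use insert.prems in auto)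
  finally show ?case unfolding sum.insert[OF insert(1,2)] .
qed (simp_all add: zero_fun_def[symmetric])

text \<open>The bound on \<open>N\<close> prevents \<open>N\<close> from dividing a nonzero
  \<open>d\<close>. The summands are then the powers of a number \<open>u \<noteq> 1\<close> with
  \<open>u ^ N = 1\<close>, and the geometric sum vanishes.\<close>

lemma sum_roots_of_unity:
  assumes "N > nat \<bar>d\<bar>"
  shows "(\<Sum>j<N. cis (of_int d * (2 * pi * of_nat j / of_nat N))) = (if d = 0 then of_nat N else 0)"
proof (cases "d = 0")
  case False
  define u where "u = cis (2 * pi * of_int d / of_nat N)"
  have pw: "cis (of_int d * (2 * pi * of_nat j / of_nat N)) = u ^ j" for j
    by (simp add: u_def Complex.DeMoivre mult_ac)
  have "u \<noteq> 1"
  proof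
    assume "u = 1"
    then have "exp (\<i> * of_real (2 * pi * of_int d / of_nat N)) = 1" by (simp add: u_def cis_conv_exp)
    then obtain n :: int where "2 * pi * of_int d / of_nat N = of_int (2 * n) * pi" by (auto simp: exp_eq_1)
    then have "real_of_int d = of_int n * of_nat N" using assms by (simp add: field_simps)
    then have "d = n * int N" by (metis of_int_eq_iff of_int_mult of_int_of_nat_eq)
    then have "int N dvd d" by simp
    then have "\<bar>int N\<bar> \<le> \<bar>d\<bar>" by (rule dvd_imp_le_int[OF False])
    then show False using assms by linarith
  qed
  moreover have "u ^ N = 1"
  proof -
    have "u ^ N = cis (2 * pi * of_int d)" using assms by (simp add: u_def Complex.DeMoivre)
    then show ?thesis by (simp add: cis_multiple_2pi)
  qed
  ultimately show ?thesis using False unfolding pw by (simp add: geometric_sum)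
qed simp

text \<open>The Riemann sums are already exact: by orthogonality of roots of unity,
  \<open>lead n (rsum k F N)\<close> has the claimed value as soon as \<open>N\<close> exceeds
  \<open>\<bar>n - k\<bar>\<close>. The limit is that of an eventually constant sequence.\<close>

lemma lead_mode_part:
  assumes F: "F \<in> eigenspace lam"
  shows "lead n (mode_part k F) = (if n = k then lead n F else 0)"
proof (rule LIMSEQ_unique)
  note h = eigenspaceD(2)[OF F]
  have hr: "jointly_holomorphic (F \<circ> rot t) disc disc" for t using eigenspaceD(2)[OF eigenspace_rot[OF F]] .
  show "(\<lambda>N. lead n (rsum k F N)) \<longlonglongrightarrow> lead n (mode_part k F)"
    by (rule lead_limit[OF loc_unif_rsum[OF eigenspaceD(1)[OF F]]])
      (auto intro!: always_eventually jointly_holomorphic_sum jointly_holomorphic_fun_scale hr simp: rsum_def)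
  have "lead n (rsum k F N) = (if n = k then lead n F else 0)" if "N > nat \<bar>n - k\<bar>" for N
  proof -
    have "lead n (rsum k F N) = (\<Sum>j<N. cis (- of_int k * (2 * pi * of_nat j / of_nat N)) / of_nat N *
        (cis (of_int n * (2 * pi * of_nat j / of_nat N)) * lead n F))"
      by (simp add: rsum_def lead_sum jointly_holomorphic_fun_scale hr lead_fun_scale lead_rot[OF h])
    also have "\<dots> = (\<Sum>j<N. cis (of_int (n - k) * (2 * pi * of_nat j / of_nat N))) / of_nat N * lead n F"
      unfolding sum_divide_distrib sum_distrib_right
    proof (intro sum.cong refl)
      fix j
      have "cis (of_int (n - k) * (2 * pi * of_nat j / of_nat N)) =
         cis (- of_int k * (2 * pi * of_nat j / of_nat N)) * cis (of_int n * (2 * pi * of_nat j / of_nat N))"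
        unfolding cis_mult by (simp add: algebra_simps diff_divide_distrib)
      then show "cis (- of_int k * (2 * pi * of_nat j / of_nat N)) / of_nat N *
        (cis (of_int n * (2 * pi * of_nat j / of_nat N)) * lead n F) =
        cis (of_int (n - k) * (2 * pi * of_nat j / of_nat N)) / of_nat N * lead n F" by simp
    qed
    also have "\<dots> = (if n = k then lead n F else 0)"
      unfolding sum_roots_of_unity[OF that] using that by auto
    finally show ?thesis .
  qed
  then have "\<forall>\<^sub>F N in sequentially. lead n (rsum k F N) = (if n = k then lead n F else 0)"
    unfolding eventually_sequentially by (meson Suc_le_lessD)
  then show "(\<lambda>N. lead n (rsum k F N)) \<longlonglongrightarrow> (if n = k then lead n F else 0)"
    by (rule tendsto_eventually)
qed

lemma eigenspace_eqI:
  assumes F: "F \<in> eigenspace lam" and G: "G \<in> eigenspace lam" and l: "\<And>k. lead k F = lead k G"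
  shows "F = G"
proof -
  have "F + fun_scale (- 1) G \<in> eigenspace lam"
    by (intro cfun.subspace_add[OF subspace_eigenspace] cfun.subspace_scale[OF subspace_eigenspace] F G)
  moreover have "lead k (F + fun_scale (- 1) G) = 0" for k
    using lead_add[OF eigenspaceD(2)[OF F] jointly_holomorphic_fun_scale[OF eigenspaceD(2)[OF G]], of k "- 1"]
      lead_fun_scale[OF eigenspaceD(2)[OF G], of k "- 1"] l[of k] by simp
  ultimately have "F + fun_scale (- 1) G = 0" by (rule eigenspace_eq_0)
  then show ?thesis by (auto simp: fun_eq_iff fun_scale_def)
qed

text \<open>Both sides are eigenfunctions with the same leads, so uniqueness replaces a change of
  variables in the integral.\<close>

lemma mode_part_rot:
  assumes F: "F \<in> eigenspace lam"
  shows "mode_part k F (rot s p) = cis (of_int k * s) * mode_part k F p"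
proof -
  have P: "mode_part k F \<in> eigenspace lam" by (rule mode_part_eigenspace[OF F])
  have "mode_part k F \<circ> rot s = fun_scale (cis (of_int k * s)) (mode_part k F)"
  proof (rule eigenspace_eqI)
    show "lead n (mode_part k F \<circ> rot s) = lead n (fun_scale (cis (of_int k * s)) (mode_part k F))" for n
      by (simp add: lead_rot lead_fun_scale eigenspaceD(2)[OF P] lead_mode_part[OF F])
  qed (auto intro: eigenspace_rot P cfun.subspace_scale[OF subspace_eigenspace])
  then show ?thesis by (auto simp: fun_eq_iff fun_scale_def simp del: split_paired_All)
qed

lemma mode_part_bound:
  assumes F: "jointly_holomorphic F disc disc" and p: "p \<in> bidisk" and B: "\<And>t. norm (F (rot t p)) \<le> B"
  shows "norm (mode_part k F p) \<le> B"
proof -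
  have "norm (integral {0..2 * pi} (\<lambda>t. cis (- of_int k * t) * F (rot t p))) \<le> B * (2 * pi - 0)"
  proof (rule integral_bound)
    show "continuous_on {0..2 * pi} (\<lambda>t. cis (- of_int k * t) * F (rot t p))"
      using continuous_on_slice[OF continuous_on_rot_integrand[OF F, of "{p}"]] p by blast
  qed (use B in \<open>auto simp: norm_mult\<close>)
  then show ?thesis using p by (simp add: mode_part_def restrict_bidisk_def norm_divide norm_mult divide_simps mult_ac)
qed

section \<open>The mode expansion\<close>

lemma curve_has_derivative:
  assumes G: "jointly_holomorphic G disc disc" and px: "p x \<in> disc" "q x \<in> disc"
    and p: "(p has_field_derivative p') (at x)" and q: "(q has_field_derivative q') (at x)"
  shows "((\<lambda>x. G (p x, q x)) has_field_derivative dz G (p x, q x) * p' + dw G (p x, q x) * q') (at x)"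
proof -
  define a where "a = dz G (p x, q x)"
  define b where "b = dw G (p x, q x)"
  have "(G has_derivative (\<lambda>(h, k). a * h + b * k)) (at (p x, q x) within disc \<times> disc)"
    unfolding a_def b_def by (rule jointly_holomorphic_imp_has_derivative[OF G open_ball open_ball convex_ball px])
  moreover have "at (p x, q x) within disc \<times> disc = at (p x, q x)"
    using px by (intro at_within_open open_Times) auto
  ultimately have 1: "(G has_derivative (\<lambda>(h, k). a * h + b * k)) (at (p x, q x))" by simp
  have "((\<lambda>x. (p x, q x)) has_derivative (\<lambda>h. (p' * h, q' * h))) (at x)"
    using p q unfolding has_field_derivative_def by (rule has_derivative_Pair)
  from has_derivative_compose[OF this 1]
  have "((\<lambda>x. G (p x, q x)) has_derivative (*) (a * p' + b * q')) (at x)"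
    by (rule has_derivative_eq_rhs) (auto simp: algebra_simps fun_eq_iff)
  then show ?thesis unfolding has_field_derivative_def a_def b_def .
qed

lemma holomorphic_curve:
  assumes G: "jointly_holomorphic G disc disc" and S: "open S"
    and p: "p holomorphic_on S" "p ` S \<subseteq> disc" and q: "q holomorphic_on S" "q ` S \<subseteq> disc"
  shows "(\<lambda>x. G (p x, q x)) holomorphic_on S"
  unfolding holomorphic_on_open[OF S]
proof
  fix x assume x: "x \<in> S"
  then have "p x \<in> disc" "q x \<in> disc" using p q by blast+
  then show "\<exists>f'. ((\<lambda>x. G (p x, q x)) has_field_derivative f') (at x)"
    using curve_has_derivative[OF G _ _ holomorphic_derivI[OF p(1) S x] holomorphic_derivI[OF q(1) S x]] by blast
qed

text \<open>For \<open>u\<close> on the unit circle this is \<open>mode_part_rot\<close>. Both sides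
  are holomorphic in \<open>u\<close> on the annulus \<open>r < norm u < 1 / r\<close>, where
  \<open>z / u\<close> and \<open>w * u\<close> stay in the disc, so the identity theorem extends
  the equality to real dilations.\<close>

lemma mode_part_homogeneous:
  assumes F: "F \<in> eigenspace lam" and r: "0 < r" "r < 1" and z: "norm z \<le> r" and w: "norm w \<le> r"
    and u: "r < norm u" "norm u < 1 / r"
  shows "mode_part k F (z / u, w * u) = u powi k * mode_part k F (z, w)"
proof -
  define S where "S = {u :: complex. r < norm (u - 0) \<and> norm (u - 0) < 1 / r}"
  have S: "open S" "connected S"
  proof -
    have "S = (norm -` {r<..<1 / r})" by (auto simp: S_def)
    then show "open S" by (simp add: open_vimage continuous_on_norm_id)
    show "connected S" unfolding S_def by (rule connected_annulus) simp
  qed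
  have r1: "1 < 1 / r" using r by simp
  have S0: "u \<noteq> 0" if "u \<in> S" for u using that r by (auto simp: S_def)
  note h = eigenspaceD(2)[OF mode_part_eigenspace[OF F, of k]]
  have "mode_part k F (z / u, w * u) - u powi k * mode_part k F (z, w) = 0"
  proof (rule analytic_continuation[where f = "\<lambda>u. mode_part k F (z / u, w * u) - u powi k * mode_part k F (z, w)", OF _ S])
    have "(\<lambda>u. mode_part k F (z / u, w * u)) holomorphic_on S"
    proof (rule holomorphic_curve[OF h S(1)])
      show "(\<lambda>u. z / u) ` S \<subseteq> disc"
        using z r by (auto simp: S_def norm_divide divide_simps)
      show "(\<lambda>u. w * u) ` S \<subseteq> disc"
      proof clarsimp
        fix u assume "u \<in> S"
        then have "norm u < 1 / r" "0 < norm u" using r by (auto simp: S_def intro: less_trans)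
        then have "norm w * norm u \<le> r * norm u" "r * norm u < r * (1 / r)"
          using w r(1) by (intro mult_right_mono mult_strict_left_mono; simp)+
        then have "norm w * norm u < 1" using r(1) by simp
        then show "norm (w * u) < 1" by (simp add: norm_mult)
      qed
    qed (use S0 in \<open>auto intro!: holomorphic_intros\<close>)
    then show "(\<lambda>u. mode_part k F (z / u, w * u) - u powi k * mode_part k F (z, w)) holomorphic_on S"
      using S0 by (auto intro!: holomorphic_intros)
    show "sphere 0 1 \<subseteq> S" "1 \<in> S" "u \<in> S"
      using r r1 u by (auto simp: S_def)
    \<comment> \<open>A connected set with more than one point has no isolated point.\<close>
    show "(1 :: complex) islimpt sphere 0 1"
    proof (rule connected_imp_perfect)
      show "connected (sphere (0 :: complex) 1)" by (rule connected_sphere) simp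
      show "sphere (0 :: complex) 1 \<noteq> {x}" for x
      proof
        assume "sphere (0 :: complex) 1 = {x}"
        moreover have "(1 :: complex) \<in> sphere 0 1" "- 1 \<in> sphere (0 :: complex) 1" by auto
        ultimately have "(1 :: complex) = - 1" by auto
        then show False by simp
      qed
    qed simp
    fix v :: complex assume "v \<in> sphere 0 1"
    then obtain t where t: "v = cis t"
      by (metis complex_norm_eq_1_exp cis_conv_exp dist_0_norm mem_sphere mult.commute)
    have "mode_part k F (rot t (z, w)) = cis (of_int k * t) * mode_part k F (z, w)" by (rule mode_part_rot[OF F])
    then show "mode_part k F (z / v, w * v) - v powi k * mode_part k F (z, w) = 0"
      by (simp add: t rot_apply Complex.cis_power_int cis_divide[symmetric] divide_inverse)
  qed
  then show ?thesis by simp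
qed

text \<open>Homogeneity trades the radius for decay in \<open>k\<close>: moving the point by a
  suitable \<open>u\<close> keeps it in the larger bidisk of radius \<open>R\<close>, where the mode
  is bounded by \<open>B\<close>, and multiplies the mode by a factor of norm
  \<open>(R / r) ^ nat \<bar>k\<bar>\<close>.\<close>

lemma mode_part_decay:
  assumes F: "F \<in> eigenspace lam" and r: "0 < r" "r < R" "R < 1"
    and B: "\<And>p. p \<in> cball 0 R \<times> cball 0 R \<Longrightarrow> norm (F p) \<le> B" and p: "p \<in> cball 0 r \<times> cball 0 r"
  shows "norm (mode_part k F p) \<le> B * (r / R) ^ nat \<bar>k\<bar>"
proof -
  obtain z w where p: "p = (z, w)" "norm z \<le> r" "norm w \<le> r" using p by auto
  \<comment> \<open>The sign of \<open>k\<close> decides whether \<open>w\<close> is dilated and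
    \<open>z\<close> contracted or the reverse; in either case the power \<open>u powi k\<close> is
    large.\<close>
  define u where "u = complex_of_real (if k \<ge> 0 then R / r else r / R)"
  have lt: "r < 1" "r / R < 1" "r < r / R" "R / r < 1 / r" "r / R < 1 / r" "r < R / r"
  proof -
    show 1: "r < 1" "r / R < 1" using r by auto
    have 2: "1 < 1 / r" "1 < R / r" "1 < 1 / R" using r by auto
    show "R / r < 1 / r" using r by (intro divide_strict_right_mono) auto
    show "r / R < 1 / r" "r < R / r" using 1 2 by linarith+
    have "r * 1 < r * (1 / R)" using 2 r by (intro mult_strict_left_mono) auto
    then show "r < r / R" by simp
  qed
  have u0: "u \<noteq> 0" using r by (auto simp: u_def)
  have nu: "norm u = (if k \<ge> 0 then R / r else r / R)" using r by (simp add: u_def)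
  have eq: "mode_part k F (z / u, w * u) = u powi k * mode_part k F (z, w)"
    by (rule mode_part_homogeneous[OF F r(1) lt(1) p(2,3)]) (use nu lt in auto)
  have zw: "norm (z / u) \<le> R" "norm (w * u) \<le> R"
  proof -
    have 1: "norm x * (R / r) \<le> R" if "norm x \<le> r" for x :: complex
      using that r by (simp add: divide_simps mult.commute)
    have 2: "norm x * (r / R) \<le> R" if "norm x \<le> r" for x :: complex
    proof -
      have "norm x * (r / R) \<le> norm x * 1" using lt by (intro mult_left_mono) auto
      then show ?thesis using that r by simp
    qed
    show "norm (z / u) \<le> R" "norm (w * u) \<le> R"
      using 1[OF p(2)] 1[OF p(3)] 2[OF p(2)] 2[OF p(3)] by (auto simp: norm_divide norm_mult nu)
  qed
  have bound: "norm (mode_part k F (z / u, w * u)) \<le> B"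
  proof (rule mode_part_bound[OF eigenspaceD(2)[OF F]])
    show "(z / u, w * u) \<in> bidisk" using zw r by (auto simp: bidisk_def)
    show "norm (F (rot t (z / u, w * u))) \<le> B" for t
      by (rule B) (use zw in \<open>auto simp: rot_apply norm_mult norm_divide\<close>)
  qed
  have "norm (u powi k) = (R / r) ^ nat \<bar>k\<bar>"
    using r by (auto simp: power_int_def norm_power norm_inverse nu)
  then have "(R / r) ^ nat \<bar>k\<bar> * norm (mode_part k F p) \<le> B"
    using bound unfolding eq p(1) by (simp add: norm_mult)
  moreover have *: "(r / R) ^ nat \<bar>k\<bar> * (R / r) ^ nat \<bar>k\<bar> = 1"
    using r by (simp add: power_mult_distrib[symmetric])
  ultimately have "(r / R) ^ nat \<bar>k\<bar> * ((R / r) ^ nat \<bar>k\<bar> * norm (mode_part k F p)) \<le> (r / R) ^ nat \<bar>k\<bar> * B"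
    using r by (intro mult_left_mono) auto
  then show ?thesis using * by (simp only: mult.assoc[symmetric] mult_1_left mult.commute[of B])
qed

lemma compact_bidisk_subset:
  assumes "compact K" "K \<subseteq> bidisk"
  obtains r where "0 < r" "r < 1" "K \<subseteq> cball 0 r \<times> cball 0 r"
proof -
  have "\<exists>r<1. \<forall>p\<in>K. max (norm (fst p)) (norm (snd p)) \<le> r"
  proof (cases "K = {}")
    case False
    have "continuous_on K (\<lambda>p. max (norm (fst p)) (norm (snd p)))" by (intro continuous_intros)
    from continuous_attains_sup[OF assms(1) False this]
    obtain q where "q \<in> K" "\<forall>p\<in>K. max (norm (fst p)) (norm (snd p)) \<le> max (norm (fst q)) (norm (snd q))"
      by blast
    then show ?thesis using assms(2) by (intro exI[of _ "max (norm (fst q)) (norm (snd q))"]) (auto simp: bidisk_def)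
  qed (auto intro: exI[of _ 0])
  then obtain r where "r < 1" "\<forall>p\<in>K. max (norm (fst p)) (norm (snd p)) \<le> r" by blast
  then show ?thesis by (intro that[of "max r (1/2)"]) auto
qed

text \<open>Pairing \<open>i\<close> with \<open>- i - 1\<close> lists every integer once. The decay
  estimate and the Weierstrass test give convergence to some eigenfunction \<open>G\<close>; since
  leads pass to the limit, \<open>G\<close> has the leads of \<open>F\<close>, and uniqueness gives
  \<open>G = F\<close>. No pointwise Fourier convergence theorem is involved.\<close>

lemma mode_part_series:
  assumes F: "F \<in> eigenspace lam"
  shows "loc_unif (\<lambda>N. \<Sum>i<N. mode_part (int i) F + mode_part (- int i - 1) F) F sequentially"
proof -
  define f where "f = (\<lambda>i. mode_part (int i) F + mode_part (- int i - 1) F)"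
  define G where "G = (\<lambda>p. suminf (\<lambda>i. f i p))"
  have fe: "f i \<in> eigenspace lam" for i
    unfolding f_def by (intro cfun.subspace_add[OF subspace_eigenspace] mode_part_eigenspace F)
  have lu: "loc_unif (\<lambda>N. \<Sum>i<N. f i) G sequentially"
    unfolding loc_unif_def
  proof (intro allI impI)
    fix K :: "(complex \<times> complex) set" assume "compact K \<and> K \<subseteq> bidisk"
    then obtain r where r: "0 < r" "r < 1" "K \<subseteq> cball 0 r \<times> cball 0 r"
      using compact_bidisk_subset by blast
    obtain R where R: "r < R" "R < 1" using dense[OF r(2)] by blast
    have "continuous_on (cball 0 R \<times> cball 0 R) F"
      by (rule continuous_on_subset[OF jointly_holomorphicD(1)[OF eigenspaceD(2)[OF F]]]) (use R in auto)
    then have "bounded (F ` (cball 0 R \<times> cball 0 R))"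
      by (intro compact_imp_bounded compact_continuous_image compact_Times compact_cball)
    then obtain B where B: "\<And>p. p \<in> cball 0 R \<times> cball 0 R \<Longrightarrow> norm (F p) \<le> B"
      by (auto simp: bounded_iff)
    have B0: "0 \<le> B" using B[of "(0, 0)"] r R by (force intro: order_trans[OF norm_ge_zero])
    have q: "r / R < 1" "0 \<le> r / R" using r R by auto
    have "uniform_limit (cball 0 r \<times> cball 0 r) (\<lambda>N p. \<Sum>i<N. f i p) G sequentially"
      unfolding G_def
    proof (rule Weierstrass_m_test)
      show "summable (\<lambda>i. 2 * B * (r / R) ^ i)"
        using q by (intro summable_mult summable_geometric) auto
      fix i p assume p: "p \<in> cball (0 :: complex) r \<times> cball (0 :: complex) r"
      have "norm (f i p) \<le> norm (mode_part (int i) F p) + norm (mode_part (- int i - 1) F p)"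
        unfolding f_def plus_fun_def by (rule norm_triangle_ineq)
      also have "\<dots> \<le> B * (r / R) ^ nat \<bar>int i\<bar> + B * (r / R) ^ nat \<bar>- int i - 1\<bar>"
        by (intro add_mono mode_part_decay[OF F r(1) R B p])
      also have "\<dots> \<le> B * (r / R) ^ i + B * (r / R) ^ i"
      proof (intro add_mono mult_left_mono power_decreasing)
        show "i \<le> nat \<bar>- int i - 1\<bar>" by linarith
      qed (use q B0 in auto)
      finally show "norm (f i p) \<le> 2 * B * (r / R) ^ i" by simp
    qed
    then have "uniform_limit K (\<lambda>N p. \<Sum>i<N. f i p) G sequentially"
      using r(3) by (rule uniform_limit_on_subset)
    then show "uniform_limit K (\<lambda>N. \<Sum>i<N. f i) G sequentially"
      by (simp add: sum_fun_apply[abs_def])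
  qed
  have Se: "(\<Sum>i<N. f i) \<in> eigenspace lam" for N
    by (intro cfun.subspace_sum[OF subspace_eigenspace] fe)
  have Ge: "G \<in> eigenspace lam"
    by (rule eigenspace_limit[OF lu]) (auto simp: Se G_def eigenspaceD(3)[OF fe] simp del: split_paired_All)
  have "G = F"
  proof (rule eigenspace_eqI[OF Ge F])
    fix k
    have "(\<lambda>N. lead k (\<Sum>i<N. f i)) \<longlonglongrightarrow> lead k G"
      by (rule lead_limit[OF lu]) (auto intro: always_eventually eigenspaceD(2)[OF Se])
    moreover have "lead k (\<Sum>i<N. f i) = lead k F" if N: "N > nat \<bar>k\<bar>" for N
    proof -
      \<comment> \<open>The position of the only pair \<open>{i, - i - 1}\<close> that contains
        \<open>k\<close>.\<close>
      define i0 where "i0 = (if k \<ge> 0 then nat k else nat (- k - 1))"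
      have "lead k (\<Sum>i<N. f i) = (\<Sum>i<N. lead k (f i))"
        by (rule lead_sum) (rule eigenspaceD(2)[OF fe])
      also have "\<dots> = (\<Sum>i<N. if i = i0 then lead k F else 0)"
      proof (intro sum.cong refl)
        fix i
        have "lead k (f i) = lead k (mode_part (int i) F) + lead k (mode_part (- int i - 1) F)"
          unfolding f_def by (intro lead_add eigenspaceD(2)[OF mode_part_eigenspace[OF F]])
        then show "lead k (f i) = (if i = i0 then lead k F else 0)"
          by (auto simp: lead_mode_part[OF F] i0_def)
      qed
      also have "\<dots> = lead k F" using N by (auto simp: i0_def)
      finally show ?thesis .
    qed
    then have "\<forall>\<^sub>F N in sequentially. lead k (\<Sum>i<N. f i) = lead k F"
      unfolding eventually_sequentially by (meson Suc_le_lessD)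
    then have "(\<lambda>N. lead k (\<Sum>i<N. f i)) \<longlonglongrightarrow> lead k F" by (rule tendsto_eventually)
    ultimately show "lead k G = lead k F" by (rule LIMSEQ_unique)
  qed
  then show ?thesis using lu by (simp add: f_def)
qed

section \<open>Closed rotation invariant subspaces\<close>

definition spectral_space :: "complex \<Rightarrow> int set \<Rightarrow> (complex \<times> complex \<Rightarrow> complex) set" where
  "spectral_space lam N = {F \<in> eigenspace lam. \<forall>k. k \<notin> N \<longrightarrow> lead k F = 0}"

lemma subspace_spectral_space: "cfun.subspace (spectral_space lam N)"
  using subspace_eigenspace[of lam] unfolding cfun.subspace_def spectral_space_def
  by (auto simp: lead_add lead_fun_scale eigenspaceD(2))

lemma closedin_spectral_space: "closedin holo_topology (spectral_space lam N)"
proof (rule closedin_holo_topologyI)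
  fix F and A :: "(complex \<times> complex \<Rightarrow> complex) filter"
  assume A: "A \<noteq> bot" and ev: "\<forall>\<^sub>F G in A. G \<in> spectral_space lam N" and F: "F \<in> holo_bidisk"
    and lu: "loc_unif (\<lambda>G. G) F A"
  have ev1: "\<forall>\<^sub>F G in A. G \<in> eigenspace lam"
    using ev by eventually_elim (simp add: spectral_space_def)
  have "F \<in> eigenspace lam"
    by (rule closedin_holo_topologyD[OF closedin_eigenspace A ev1 lu F])
  moreover have "lead k F = 0" if "k \<notin> N" for k
  proof (rule tendsto_unique[OF A])
    show "((\<lambda>G. lead k G) \<longlongrightarrow> lead k F) A"
      by (rule lead_limit[OF lu A]) (use ev1 in \<open>auto elim!: eventually_mono intro: eigenspaceD(2)\<close>)
    have "\<forall>\<^sub>F G in A. lead k G = 0"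
      using ev by eventually_elim (use that in \<open>simp add: spectral_space_def\<close>)
    then show "((\<lambda>G. lead k G) \<longlongrightarrow> 0) A" by (rule tendsto_eventually)
  qed
  ultimately show "F \<in> spectral_space lam N" by (simp add: spectral_space_def)
qed (auto simp: spectral_space_def dest: eigenspaceD(1))

lemma mode_part_partial_sum_limit:
  assumes Y: "cfun.subspace Y" "closedin holo_topology Y" and F: "F \<in> eigenspace lam"
    and m: "\<And>k. mode_part k F \<in> Y"
  shows "F \<in> Y"
  by (rule closedin_holo_topologyD[OF Y(2) _ _ mode_part_series[OF F] eigenspaceD(1)[OF F]])
    (auto intro!: always_eventually cfun.subspace_sum[OF Y(1)] cfun.subspace_add[OF Y(1)] m)

lemma mode_part_eq_scale:
  assumes F: "F \<in> eigenspace lam" and G: "G \<in> eigenspace lam" and l: "lead k G \<noteq> 0"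
  shows "mode_part k F = fun_scale (lead k F / lead k G) (mode_part k G)"
proof (rule eigenspace_eqI[where lam = lam])
  show "lead n (mode_part k F) = lead n (fun_scale (lead k F / lead k G) (mode_part k G))" for n
    using l by (simp add: lead_mode_part[OF F] lead_mode_part[OF G] lead_fun_scale[OF eigenspaceD(2)[OF mode_part_eigenspace[OF G]]])
qed (intro mode_part_eigenspace F G cfun.subspace_scale[OF subspace_eigenspace])+

text \<open>If \<open>k\<close> occurs in \<open>Y\<close>, say through \<open>G\<close>, then the
  \<open>k\<close>-th mode of any eigenfunction is a multiple of that of \<open>G\<close>, which
  lies in \<open>Y\<close>. If \<open>k\<close> does not occur, the \<open>k\<close>-th mode of
  \<open>F\<close> is zero. The partial sums of the mode series of \<open>F\<close> thus lie in
  \<open>Y\<close>, and \<open>Y\<close> is closed.\<close>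

theorem closed_rotation_invariant_subspace:
  assumes Y: "cfun.subspace Y" "closedin holo_topology Y" "Y \<subseteq> eigenspace lam"
    and rot: "\<And>t G. G \<in> Y \<Longrightarrow> G \<circ> rot t \<in> Y"
  shows "Y = spectral_space lam {k. \<exists>G\<in>Y. lead k G \<noteq> 0}"
proof
  show "Y \<subseteq> spectral_space lam {k. \<exists>G\<in>Y. lead k G \<noteq> 0}"
    using Y(3) by (auto simp: spectral_space_def)
  show "spectral_space lam {k. \<exists>G\<in>Y. lead k G \<noteq> 0} \<subseteq> Y"
  proof
    fix F assume "F \<in> spectral_space lam {k. \<exists>G\<in>Y. lead k G \<noteq> 0}"
    then have F: "F \<in> eigenspace lam" and l: "\<And>k. \<forall>G\<in>Y. lead k G = 0 \<Longrightarrow> lead k F = 0"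
      by (auto simp: spectral_space_def)
    show "F \<in> Y"
    proof (rule mode_part_partial_sum_limit[OF Y(1,2) F])
      fix k
      show "mode_part k F \<in> Y"
      proof (cases "\<exists>G\<in>Y. lead k G \<noteq> 0")
        case True
        then obtain G where G: "G \<in> Y" "lead k G \<noteq> 0" by blast
        have "mode_part k F = fun_scale (lead k F / lead k G) (mode_part k G)"
          using G Y(3) by (intro mode_part_eq_scale[OF F]) auto
        also have "\<dots> \<in> Y"
          by (intro cfun.subspace_scale[OF Y(1)] mode_part_closed_subspace[OF Y rot G(1)])
        finally show ?thesis .
      next
        case False
        have "mode_part k F = 0"
          by (rule eigenspace_eq_0[OF mode_part_eigenspace[OF F]]) (use False l lead_mode_part[OF F] in auto)
        then show ?thesis using cfun.subspace_0[OF Y(1)] by simp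
      qed
    qed
  qed
qed

section \<open>The Poisson kernel and the index shift\<close>

text \<open>The bracket equals (1 - zw) / ((1 - z)(1 - w)), so this is the integrand of the Poisson
  modes of order \<open>m + 1\<close> at \<open>t = 0\<close> together with its prefactor. Written
  as a sum, each partial derivative of the bracket involves one variable only.\<close>

definition poisson_kernel :: "nat \<Rightarrow> complex \<times> complex \<Rightarrow> complex" where
  "poisson_kernel m = (\<lambda>p. (1 / (1 - fst p) + 1 / (1 - snd p) - 1) ^ Suc m)"

lemma disc_neq_1: "z \<in> disc \<Longrightarrow> 1 - z \<noteq> 0"
  by auto

lemma disc_mult: "z \<in> disc \<Longrightarrow> w \<in> disc \<Longrightarrow> z * w \<in> disc"
  using mult_strict_mono'[of "norm z" 1 "norm w" 1] by (auto simp: norm_mult)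

text \<open>For u = 1/(1 - z) + 1/(1 - w) - 1 the partial derivatives are 1/(1 - z)^2 and 1/(1 -
  w)^2, and 1 - zw = u (1 - z)(1 - w). Hence the operator sends u^(m+1) to 4 (m + 1) m u^(m-1)
  u^2.\<close>

lemma poisson_kernel_eigenspace:
  "restrict_bidisk (poisson_kernel m) \<in> eigenspace (4 * of_nat m * (of_nat m + 1))"
proof (rule restrict_bidisk_in_eigenspace)
  show "jointly_holomorphic (poisson_kernel m) disc disc"
    unfolding jointly_holomorphic_def poisson_kernel_def
    by (intro conjI ballI continuous_intros holomorphic_intros) (auto simp: disc_neq_1)
  fix z w :: complex assume zw: "z \<in> disc" "w \<in> disc"
  define u where "u = (\<lambda>z. 1 / (1 - z) + 1 / (1 - w) - 1)"
  have dw: "dw (poisson_kernel m) (x, w) = of_nat (Suc m) * u x ^ m * (1 / (1 - w) ^ 2)" if "x \<in> disc" for x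
  proof -
    have "((\<lambda>w. (1 / (1 - x) + 1 / (1 - w) - 1) ^ Suc m) has_field_derivative
       of_nat (Suc m) * u x ^ m * (1 / (1 - w) ^ 2)) (at w)"
    proof -
      have "((\<lambda>w. 1 / (1 - x) + 1 / (1 - w) - 1) has_field_derivative 1 / (1 - w) ^ 2) (at w)"
        using zw by (auto intro!: derivative_eq_intros simp: disc_neq_1 power2_eq_square)
      from DERIV_power[OF this, of "Suc m"] show ?thesis by (simp add: u_def mult_ac del: power_Suc)
    qed
    then show ?thesis by (simp add: dw_def poisson_kernel_def DERIV_imp_deriv)
  qed
  have "dz (dw (poisson_kernel m)) (z, w) = dz (\<lambda>p. of_nat (Suc m) * u (fst p) ^ m * (1 / (1 - w) ^ 2)) (z, w)"
    using dw zw by (intro dz_cong[of disc]) auto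
  also have "\<dots> = of_nat (Suc m) * (of_nat m * u z ^ (m - 1) * (1 / (1 - z) ^ 2)) * (1 / (1 - w) ^ 2)"
  proof -
    have "((\<lambda>x. of_nat (Suc m) * u x ^ m * (1 / (1 - w) ^ 2)) has_field_derivative
       of_nat (Suc m) * (of_nat m * u z ^ (m - 1) * (1 / (1 - z) ^ 2)) * (1 / (1 - w) ^ 2)) (at z)"
    proof -
      have "(u has_field_derivative 1 / (1 - z) ^ 2) (at z)"
        using zw unfolding u_def by (auto intro!: derivative_eq_intros simp: disc_neq_1 power2_eq_square)
      from DERIV_cmult_right[OF DERIV_cmult[OF DERIV_power[OF this, of m], of "of_nat (Suc m)"], of "1 / (1 - w) ^ 2"]
      show ?thesis by (simp add: mult_ac)
    qed
    then show ?thesis by (simp add: dz_def DERIV_imp_deriv)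
  qed
  finally have eq: "dz (dw (poisson_kernel m)) (z, w) =
     of_nat (Suc m) * (of_nat m * u z ^ (m - 1) * (1 / (1 - z) ^ 2)) * (1 / (1 - w) ^ 2)" .
  have u: "(1 - z * w) = u z * ((1 - z) * (1 - w))"
    using zw disc_neq_1[of z] disc_neq_1[of w] by (simp add: u_def divide_simps) (simp add: algebra_simps)
  \<comment> \<open>For \<open>m = 0\<close> the exponent \<open>m - 1\<close> is truncated to 0,
    but then the factor \<open>of_nat m\<close> vanishes.\<close>
  have um: "of_nat m * (u z)\<^sup>2 * u z ^ (m - 1) = of_nat m * u z ^ Suc m"
    by (cases m) (auto simp: power2_eq_square)
  have "4 * (1 - z * w)\<^sup>2 * dz (dw (poisson_kernel m)) (z, w) =
     4 * of_nat (Suc m) * (of_nat m * (u z)\<^sup>2 * u z ^ (m - 1))"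
    unfolding eq u using zw disc_neq_1[of z] disc_neq_1[of w] by (simp add: power_mult_distrib)
  also have "\<dots> = 4 * of_nat m * (of_nat m + 1) * poisson_kernel m (z, w)"
    unfolding um by (simp add: poisson_kernel_def u_def algebra_simps)
  finally show "4 * (1 - z * w)\<^sup>2 * dz (dw (poisson_kernel m)) (z, w) =
     4 * of_nat m * (of_nat m + 1) * poisson_kernel m (z, w)" .
qed

text \<open>Rotations fix \<open>z * w\<close>, so the prefactor can be moved under the integral,
  where it completes the kernel at the rotated point. The exponent is a natural number, which turns
  \<open>powr\<close> into an ordinary power.\<close>

lemma poisson_mode_eq_mode_part:
  "poisson_mode (of_nat (m + 1)) n = mode_part n (restrict_bidisk (poisson_kernel m))"
proof
  fix p :: "complex \<times> complex"
  show "poisson_mode (of_nat (m + 1)) n p = mode_part n (restrict_bidisk (poisson_kernel m)) p"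
  proof (cases "p \<in> bidisk")
    case True
    obtain z w where p: "p = (z, w)" "z \<in> disc" "w \<in> disc" using True by (auto simp: bidisk_def)
    have integrand: "(1 - z * w) ^ Suc m * (exp (- \<i> * of_int n * of_real t) /
       ((1 - z * exp (- \<i> * of_real t)) powr of_nat (m + 1) * (1 - w * exp (\<i> * of_real t)) powr of_nat (m + 1)))
      = cis (- of_int n * t) * restrict_bidisk (poisson_kernel m) (rot t p)" for t
    proof -
      define a where "a = 1 - z * cis (- t)"
      define b where "b = 1 - w * cis t"
      have zw: "z * cis (- t) \<in> disc" "w * cis t \<in> disc" using p by (auto simp: norm_mult)
      have ab: "a \<noteq> 0" "b \<noteq> 0" using zw[THEN disc_neq_1] by (auto simp: a_def b_def)
      have e: "exp (- \<i> * of_real t) = cis (- t)" "exp (\<i> * of_real t) = cis t"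
        "exp (- \<i> * of_int n * of_real t) = cis (- of_int n * t)"
        by (simp_all add: cis_conv_exp mult.assoc)
      have "(1 - a) * (1 - b) = z * w * (cis (- t) * cis t)" by (simp add: a_def b_def mult_ac)
      then have "(1 - a) * (1 - b) = z * w" by (simp add: cis_mult)
      then have "1 / a + 1 / b - 1 = (1 - z * w) / (a * b)"
        using ab by (simp add: divide_simps) (simp add: algebra_simps)
      moreover have "restrict_bidisk (poisson_kernel m) (rot t p) = (1 / a + 1 / b - 1) ^ Suc m"
        using zw p by (simp add: restrict_bidisk_def bidisk_def rot_apply poisson_kernel_def a_def b_def)
      ultimately have "restrict_bidisk (poisson_kernel m) (rot t p) = (1 - z * w) ^ Suc m / (a ^ Suc m * b ^ Suc m)"
        by (simp only: power_divide power_mult_distrib)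
      moreover have "x powr of_nat (m + 1) = x ^ Suc m" if "x \<noteq> 0" for x :: complex
        using powr_nat[of x "Suc m"] that by simp
      ultimately show ?thesis
        unfolding e a_def[symmetric] b_def[symmetric] using ab by simp
    qed
    have nz: "1 - z * w \<noteq> 0" using disc_mult[OF p(2,3)] by (rule disc_neq_1)
    have "poisson_mode (of_nat (m + 1)) n p = (1 - z * w) ^ Suc m / (2 * of_real pi) *
     integral {0..2 * pi} (\<lambda>t. exp (- \<i> * of_int n * of_real t) /
       ((1 - z * exp (- \<i> * of_real t)) powr of_nat (m + 1) * (1 - w * exp (\<i> * of_real t)) powr of_nat (m + 1)))"
      using True powr_nat[of "1 - z * w" "Suc m"] nz unfolding poisson_mode_def restrict_bidisk_def p(1) by simp
    also have "\<dots> = integral {0..2 * pi} (\<lambda>t. (1 - z * w) ^ Suc m * (exp (- \<i> * of_int n * of_real t) /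
       ((1 - z * exp (- \<i> * of_real t)) powr of_nat (m + 1) * (1 - w * exp (\<i> * of_real t)) powr of_nat (m + 1)))) / (2 * of_real pi)"
      by (subst integral_mult_right) simp
    also have "\<dots> = mode_part n (restrict_bidisk (poisson_kernel m)) p"
      unfolding integrand using True by (simp add: mode_part_def restrict_bidisk_def)
    finally show ?thesis .
  qed (simp add: poisson_mode_def mode_part_def restrict_bidisk_def)
qed

text \<open>The coefficients of (1 - X)^(-m-1) are positive integers, as iterated convolutions of
  positive integers.\<close>

lemma fps_geometric_power_nth_nonzero:
  "fps_nth (Abs_fps (\<lambda>_. 1 :: complex) ^ Suc m) n \<noteq> 0"
proof -
  have "\<exists>c > 0. fps_nth (Abs_fps (\<lambda>_. 1 :: complex) ^ Suc m) n = of_nat c" for n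
  proof (induction m arbitrary: n)
    case (Suc m)
    obtain c where c: "\<And>n. c n > 0" "\<And>n. fps_nth (Abs_fps (\<lambda>_. 1 :: complex) ^ Suc m) n = of_nat (c n)"
      using Suc.IH by metis
    have "fps_nth (Abs_fps (\<lambda>_. 1 :: complex) ^ Suc (Suc m)) n = of_nat (\<Sum>i=0..n. c (n - i))"
      by (subst power_Suc, subst fps_mult_nth) (simp add: c(2) del: power_Suc)
    moreover have "(\<Sum>i=0..n. c (n - i)) > 0" by (rule sum_pos) (use c in auto)
    ultimately show ?case by blast
  qed (auto intro: exI[of _ 1])
  then show ?thesis by (metis of_nat_eq_0_iff less_irrefl)
qed

lemma taylor_coeff_cong:
  assumes "\<And>z. z \<in> disc \<Longrightarrow> f z = g z" shows "taylor_coeff f n = taylor_coeff g n"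
  unfolding taylor_coeff_def using assms
  by (intro arg_cong2[of _ _ _ _ "(/)"] higher_deriv_cong_ev eventually_mono[OF eventually_nhds_in_open[of disc]]) auto

text \<open>On either axis the kernel reduces to (1 / (1 - z))^(m+1). Thus one function has a
  nonzero mode of every index.\<close>

lemma lead_poisson_kernel: "lead k (restrict_bidisk (poisson_kernel m)) \<noteq> 0"
proof -
  have "(\<lambda>z :: complex. (1 / (1 - z)) ^ Suc m) has_fps_expansion (inverse (1 - fps_X) ^ Suc m)"
    unfolding divide_inverse mult_1_left by (intro fps_expansion_intros) simp
  moreover have "inverse (1 - fps_X) = Abs_fps (\<lambda>_. 1 :: complex)"
    using fps_inverse_gp'[where 'a = complex] by (metis fps_inverse_idempotent fps_nth_Abs_fps zero_neq_one)
  ultimately have "taylor_coeff (\<lambda>z. (1 / (1 - z)) ^ Suc m) n \<noteq> 0" for n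
    using fps_geometric_power_nth_nonzero[of m n] by (simp add: taylor_coeff_fps)
  moreover have "taylor_coeff (\<lambda>w. restrict_bidisk (poisson_kernel m) (0, w)) n = taylor_coeff (\<lambda>z. (1 / (1 - z)) ^ Suc m) n"
    "taylor_coeff (\<lambda>z. restrict_bidisk (poisson_kernel m) (z, 0)) n = taylor_coeff (\<lambda>z. (1 / (1 - z)) ^ Suc m) n" for n
    by (auto intro!: taylor_coeff_cong simp: restrict_bidisk_def bidisk_def poisson_kernel_def)
  ultimately show ?thesis by (simp add: lead_def)
qed

lemma poisson_mode_eigenspace:
  "poisson_mode (of_nat (m + 1)) n \<in> eigenspace (4 * of_nat m * (of_nat m + 1))"
  unfolding poisson_mode_eq_mode_part by (rule mode_part_eigenspace[OF poisson_kernel_eigenspace])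

lemma lead_poisson_mode: "lead k (poisson_mode (of_nat (m + 1)) n) = 0 \<longleftrightarrow> k \<noteq> n"
  unfolding poisson_mode_eq_mode_part lead_mode_part[OF poisson_kernel_eigenspace] using lead_poisson_kernel by auto

section \<open>Shifting the index by an infinitesimal hyperbolic translation\<close>

lemma deriv_zero_on_reals:
  assumes h: "(h has_field_derivative d) (at (0 :: complex))" and r: "r > 0"
    and z: "\<And>s. \<bar>s\<bar> < r \<Longrightarrow> h (complex_of_real s) = 0"
  shows "d = 0"
proof -
  \<comment> \<open>Only real parameters are available in \<open>tau\<close>, so the complex
    derivative is computed along the real null sequence 1 / (n + 1).\<close>
  have "(\<lambda>n. inverse (complex_of_real (of_nat (Suc n)))) \<longlonglongrightarrow> 0"
    using tendsto_of_real[OF LIMSEQ_inverse_real_of_nat, where 'a = complex] by simp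
  then have fl: "filterlim (\<lambda>n. inverse (complex_of_real (of_nat (Suc n)))) (at 0) sequentially"
    unfolding filterlim_at by (auto simp del: of_nat_Suc)
  have "((\<lambda>k. (h (0 + k) - h 0) / k) \<longlongrightarrow> d) (at 0)" using h by (simp add: DERIV_def)
  from filterlim_compose[OF this fl]
  have 1: "(\<lambda>n. (h (0 + inverse (complex_of_real (of_nat (Suc n)))) - h 0) / inverse (complex_of_real (of_nat (Suc n)))) \<longlonglongrightarrow> d" .
  have "\<forall>\<^sub>F n in sequentially. inverse (real (Suc n)) < r"
    using LIMSEQ_inverse_real_of_nat r by (rule order_tendstoD)
  then have "\<forall>\<^sub>F n in sequentially. (h (0 + inverse (complex_of_real (of_nat (Suc n)))) - h 0) / inverse (complex_of_real (of_nat (Suc n))) = 0"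
  proof eventually_elim
    case (elim n)
    have "h (complex_of_real (inverse (real (Suc n)))) = 0" by (rule z) (use elim in auto)
    then show ?case using z[of 0] r by simp
  qed
  then have "(\<lambda>n. (h (0 + inverse (complex_of_real (of_nat (Suc n)))) - h 0) / inverse (complex_of_real (of_nat (Suc n)))) \<longlonglongrightarrow> 0"
    by (rule tendsto_eventually)
  then show "d = 0" using 1 LIMSEQ_unique by blast
qed

text \<open>For real \<open>s\<close> this map is its own partner under conjugation with inversion,
  1 / tau(1 / w) = tau(w), so it acts on both variables by the same formula.\<close>

definition tau :: "real \<Rightarrow> complex \<Rightarrow> complex" where
  "tau s z = (z + of_real s) / (of_real s * z + 1)"

text \<open>The derivative at \<open>s = 0\<close> of \<open>G \<circ> tau s\<close> is \<open>(1 - z\<^sup>2) \<partial>\<^sub>z G + (1 - w\<^sup>2) \<partial>\<^sub>w G\<close>, the sum of a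
  raising and a lowering operator for the index of \<^const>\<open>lead\<close>; it is only needed at \<open>z = 0\<close>.\<close>

lemma lead_tau_derivative:
  assumes G: "jointly_holomorphic G disc disc"
    and z: "\<And>s. \<bar>s\<bar> < 1 \<Longrightarrow> lead (int j) (restrict_bidisk (G \<circ> map_prod (tau s) (tau s))) = 0"
  shows "taylor_coeff (\<lambda>w. dz G (0, w) + (1 - w ^ 2) * dw G (0, w)) j = 0"
proof -
  \<comment> \<open>Radius 1/3 works because then |w + s| < 2/3 < 8/9 \<le> |s w + 1|, which keeps
    \<open>(w + s) / (s * w + 1)\<close> in the disc.\<close>
  define B where "B = ball (0 :: complex) (1/3)"
  \<comment> \<open>The transformed function on the axis \<open>z = 0\<close>, where
    \<open>tau s 0 = s\<close>. The Taylor variable \<open>w\<close> comes first and the parameter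
    \<open>s\<close> second, so that \<open>taylor_coeff_slice_has_derivative\<close> differentiates
    in \<open>s\<close>.\<close>
  define F where "F = (\<lambda>p. G (snd p, (fst p + snd p) / (snd p * fst p + 1)))"
  have small: "norm (w + s) < norm (s * w + 1)" "s * w + 1 \<noteq> 0" if "s \<in> B" "w \<in> B" for s w
  proof -
    have "norm s * norm w \<le> (1/3) * (1/3)" using that by (intro mult_mono) (auto simp: B_def)
    moreover have "norm (w + s) \<le> norm w + norm s" by (rule norm_triangle_ineq)
    moreover have "norm (1 :: complex) \<le> norm (s * w + 1) + norm (s * w)"
      using norm_triangle_ineq4[of "s * w + 1" "s * w"] by simp
    moreover have "norm w < 1/3" "norm s < 1/3" using that by (auto simp: B_def)
    ultimately show "norm (w + s) < norm (s * w + 1)" unfolding norm_mult norm_one by linarith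
    then show "s * w + 1 \<noteq> 0" using norm_ge_zero[of "w + s"] by auto
  qed
  have ind: "(w + s) / (s * w + 1) \<in> disc" if "s \<in> B" "w \<in> B" for s w
    using small[OF that] by (simp add: norm_divide)
  have opB: "open B" "0 \<in> B" by (auto simp: B_def)
  have F: "jointly_holomorphic F B B"
    unfolding jointly_holomorphic_def
  proof (intro conjI ballI)
    show "continuous_on (B \<times> B) F"
      unfolding F_def
      by (rule continuous_on_compose2[OF jointly_holomorphicD(1)[OF G]])
        (use ind small in \<open>auto intro!: continuous_intros simp: B_def\<close>)
    show "(\<lambda>z. F (z, w)) holomorphic_on B" if "w \<in> B" for w
      unfolding F_def fst_conv snd_conv
      by (rule holomorphic_curve[OF G opB(1)])
        (use that ind small(2) in \<open>auto intro!: holomorphic_intros simp: B_def\<close>)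
    show "(\<lambda>w. F (z, w)) holomorphic_on B" if "z \<in> B" for z
      unfolding F_def fst_conv snd_conv
      by (rule holomorphic_curve[OF G opB(1)])
        (use that ind small(2) in \<open>auto intro!: holomorphic_intros simp: B_def\<close>)
  qed
  have dF: "dw F (w, 0) = dz G (0, w) + (1 - w ^ 2) * dw G (0, w)" if "w \<in> B" for w
  proof -
    have "((\<lambda>s. (w + s) / (s * w + 1)) has_field_derivative (1 - w ^ 2)) (at 0)"
      by (auto intro!: derivative_eq_intros simp: power2_eq_square)
    from curve_has_derivative[OF G _ _ DERIV_ident this]
    have "((\<lambda>s. G (s, (w + s) / (s * w + 1))) has_field_derivative dz G (0, w) + dw G (0, w) * (1 - w ^ 2)) (at 0)"
      using that by (auto simp: B_def)
    then show ?thesis by (simp add: dw_def F_def DERIV_imp_deriv mult.commute)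
  qed
  have "((\<lambda>s. taylor_coeff (\<lambda>w. F (w, s)) j) has_field_derivative taylor_coeff (\<lambda>w. dw F (w, 0)) j) (at 0)"
    by (rule taylor_coeff_slice_has_derivative[OF F opB(1,1,2,2)])
  then have "taylor_coeff (\<lambda>w. dw F (w, 0)) j = 0"
  proof (rule deriv_zero_on_reals)
    fix s :: real assume s: "\<bar>s\<bar> < 1/3"
    have "taylor_coeff (\<lambda>w. F (w, of_real s)) j = taylor_coeff (\<lambda>w. restrict_bidisk (G \<circ> map_prod (tau s) (tau s)) (0, w)) j"
      by (rule taylor_coeff_cong) (simp add: F_def restrict_bidisk_def bidisk_def tau_def)
    then show "taylor_coeff (\<lambda>w. F (w, of_real s)) j = 0"
      using z[of s] s by (simp add: lead_nonneg)
  qed simp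
  moreover have "taylor_coeff (\<lambda>w. dw F (w, 0)) j = taylor_coeff (\<lambda>w. dz G (0, w) + (1 - w ^ 2) * dw G (0, w)) j"
    unfolding taylor_coeff_def
    by (intro arg_cong2[of _ _ _ _ "(/)"] higher_deriv_cong_ev eventually_mono[OF eventually_nhds_in_open[of B]])
      (use opB dF in auto)
  ultimately show ?thesis by simp
qed

text \<open>Here G(0, w) = c w^n, and the equation at z = 0 integrates to dz G(0, w) = lam c w^(n+1)
  / (4 (n + 1)). The derivative at \<open>s = 0\<close> therefore has coefficient c (lam / (4 (n +
  1)) - n) at w^(n+1), which vanishes only for the excluded \<open>lam\<close>, and c n at w^(n-1).
  If the shifted lead vanished for all small \<open>s\<close>, so would this derivative.\<close>

lemma lead_shift:
  assumes G: "G \<in> eigenspace lam" and n: "lead (int n) G \<noteq> 0" and o: "\<And>k. k \<noteq> int n \<Longrightarrow> lead k G = 0"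
  shows "lam \<noteq> 4 * of_nat n * (of_nat n + 1) \<Longrightarrow>
      \<exists>s. \<bar>s\<bar> < 1 \<and> lead (int n + 1) (restrict_bidisk (G \<circ> map_prod (tau s) (tau s))) \<noteq> 0"
    and "n > 0 \<Longrightarrow> \<exists>s. \<bar>s\<bar> < 1 \<and> lead (int n - 1) (restrict_bidisk (G \<circ> map_prod (tau s) (tau s))) \<noteq> 0"
proof -
  note h = eigenspaceD(2)[OF G]
  define c where "c = lead (int n) G"
  define A where "A = Abs_fps (taylor_coeff (\<lambda>w. dz G (0, w)))"
  have tcG: "taylor_coeff (\<lambda>w. G (0, w)) j = (if j = n then c else 0)" for j
    using o[of "int j"] by (auto simp: c_def lead_nonneg)
  have "Abs_fps (taylor_coeff (\<lambda>w. G (0, w))) = fps_const c * fps_X ^ n"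
    by (rule fps_ext) (simp add: tcG)
  then have g0: "(\<lambda>w. G (0, w)) has_fps_expansion fps_const c * fps_X ^ n"
    using has_fps_expansion_taylor_coeff[OF jointly_holomorphicD(3)[OF h, of 0]] by simp
  then have g2: "(\<lambda>w. dw G (0, w)) has_fps_expansion fps_deriv (fps_const c * fps_X ^ n)"
    unfolding dw_def prod.case by (rule has_fps_expansion_deriv)
  have g1: "(\<lambda>w. dz G (0, w)) has_fps_expansion A"
    unfolding A_def by (rule has_fps_expansion_taylor_coeff[of _ disc]) (use jointly_holomorphicD(3)[OF jointly_holomorphic_dz[OF h]] in auto)
  have d4: "(\<lambda>w. 4 * deriv (\<lambda>w. dz G (0, w)) w) has_fps_expansion fps_const 4 * fps_deriv A"
    by (intro fps_expansion_intros g1)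
  have ev: "\<forall>\<^sub>F w in nhds 0. 4 * deriv (\<lambda>w. dz G (0, w)) w = lam * G (0, w)"
    unfolding eventually_nhds
  proof (intro exI[of _ disc] conjI ballI)
    fix w :: complex assume w: "w \<in> disc"
    have "deriv (\<lambda>w. dz G (0, w)) w = dz (dw G) (0, w)"
      using dz_dw_commute[OF h open_ball open_ball _ w, of 0] by (simp add: dw_def)
    then show "4 * deriv (\<lambda>w. dz G (0, w)) w = lam * G (0, w)"
      using eigenspaceD(4)[OF G _ w, of 0] by simp
  qed auto
  from d4 have "(\<lambda>w. lam * G (0, w)) has_fps_expansion fps_const 4 * fps_deriv A"
    unfolding has_fps_expansion_cong[OF ev refl] .
  moreover have "(\<lambda>w. lam * G (0, w)) has_fps_expansion fps_const lam * (fps_const c * fps_X ^ n)"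
    by (intro fps_expansion_intros g0)
  ultimately have "fps_const 4 * fps_deriv A = fps_const lam * (fps_const c * fps_X ^ n)"
    by (rule fps_expansion_unique_complex)
  then have "fps_nth (fps_const 4 * fps_deriv A) j = fps_nth (fps_const lam * (fps_const c * fps_X ^ n)) j" for j
    by simp
  then have A: "4 * (of_nat (Suc j) * fps_nth A (Suc j)) = (if j = n then lam * c else 0)" for j
    by (simp add: algebra_simps split: if_splits)
  \<comment> \<open>The constant of integration in \<open>w\<close> is the lead of index -1, which
    is not \<open>int n\<close>.\<close>
  have A0: "fps_nth A 0 = 0"
  proof -
    have "fps_nth A 0 = taylor_coeff (\<lambda>z. G (z, 0)) 1" by (simp add: A_def taylor_coeff_def dz_def)
    also have "\<dots> = lead (- 1) G" using lead_nonpos[of 1 G] by simp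
    also have "\<dots> = 0" by (rule o) simp
    finally show ?thesis .
  qed
  have exp: "(\<lambda>w. dz G (0, w) + (1 - w ^ 2) * dw G (0, w)) has_fps_expansion
      A + (1 - fps_X ^ 2) * fps_deriv (fps_const c * fps_X ^ n)"
    by (intro fps_expansion_intros g1 g2)
  have coeff: "taylor_coeff (\<lambda>w. dz G (0, w) + (1 - w ^ 2) * dw G (0, w)) j =
      fps_nth A j + (if Suc j = n then c * of_nat n else 0) - (if j = Suc n then c * of_nat n else 0)" for j
  proof -
    have "(1 - fps_X ^ 2) * fps_deriv (fps_const c * fps_X ^ n) =
        fps_const (c * of_nat n) * (fps_X ^ (n - 1) - fps_X ^ 2 * fps_X ^ (n - 1))"
      by (simp add: fps_deriv_power fps_of_nat[symmetric] algebra_simps del: fps_const_mult) 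
    also have "\<dots> = fps_const (c * of_nat n) * (fps_X ^ (n - 1) - fps_X ^ (n + 1))"
      by (cases n) (auto simp: power_add[symmetric])
    finally show ?thesis unfolding taylor_coeff_fps[OF exp] by (cases n) auto
  qed
  show "\<exists>s. \<bar>s\<bar> < 1 \<and> lead (int n + 1) (restrict_bidisk (G \<circ> map_prod (tau s) (tau s))) \<noteq> 0"
    if l: "lam \<noteq> 4 * of_nat n * (of_nat n + 1)"
  proof (rule ccontr)
    assume "\<not> ?thesis"
    then have "taylor_coeff (\<lambda>w. dz G (0, w) + (1 - w ^ 2) * dw G (0, w)) (Suc n) = 0"
      by (intro lead_tau_derivative[OF h]) (auto simp: add.commute)
    then have "fps_nth A (Suc n) = c * of_nat n" unfolding coeff by simp
    then have "4 * (of_nat (Suc n) * (c * of_nat n)) = lam * c" using A[of n] by simp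
    then have "c * (lam - 4 * of_nat n * (of_nat n + 1)) = 0" by (simp add: algebra_simps)
    then show False using l n by (simp add: c_def)
  qed
  show "\<exists>s. \<bar>s\<bar> < 1 \<and> lead (int n - 1) (restrict_bidisk (G \<circ> map_prod (tau s) (tau s))) \<noteq> 0"
    if n0: "n > 0"
  proof (rule ccontr)
    assume "\<not> ?thesis"
    then have "taylor_coeff (\<lambda>w. dz G (0, w) + (1 - w ^ 2) * dw G (0, w)) (n - 1) = 0"
      using n0 by (intro lead_tau_derivative[OF h]) (auto simp: of_nat_diff)
    moreover have "fps_nth A (n - 1) = 0"
    proof (cases "n - 1")
      case (Suc j)
      then have "4 * (of_nat (Suc j) * fps_nth A (Suc j)) = 0" using A[of j] by simp
      then show ?thesis using Suc by (simp del: of_nat_Suc)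
    qed (simp add: A0)
    moreover have "n - 1 \<noteq> Suc n" "Suc (n - 1) = n" using n0 by auto
    ultimately have "c * of_nat n = 0" unfolding coeff by simp
    then show False using n n0 by (simp add: c_def)
  qed
qed

section \<open>Moebius transformations of the bidisk\<close>

definition mob :: "complex \<Rightarrow> complex \<Rightarrow> complex \<Rightarrow> complex \<Rightarrow> complex \<Rightarrow> complex" where
  "mob a b c d z = (a * z + b) / (c * z + d)"

text \<open>If psi is \<open>mob a b c d\<close>, then 1 / psi(1 / w) is \<open>mob d c b a\<close>.
  The definition records that both coordinate maps send the disc into itself without poles;
  invertibility enters in \<open>moebius_in_direct_group\<close> through explicit inverses.\<close>

definition disc_moebius :: "complex \<Rightarrow> complex \<Rightarrow> complex \<Rightarrow> complex \<Rightarrow> bool" where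
  "disc_moebius a b c d \<longleftrightarrow> a * d - b * c \<noteq> 0 \<and>
     (\<forall>z\<in>disc. c * z + d \<noteq> 0 \<and> mob a b c d z \<in> disc) \<and>
     (\<forall>w\<in>disc. b * w + a \<noteq> 0 \<and> mob d c b a w \<in> disc)"

lemma disc_moebius_swap: "disc_moebius a b c d \<longleftrightarrow> disc_moebius d c b a"
  by (auto simp: disc_moebius_def mult.commute)

lemma sphere_inverse_moebius:
  assumes "a * d - b * c \<noteq> 0"
  shows "sphere_inverse (moebius a b c d (sphere_inverse (Some w))) =
    (if b * w + a = 0 then None else Some (mob d c b a w))"
proof (cases "w = 0")
  case True
  then show ?thesis using assms by (auto simp: sphere_inverse_def mob_def)
next
  case False
  have n: "c / w + d = (d * w + c) / w" "a / w + b = (b * w + a) / w"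
    using False by (simp_all add: field_simps)
  \<comment> \<open>The nonzero determinant excludes 0/0, so a zero of \<open>d * w + c\<close> is
    sent to infinity by the inner quotient and back to 0 by the inversion.\<close>
  have "b * w + a \<noteq> 0 \<or> d * w + c \<noteq> 0"
  proof (rule ccontr)
    assume "\<not> ?thesis"
    then have "a = - (b * w)" "c = - (d * w)" by (simp_all add: eq_neg_iff_add_eq_0 add.commute)
    then show False using assms by simp
  qed
  then show ?thesis using False by (auto simp: sphere_inverse_def n mob_def)
qed

lemma direct_automorphism_form:
  assumes "T \<in> moebius_group_bidisk_direct"
  obtains a b c d where "disc_moebius a b c d"
    "\<And>p. p \<in> bidisk \<Longrightarrow> T p = map_prod (mob a b c d) (mob d c b a) p"
proof -
  from assms obtain \<psi> where psi: "\<psi> \<in> moebius_transformations" and Aut: "T \<in> Aut_bidisk"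
    and eq: "\<And>z w. (z, w) \<in> bidisk \<Longrightarrow>
      (\<psi> (Some z), sphere_inverse (\<psi> (sphere_inverse (Some w)))) = (Some (fst (T (z, w))), Some (snd (T (z, w))))"
    by (auto simp: moebius_group_bidisk_direct_def bidisk_automorphisms_from_def moebius_group_direct_def)
  obtain a b c d where abcd: "\<psi> = moebius a b c d" "a * d - b * c \<noteq> 0"
    using psi by (auto simp: moebius_transformations_def)
  have T: "T p \<in> bidisk" if "p \<in> bidisk" for p
    using Aut that by (auto simp: Aut_bidisk_def holomorphic_map_bidisk_def)
  have *: "c * z + d \<noteq> 0 \<and> b * w + a \<noteq> 0 \<and> T (z, w) = (mob a b c d z, mob d c b a w)"
    if zw: "z \<in> disc" "w \<in> disc" for z w
    using eq[of z w] zw unfolding abcd(1) sphere_inverse_moebius[OF abcd(2)]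
    by (auto simp: bidisk_def mob_def prod_eq_iff split: if_splits)
  have "disc_moebius a b c d"
    unfolding disc_moebius_def
  proof (intro conjI ballI abcd(2))
    fix z :: complex assume z: "z \<in> disc"
    show "c * z + d \<noteq> 0" "b * z + a \<noteq> 0" using *[of z z] z by auto
    \<comment> \<open>A point on the diagonal gives the conditions on both coordinate maps at
      once.\<close>
    have "T (z, z) \<in> bidisk" using z by (intro T) (auto simp: bidisk_def)
    then show "mob a b c d z \<in> disc" "mob d c b a z \<in> disc" using *[of z z] z by (auto simp: bidisk_def)
  qed
  moreover have "T p = map_prod (mob a b c d) (mob d c b a) p" if "p \<in> bidisk" for p
    using that * by (cases p) (auto simp: bidisk_def)
  ultimately show ?thesis by (rule that)
qed

lemma mob_holomorphic: "disc_moebius a b c d \<Longrightarrow> mob a b c d holomorphic_on disc"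
  unfolding mob_def disc_moebius_def by (auto intro!: holomorphic_intros)

lemma mob_image: "disc_moebius a b c d \<Longrightarrow> mob a b c d ` disc \<subseteq> disc"
  by (auto simp: disc_moebius_def)

lemma deriv_mob:
  assumes "c * z + d \<noteq> 0"
  shows "deriv (mob a b c d) z = (a * d - b * c) / (c * z + d)\<^sup>2"
proof (rule DERIV_imp_deriv)
  show "(mob a b c d has_field_derivative (a * d - b * c) / (c * z + d)\<^sup>2) (at z)"
    unfolding mob_def[abs_def] using assms
    by (auto intro!: derivative_eq_intros simp: power2_eq_square algebra_simps)
qed

lemma one_minus_mob:
  assumes "c * z + d \<noteq> 0" "b * w + a \<noteq> 0"
  shows "1 - mob a b c d z * mob d c b a w = (a * d - b * c) * (1 - z * w) / ((c * z + d) * (b * w + a))"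
  using assms unfolding mob_def by (simp add: divide_simps) (simp add: algebra_simps)

text \<open>The square of the identity \<open>one_minus_mob\<close> matches the product of the
  derivatives, because both coordinate maps have the same determinant \<open>a * d - b * c\<close>.
  This is the condition in \<open>eigenspace_compose\<close>.\<close>

lemma eigenspace_moebius:
  assumes F: "F \<in> eigenspace lam" and m: "disc_moebius a b c d"
  shows "restrict_bidisk (F \<circ> map_prod (mob a b c d) (mob d c b a)) \<in> eigenspace lam"
proof -
  have m': "disc_moebius d c b a" using m disc_moebius_swap by blast
  show ?thesis
  proof (rule eigenspace_compose[OF F mob_holomorphic[OF m] mob_image[OF m] mob_holomorphic[OF m'] mob_image[OF m']])
    fix z w :: complex assume "z \<in> disc" "w \<in> disc"
    then have nz: "c * z + d \<noteq> 0" "b * w + a \<noteq> 0" using m by (auto simp: disc_moebius_def)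
    show "(1 - z * w)\<^sup>2 * deriv (mob a b c d) z * deriv (mob d c b a) w = (1 - mob a b c d z * mob d c b a w)\<^sup>2"
      unfolding one_minus_mob[OF nz] deriv_mob[OF nz(1)] deriv_mob[OF nz(2)]
        mult.commute[of d a] mult.commute[of c b]
      by (simp only: power_mult_distrib power_divide times_divide_eq_left times_divide_eq_right
          divide_divide_eq_left power2_eq_square[of "a * d - b * c"] mult_ac)
  qed
qed

lemma holomorphic_map_bidisk_moebius:
  assumes m: "disc_moebius a b c d"
  shows "holomorphic_map_bidisk (map_prod (mob a b c d) (mob d c b a))"
proof -
  have m': "disc_moebius d c b a" using m disc_moebius_swap by blast
  have hf: "jointly_holomorphic fst disc disc" "jointly_holomorphic snd disc disc"
    by (auto simp: jointly_holomorphic_def intro!: continuous_intros holomorphic_intros)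
  note c = jointly_holomorphic_compose[OF _ mob_holomorphic[OF m] mob_image[OF m] mob_holomorphic[OF m'] mob_image[OF m']]
  have "map_prod (mob a b c d) (mob d c b a) ` bidisk \<subseteq> bidisk"
    using mob_image[OF m] mob_image[OF m'] by (auto simp: bidisk_def)
  then show ?thesis
    unfolding holomorphic_map_bidisk_def holomorphic2_on_iff_jointly_holomorphic using c[OF hf(1)] c[OF hf(2)] by blast
qed

text \<open>It is applied to the rotations and to \<open>tau\<close> only: these maps already
  produce all restrictions on the index set.\<close>

lemma moebius_in_direct_group:
  assumes m: "disc_moebius a b c d" and m': "disc_moebius a' b' c' d'"
    and inv: "\<And>z. z \<in> disc \<Longrightarrow> mob a' b' c' d' (mob a b c d z) = z" "\<And>z. z \<in> disc \<Longrightarrow> mob a b c d (mob a' b' c' d' z) = z"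
      "\<And>z. z \<in> disc \<Longrightarrow> mob d' c' b' a' (mob d c b a z) = z" "\<And>z. z \<in> disc \<Longrightarrow> mob d c b a (mob d' c' b' a' z) = z"
  shows "map_prod (mob a b c d) (mob d c b a) \<in> moebius_group_bidisk_direct"
  unfolding moebius_group_bidisk_direct_def bidisk_automorphisms_from_def
proof (intro CollectI conjI)
  show "map_prod (mob a b c d) (mob d c b a) \<in> Aut_bidisk"
    unfolding Aut_bidisk_def
    using holomorphic_map_bidisk_moebius[OF m] holomorphic_map_bidisk_moebius[OF m'] inv
    by (auto intro!: exI[of _ "map_prod (mob a' b' c' d') (mob d' c' b' a')"] simp: bidisk_def)
  have d: "a * d - b * c \<noteq> 0" using m by (simp add: disc_moebius_def)
  show "\<exists>\<Phi>\<in>moebius_group_direct. \<forall>(z, w)\<in>bidisk. \<Phi> (Some z, Some w) =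
      (Some (fst (map_prod (mob a b c d) (mob d c b a) (z, w))), Some (snd (map_prod (mob a b c d) (mob d c b a) (z, w))))"
  proof
    show "(\<lambda>(z, w). (moebius a b c d z, sphere_inverse (moebius a b c d (sphere_inverse w)))) \<in> moebius_group_direct"
      using d unfolding moebius_group_direct_def moebius_transformations_def by blast
    show "\<forall>(z, w)\<in>bidisk. (\<lambda>(z, w). (moebius a b c d z, sphere_inverse (moebius a b c d (sphere_inverse w)))) (Some z, Some w) =
      (Some (fst (map_prod (mob a b c d) (mob d c b a) (z, w))), Some (snd (map_prod (mob a b c d) (mob d c b a) (z, w))))"
      using m d by (auto simp: bidisk_def disc_moebius_def sphere_inverse_moebius) (simp_all add: mob_def)
  qed
qed

lemma rot_in_direct_group: "rot t \<in> moebius_group_bidisk_direct"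
proof -
  have e: "mob (cis t) 0 0 1 = (\<lambda>z. z * cis t)" "mob 1 0 0 (cis t) = (\<lambda>z. z * cis (- t))" for t
    by (auto simp: mob_def fun_eq_iff divide_inverse)
  have m: "disc_moebius (cis t) 0 0 1" for t
    by (auto simp: disc_moebius_def e norm_mult)
  have "map_prod (mob (cis (- t)) 0 0 1) (mob 1 0 0 (cis (- t))) \<in> moebius_group_bidisk_direct"
    by (rule moebius_in_direct_group[OF m[of "- t"] m[of t]]) (auto simp: e mult.assoc cis_mult)
  then show ?thesis by (simp add: e rot_def)
qed

lemma tau_eq_mob: "tau s = mob 1 (of_real s) (of_real s) 1"
  by (auto simp: tau_def mob_def fun_eq_iff)

lemma disc_moebius_tau:
  assumes "\<bar>s\<bar> < 1" shows "disc_moebius 1 (of_real s) (of_real s) 1"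
proof -
  have "1 * 1 - complex_of_real s * of_real s \<noteq> 0"
  proof
    assume "1 * 1 - complex_of_real s * of_real s = 0"
    then have "of_real (s * s) = (1 :: complex)" by simp
    then have "s * s = 1" by (simp only: of_real_eq_1_iff)
    moreover have "\<bar>s\<bar> * \<bar>s\<bar> < 1" using assms by (metis abs_ge_zero mult_strict_mono' mult_1_left)
    ultimately show False by (simp add: abs_mult[symmetric])
  qed
  moreover have "of_real s * z + 1 \<noteq> 0 \<and> mob 1 (of_real s) (of_real s) 1 z \<in> disc" if z: "z \<in> disc" for z
  proof
    have "of_real (- s) * z \<in> disc" using z assms by (intro disc_mult) auto
    then show "of_real s * z + 1 \<noteq> 0" using disc_neq_1[of "of_real (- s) * z"] by (simp add: add.commute)
    \<comment> \<open>With centre \<open>- s\<close> real, this Blaschke factor is z to (z + s) / (1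
      + s z), the map \<open>tau s\<close>.\<close>
    have "norm (Moebius_function 0 (of_real (- s)) z) < 1"
      using assms z by (intro Moebius_function_norm_lt_1) auto
    then show "mob 1 (of_real s) (of_real s) 1 z \<in> disc"
      by (simp add: Moebius_function_simple mob_def add.commute)
  qed
  ultimately show ?thesis by (simp add: disc_moebius_def)
qed

lemma tau_inverse:
  assumes "\<bar>s\<bar> < 1" "z \<in> disc" shows "tau (- s) (tau s z) = z"
proof -
  have nz: "of_real s * z + 1 \<noteq> 0" and ns: "1 - complex_of_real s * of_real s \<noteq> 0"
    using disc_moebius_tau[OF assms(1)] assms(2) by (auto simp: disc_moebius_def)
  have 1: "tau s z + of_real (- s) = (1 - of_real s * of_real s) * z / (of_real s * z + 1)"
    using nz by (simp add: tau_def divide_simps) (simp add: algebra_simps)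
  have 2: "of_real (- s) * tau s z + 1 = (1 - of_real s * of_real s) / (of_real s * z + 1)"
    using nz by (simp add: tau_def divide_simps) (simp add: algebra_simps)
  show ?thesis unfolding tau_def[of "- s"] 1 2 using nz ns by simp
qed

lemma tau_in_direct_group:
  assumes "\<bar>s\<bar> < 1" shows "map_prod (tau s) (tau s) \<in> moebius_group_bidisk_direct"
proof -
  have s: "\<bar>- s\<bar> < 1" using assms by simp
  show ?thesis
    unfolding tau_eq_mob
    by (rule moebius_in_direct_group[OF disc_moebius_tau[OF assms] disc_moebius_tau[OF s]];
      unfold tau_eq_mob[symmetric]) (use tau_inverse[OF assms] tau_inverse[OF s] in auto)
qed

text \<open>The operator is symmetric because the mixed derivatives commute. The flip reduces
  statements about negative indices to positive ones.\<close>

lemma eigenspace_swap: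
  assumes F: "F \<in> eigenspace lam" shows "F \<circ> prod.swap \<in> eigenspace lam"
proof -
  note h = eigenspaceD(2)[OF F]
  have "dz (dw (F \<circ> prod.swap)) (z, w) = dz (dw F) (w, z)" if "z \<in> disc" "w \<in> disc" for z w
    unfolding dw_swap dz_swap using dz_dw_commute[OF h open_ball open_ball that(2,1)] by simp
  moreover have "p \<in> bidisk \<longleftrightarrow> prod.swap p \<in> bidisk" for p by (cases p) (auto simp: bidisk_def)
  moreover have "4 * (1 - z * w)\<^sup>2 * dz (dw F) (w, z) = lam * F (w, z)" if "z \<in> disc" "w \<in> disc" for z w
    using eigenspaceD(4)[OF F that(2,1)] by (simp only: mult.commute[of w z])
  ultimately show ?thesis
    using jointly_holomorphic_swap[OF h] eigenspaceD(3)[OF F]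
    by (simp add: eigenspace_iff holo_bidisk_iff del: split_paired_All)
qed

lemma restrict_swap: "restrict_bidisk (F \<circ> prod.swap) = restrict_bidisk F \<circ> prod.swap"
  by (auto simp: restrict_bidisk_def bidisk_def fun_eq_iff)

text \<open>Projecting a witness to its \<open>k\<close>-th mode produces a function with a single
  nonzero lead, as \<open>lead_shift\<close> requires. That lemma treats indices at least 0; the
  remaining directions follow by the flip, which negates indices and commutes with
  \<open>tau\<close> acting on both variables.\<close>

lemma spectrum_shift:
  assumes Y: "cfun.subspace Y" "closedin holo_topology Y" "Y \<subseteq> eigenspace lam"
    and rot: "\<And>t G. G \<in> Y \<Longrightarrow> G \<circ> rot t \<in> Y"
    and tau: "\<And>s G. G \<in> Y \<Longrightarrow> \<bar>s\<bar> < 1 \<Longrightarrow> restrict_bidisk (G \<circ> map_prod (tau s) (tau s)) \<in> Y"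
    and k: "\<exists>G\<in>Y. lead k G \<noteq> 0"
  shows "\<not> (k \<ge> 0 \<and> lam = 4 * of_int k * (of_int k + 1)) \<Longrightarrow> \<exists>G\<in>Y. lead (k + 1) G \<noteq> 0"
    and "\<not> (k \<le> 0 \<and> lam = 4 * of_int k * (of_int k - 1)) \<Longrightarrow> \<exists>G\<in>Y. lead (k - 1) G \<noteq> 0"
proof -
  obtain G0 where G0: "G0 \<in> Y" "lead k G0 \<noteq> 0" using k by blast
  define G where "G = mode_part k G0"
  have G: "G \<in> Y" unfolding G_def by (rule mode_part_closed_subspace[OF Y rot G0(1)])
  then have Ge: "G \<in> eigenspace lam" using Y by blast
  have G0e: "G0 \<in> eigenspace lam" using Y G0 by blast
  have lG: "lead k G \<noteq> 0" "\<And>n. n \<noteq> k \<Longrightarrow> lead n G = 0"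
    using G0(2) by (auto simp: G_def lead_mode_part[OF G0e])
  have sw: "restrict_bidisk ((G \<circ> prod.swap) \<circ> map_prod (tau s) (tau s)) =
      restrict_bidisk (G \<circ> map_prod (tau s) (tau s)) \<circ> prod.swap" for s
    unfolding restrict_swap[symmetric] by (auto simp: fun_eq_iff restrict_bidisk_def)
  have pos: "\<exists>G\<in>Y. lead n G \<noteq> 0" if "\<exists>s. \<bar>s\<bar> < 1 \<and> lead n (restrict_bidisk (G \<circ> map_prod (tau s) (tau s))) \<noteq> 0" for n
    using that tau[OF G] by blast
  have neg: "\<exists>G\<in>Y. lead n G \<noteq> 0"
    if "\<exists>s. \<bar>s\<bar> < 1 \<and> lead (- n) (restrict_bidisk ((G \<circ> prod.swap) \<circ> map_prod (tau s) (tau s))) \<noteq> 0" for n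
    using that unfolding sw lead_swap by (intro pos) simp
  have lGs: "lead (- k) (G \<circ> prod.swap) \<noteq> 0" "\<And>n. n \<noteq> - k \<Longrightarrow> lead n (G \<circ> prod.swap) = 0"
    using lG unfolding lead_swap by auto
  show "\<exists>G\<in>Y. lead (k + 1) G \<noteq> 0" if c: "\<not> (k \<ge> 0 \<and> lam = 4 * of_int k * (of_int k + 1))"
  proof (cases "k \<ge> 0")
    case True
    then obtain n where n: "k = int n" using nonneg_int_cases by blast
    show ?thesis unfolding n
      by (rule pos, rule lead_shift(1)[OF Ge]) (use lG c n in auto)
  next
    case False
    then obtain n where n: "- k = int n" "n > 0" by (metis neg_int_cases add.inverse_inverse not_le)
    have "lead (int n) (G \<circ> prod.swap) \<noteq> 0" "\<And>l. l \<noteq> int n \<Longrightarrow> lead l (G \<circ> prod.swap) = 0"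
      using lGs unfolding n by auto
    from lead_shift(2)[OF eigenspace_swap[OF Ge] this n(2)] show ?thesis
      by (intro neg) (simp add: n(1)[symmetric])
  qed
  show "\<exists>G\<in>Y. lead (k - 1) G \<noteq> 0" if c: "\<not> (k \<le> 0 \<and> lam = 4 * of_int k * (of_int k - 1))"
  proof (cases "k \<le> 0")
    case True
    then obtain n where n: "- k = int n" using nonneg_int_cases[of "- k"] by auto
    have "lead (int n) (G \<circ> prod.swap) \<noteq> 0" "\<And>l. l \<noteq> int n \<Longrightarrow> lead l (G \<circ> prod.swap) = 0"
      using lGs unfolding n by auto
    moreover have "lam \<noteq> 4 * of_nat n * (of_nat n + 1)"
    proof -
      have "complex_of_int k = - of_nat n" using n by (metis add.inverse_inverse of_int_minus of_int_of_nat_eq)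
      then show ?thesis using c True by (auto simp: algebra_simps)
    qed
    ultimately show ?thesis
      using lead_shift(1)[OF eigenspace_swap[OF Ge], of n] by (intro neg) (simp add: n(1)[symmetric])
  next
    case False
    then obtain n where n: "k = int n" "n > 0" by (metis pos_int_cases not_le)
    show ?thesis unfolding n
      by (rule pos, rule lead_shift(2)[OF Ge]) (use lG n in auto)
  qed
qed

section \<open>Invariance of the exceptional subspaces\<close>

lemma dw_weighted:
  assumes F: "jointly_holomorphic F disc disc" and zw: "z \<in> disc" "w \<in> disc"
  shows "dw (\<lambda>p. (1 - fst p * snd p) ^ m * F p) (z, w) =
    (1 - z * w) ^ m * dw F (z, w) - of_nat m * (1 - z * w) ^ (m - 1) * z * F (z, w)"
proof -
  have "((\<lambda>w. 1 - z * w) has_field_derivative - z) (at w)"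
    by (auto intro!: derivative_eq_intros)
  from DERIV_mult[OF DERIV_power[OF this, of m] dw_has_derivative[OF F open_ball zw]]
  have "((\<lambda>w. (1 - z * w) ^ m * F (z, w)) has_field_derivative
     (1 - z * w) ^ m * dw F (z, w) - of_nat m * (1 - z * w) ^ (m - 1) * z * F (z, w)) (at w)"
    by (rule DERIV_cong) (simp add: algebra_simps)
  from DERIV_imp_deriv[OF this] show ?thesis by (simp add: dw_def)
qed

lemma dz_weighted:
  assumes F: "jointly_holomorphic F disc disc" and zw: "z \<in> disc" "w \<in> disc"
  shows "dz (\<lambda>p. (1 - fst p * snd p) ^ m * F p) (z, w) =
    (1 - z * w) ^ m * dz F (z, w) - of_nat m * (1 - z * w) ^ (m - 1) * w * F (z, w)"
proof -
  have "((\<lambda>z. 1 - z * w) has_field_derivative - w) (at z)"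
    by (auto intro!: derivative_eq_intros)
  from DERIV_mult[OF DERIV_power[OF this, of m] dz_has_derivative[OF F open_ball zw]]
  have "((\<lambda>z. (1 - z * w) ^ m * F (z, w)) has_field_derivative
     (1 - z * w) ^ m * dz F (z, w) - of_nat m * (1 - z * w) ^ (m - 1) * w * F (z, w)) (at z)"
    by (rule DERIV_cong) (simp add: algebra_simps)
  from DERIV_imp_deriv[OF this] show ?thesis by (simp add: dz_def)
qed

text \<open>The exponents \<open>m - 1\<close> and \<open>m - 1 - 1\<close> are truncated; wherever
  truncation happens, a factor \<open>of_nat m\<close> or \<open>of_nat (m - 1)\<close> is
  zero.\<close>

lemma dz_dw_weighted:
  assumes F: "jointly_holomorphic F disc disc" and zw: "z \<in> disc" "w \<in> disc"
  shows "dz (dw (\<lambda>p. (1 - fst p * snd p) ^ m * F p)) (z, w) =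
    (1 - z * w) ^ m * dz (dw F) (z, w) - of_nat m * (1 - z * w) ^ (m - 1) * w * dw F (z, w)
    - of_nat m * (1 - z * w) ^ (m - 1) * z * dz F (z, w) - of_nat m * (1 - z * w) ^ (m - 1) * F (z, w)
    + of_nat m * (of_nat (m - 1) * (1 - z * w) ^ (m - 1 - 1)) * (z * w) * F (z, w)"
proof -
  have "dz (dw (\<lambda>p. (1 - fst p * snd p) ^ m * F p)) (z, w) =
     dz (\<lambda>p. (1 - fst p * w) ^ m * dw F (fst p, w) - of_nat m * (1 - fst p * w) ^ (m - 1) * fst p * F (fst p, w)) (z, w)"
    using zw dw_weighted[OF F] by (intro dz_cong[of disc]) auto
  also have "\<dots> = (1 - z * w) ^ m * dz (dw F) (z, w) - of_nat m * (1 - z * w) ^ (m - 1) * w * dw F (z, w)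
    - of_nat m * (1 - z * w) ^ (m - 1) * z * dz F (z, w) - of_nat m * (1 - z * w) ^ (m - 1) * F (z, w)
    + of_nat m * (of_nat (m - 1) * (1 - z * w) ^ (m - 1 - 1)) * (z * w) * F (z, w)"
  proof -
    have alg: "n * (- w * A1) * fw + fzw * A0 - ((n * (k * (- w * A2)) * z + 1 * (n * A1)) * f + fz * (n * A1 * z)) =
        A0 * fzw - n * A1 * w * fw - n * A1 * z * fz - n * A1 * f + n * (k * A2) * (z * w) * f"
      for n k A0 A1 A2 f fz fw fzw :: complex
      by (simp add: algebra_simps)
    have d: "((\<lambda>z. 1 - z * w) has_field_derivative - w) (at z)"
      by (auto intro!: derivative_eq_intros)
    note d1 = DERIV_mult[OF DERIV_power[OF d, of m] dz_has_derivative[OF jointly_holomorphic_dw[OF F open_ball open_ball] open_ball zw]]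
    note d2 = DERIV_mult[OF DERIV_mult[OF DERIV_cmult[OF DERIV_power[OF d, of "m - 1"], of "of_nat m"] DERIV_ident]
        dz_has_derivative[OF F open_ball zw]]
    have "((\<lambda>z. (1 - z * w) ^ m * dw F (z, w) - of_nat m * (1 - z * w) ^ (m - 1) * z * F (z, w)) has_field_derivative
     (1 - z * w) ^ m * dz (dw F) (z, w) - of_nat m * (1 - z * w) ^ (m - 1) * w * dw F (z, w)
    - of_nat m * (1 - z * w) ^ (m - 1) * z * dz F (z, w) - of_nat m * (1 - z * w) ^ (m - 1) * F (z, w)
    + of_nat m * (of_nat (m - 1) * (1 - z * w) ^ (m - 1 - 1)) * (z * w) * F (z, w)) (at z)"
      by (rule DERIV_cong[OF DERIV_diff[OF d1 d2]], unfold One_nat_def[symmetric]) (rule alg)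
    from DERIV_imp_deriv[OF this] show ?thesis by (simp add: dz_def)
  qed
  finally show ?thesis .
qed

text \<open>The weight \<open>(1 - z * w) ^ m\<close> lowers the factor
  \<open>(1 - z * w)\<^sup>2\<close> of the eigenvalue equation to its first power, so that
  comparing coefficients in \<open>z\<close> relates two consecutive indices only.\<close>

lemma weighted_pde:
  assumes F: "F \<in> eigenspace (4 * of_nat m * (of_nat m + 1))" and zw: "z \<in> disc" "w \<in> disc"
  defines "H \<equiv> \<lambda>p. (1 - fst p * snd p) ^ m * F p"
  shows "(1 - z * w) * dz (dw H) (z, w) + of_nat m * (z * dz H (z, w) + w * dw H (z, w)) - of_nat m ^ 2 * H (z, w) = 0"
proof -
  note h = eigenspaceD(2)[OF F]
  define D where "D = 1 - z * w"
  define P1 where "P1 = of_nat m * D ^ (m - 1)"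
  define P2 where "P2 = of_nat m * (of_nat (m - 1) * D ^ (m - 1 - 1))"
  define M where "M = (of_nat m :: complex)"
  have D0: "D \<noteq> 0" unfolding D_def using disc_mult[OF zw] by (rule disc_neq_1)
  \<comment> \<open>\<open>P1\<close> and \<open>P2\<close> come from the first and second
    derivative of \<open>D ^ m\<close>. The whole equation is multiplied by \<open>D\<close>, these
    two rules remove the truncated exponents, and \<open>D\<close> is cancelled at the end.\<close>
  have P1: "D * P1 = M * D ^ m" by (cases m) (auto simp: P1_def M_def)
  have P2: "D * P2 = (M - 1) * P1"
  proof (cases m)
    case (Suc j)
    then show ?thesis by (cases j) (auto simp: P1_def P2_def M_def)
  qed (simp add: P1_def P2_def)
  have F2: "D * (D * dz (dw F) (z, w)) = M * (M + 1) * F (z, w)"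
  proof -
    have "4 * (D * (D * dz (dw F) (z, w))) = 4 * (M * (M + 1) * F (z, w))"
      using eigenspaceD(4)[OF F zw] by (simp add: D_def M_def power2_eq_square mult.assoc)
    then show ?thesis by (simp only: mult_cancel_left) simp
  qed
  have zw1: "z * w = 1 - D" by (simp add: D_def)
  define f where "f = F (z, w)"
  define fz where "fz = dz F (z, w)"
  define fw where "fw = dw F (z, w)"
  define fzw where "fzw = dz (dw F) (z, w)"
  have Hs: "H (z, w) = D ^ m * f" "dw H (z, w) = D ^ m * fw - P1 * z * f" "dz H (z, w) = D ^ m * fz - P1 * w * f"
    "dz (dw H) (z, w) = D ^ m * fzw - P1 * w * fw - P1 * z * fz - P1 * f + P2 * (z * w) * f"
    unfolding H_def dw_weighted[OF h zw] dz_weighted[OF h zw] dz_dw_weighted[OF h zw]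
    by (simp_all add: D_def P1_def P2_def f_def fz_def fw_def fzw_def)
  have "D * (D * dz (dw H) (z, w) + M * (z * dz H (z, w) + w * dw H (z, w)) - M ^ 2 * H (z, w)) =
     D ^ m * (D * (D * fzw)) - (D * P1) * D * (w * fw + z * fz + f) + (D * P2) * D * (z * w) * f
     + M * D * D ^ m * (z * fz + w * fw) - 2 * M * (D * P1) * (z * w) * f - M ^ 2 * D * D ^ m * f"
    unfolding Hs by (simp add: algebra_simps power2_eq_square)
  also have "(D * P2) * D = (M - 1) * (D * P1)" unfolding P2 by simp
  also have "D ^ m * (D * (D * fzw)) - (D * P1) * D * (w * fw + z * fz + f) + ((M - 1) * (D * P1)) * (z * w) * f
     + M * D * D ^ m * (z * fz + w * fw) - 2 * M * (D * P1) * (z * w) * f - M ^ 2 * D * D ^ m * f = 0"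
    unfolding P1 F2[folded f_def fzw_def] zw1 by (simp add: algebra_simps power2_eq_square)
  finally show ?thesis using D0 by (simp add: D_def M_def)
qed

text \<open>Writing \<open>b\<^sub>j(w)\<close> for the coefficients in \<open>z\<close> of \<open>(1 - z w)\<^sup>m F\<close>, the eigenvalue equation becomes
  \<open>(j + 1) b\<^sub>j\<^sub>+\<^sub>1' = (j - m) (w b\<^sub>j' - m b\<^sub>j)\<close>, so the coefficients of index greater than \<open>m\<close> decouple.\<close>

lemma weighted_coefficients_vanish:
  assumes F: "F \<in> eigenspace (4 * of_nat m * (of_nat m + 1))"
    and F0: "\<And>j. j > m \<Longrightarrow> taylor_coeff (\<lambda>z. F (z, 0)) j = 0" and w: "w \<in> disc" and j: "j > m"
  shows "taylor_coeff (\<lambda>z. (1 - z * w) ^ m * F (z, w)) j = 0"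
proof -
  note h = eigenspaceD(2)[OF F]
  define H where "H = (\<lambda>p. (1 - fst p * snd p) ^ m * F p)"
  have H: "jointly_holomorphic H disc disc"
    unfolding jointly_holomorphic_def H_def
    by (intro conjI ballI continuous_intros holomorphic_intros jointly_holomorphicD(1)[OF h]) (auto intro!: holomorphic_intros jointly_holomorphicD[OF h])
  have rec: "of_nat (Suc i) * taylor_coeff (\<lambda>z. dw H (z, w)) (Suc i) =
      (of_nat i - of_nat m) * (w * taylor_coeff (\<lambda>z. dw H (z, w)) i - of_nat m * taylor_coeff (\<lambda>z. H (z, w)) i)"
    if w: "w \<in> disc" for w i
  proof -
    define B where "B = Abs_fps (taylor_coeff (\<lambda>z. H (z, w)))"
    define C where "C = Abs_fps (taylor_coeff (\<lambda>z. dw H (z, w)))"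
    have B: "(\<lambda>z. H (z, w)) has_fps_expansion B"
      unfolding B_def by (rule has_fps_expansion_taylor_coeff[OF jointly_holomorphicD(2)[OF H w]]) auto
    have C: "(\<lambda>z. dw H (z, w)) has_fps_expansion C"
      unfolding C_def by (rule has_fps_expansion_taylor_coeff[OF jointly_holomorphicD(2)[OF jointly_holomorphic_dw[OF H] w]]) auto
    have exp: "(\<lambda>z. (1 - w * z) * deriv (\<lambda>z. dw H (z, w)) z + of_nat m * (z * deriv (\<lambda>z. H (z, w)) z + w * dw H (z, w))
        - of_nat m ^ 2 * H (z, w)) has_fps_expansion
      (1 - fps_const w * fps_X) * fps_deriv C + fps_const (of_nat m) * (fps_X * fps_deriv B + fps_const w * C)
        - fps_const (of_nat m) ^ 2 * B" (is "?f has_fps_expansion ?E")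
      by (intro fps_expansion_intros B C)
    have ev: "\<forall>\<^sub>F z in nhds 0. ?f z = 0"
      unfolding eventually_nhds
    proof (intro exI[of _ disc] conjI ballI)
      show "?f z = 0" if z: "z \<in> disc" for z
      proof -
        have "(1 - z * w) * dz (dw H) (z, w) + of_nat m * (z * dz H (z, w) + w * dw H (z, w)) - of_nat m ^ 2 * H (z, w) = 0"
          unfolding H_def by (rule weighted_pde[OF F z w])
        then show ?thesis by (simp add: dz_def mult.commute[of w z])
      qed
    qed auto
    from exp have "(\<lambda>_. 0) has_fps_expansion ?E"
      unfolding has_fps_expansion_cong[OF ev refl] .
    then have "?E = 0" by (rule fps_expansion_unique_complex[OF _ has_fps_expansion_0])
    then have "fps_nth ?E i = 0" by simp
    then have "of_nat (Suc i) * fps_nth C (Suc i) = (of_nat i - of_nat m) * (w * fps_nth C i - of_nat m * fps_nth B i)"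
      by (cases i) (simp_all add: algebra_simps power2_eq_square)
    then show ?thesis by (simp add: B_def C_def)
  qed
  have "\<forall>w\<in>disc. taylor_coeff (\<lambda>z. H (z, w)) j = 0" if "j > m" for j
    using that
  proof (induction j rule: less_induct)
    case (less j)
    then obtain i where i: "j = Suc i" by (cases j) auto
    \<comment> \<open>On the axis \<open>w = 0\<close> the weight is 1, so \<open>H\<close> and
      \<open>F\<close> agree there.\<close>
    have H0: "taylor_coeff (\<lambda>z. H (z, 0)) j = 0" using F0[OF less.prems] by (simp add: H_def)
    show ?case
    proof (intro ballI vanishing_coefficients_step[OF H H0])
      fix w :: complex assume w: "w \<in> disc"
      have "(of_nat i - of_nat m) * (w * taylor_coeff (\<lambda>z. dw H (z, w)) i - of_nat m * taylor_coeff (\<lambda>z. H (z, w)) i) = 0"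
      \<comment> \<open>At \<open>i = m\<close> the factor \<open>i - m\<close> cuts the recurrence
        off from the lower coefficients; for \<open>i > m\<close> the induction hypothesis
        applies.\<close>
      proof (cases "i = m")
        case False
        then have "\<forall>w\<in>disc. taylor_coeff (\<lambda>z. H (z, w)) i = 0" using less i by simp
        then show ?thesis using vanishing_coefficients_deriv[OF H _ w, of i] w by simp
      qed simp
      then have "of_nat (Suc i) * taylor_coeff (\<lambda>z. dw H (z, w)) (Suc i) = 0" using rec[OF w, of i] by simp
      then show "taylor_coeff (\<lambda>z. dw H (z, w)) j = 0" using i by (simp del: of_nat_Suc)
    qed
  qed
  then show ?thesis using w j by (simp add: H_def)
qed

lemma taylor_coeff_poly:
  assumes "\<And>z. z \<in> disc \<Longrightarrow> f z = poly p z" "degree p \<le> m" "n > m"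
  shows "taylor_coeff f n = 0"
proof (rule taylor_coeff_polynomial[OF _ assms(3)])
  fix z :: complex assume "z \<in> disc"
  have "(\<Sum>i\<le>m. coeff p i * z ^ i) = (\<Sum>i\<le>degree p. coeff p i * z ^ i)"
    by (rule sum.mono_neutral_right) (use assms(2) in \<open>auto simp: coeff_eq_0\<close>)
  then show "f z = (\<Sum>i\<le>m. coeff p i * z ^ i)"
    using assms(1)[OF \<open>z \<in> disc\<close>] by (simp add: poly_altdef)
qed

text \<open>The transformed function on the axis \<open>w = 0\<close> is F(mob(z), w0) with the
  fixed value w0 = c / a. On this slice (1 - z w0)^m F(z, w0) is a polynomial of degree at most
  \<open>m\<close> in \<open>z\<close>, and 1 - mob(z) w0 = (ad - bc) / (a (cz + d)). Dividing by
  the \<open>m\<close>-th power of the latter supplies (cz + d)^m, which clears all denominators (cz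
  + d)^i and leaves a polynomial of degree at most \<open>m\<close>.\<close>

lemma spectral_space_plus_moebius:
  assumes F: "F \<in> spectral_space (4 * of_nat m * (of_nat m + 1)) {- int m..}" and M: "disc_moebius a b c d"
  shows "restrict_bidisk (F \<circ> map_prod (mob a b c d) (mob d c b a)) \<in> spectral_space (4 * of_nat m * (of_nat m + 1)) {- int m..}"
proof -
  have Fe: "F \<in> eigenspace (4 * of_nat m * (of_nat m + 1))" using F by (simp add: spectral_space_def)
  note h = eigenspaceD(2)[OF Fe]
  define G where "G = restrict_bidisk (F \<circ> map_prod (mob a b c d) (mob d c b a))"
  have F0: "taylor_coeff (\<lambda>z. F (z, 0)) j = 0" if "j > m" for j
    using F that lead_nonpos[of j F] by (auto simp: spectral_space_def)
  define w0 where "w0 = mob d c b a 0"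
  have M0: "a * d - b * c \<noteq> 0" "a \<noteq> 0" "w0 \<in> disc"
    using M by (auto simp: disc_moebius_def w0_def dest: bspec[of _ _ 0])
  have w0: "w0 = c / a" by (simp add: w0_def mob_def)
  define k where "k = (\<lambda>i. taylor_coeff (\<lambda>z. (1 - z * w0) ^ m * F (z, w0)) i)"
  define p where "p = (\<Sum>i\<le>m. smult (k i * (a / (a * d - b * c)) ^ m) ([:b, a:] ^ i * [:d, c:] ^ (m - i)))"
  have hol: "(\<lambda>z. (1 - z * w0) ^ m * F (z, w0)) holomorphic_on disc"
    by (intro holomorphic_intros jointly_holomorphicD(2)[OF h M0(3)])
  have weighted: "(1 - z * w0) ^ m * F (z, w0) = (\<Sum>i\<le>m. k i * z ^ i)" if "z \<in> disc" for z
    unfolding k_def by (rule taylor_coeff_finite[OF hol _ that]) (rule weighted_coefficients_vanish[OF Fe F0 M0(3)])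
  have "G (z, 0) = poly p z" if z: "z \<in> disc" for z
  proof -
    have nz: "c * z + d \<noteq> 0" and mz: "mob a b c d z \<in> disc" using M z by (auto simp: disc_moebius_def)
    \<comment> \<open>The reciprocal of \<open>1 - mob a b c d z * w0\<close>.\<close>
    define q where "q = a * (c * z + d) / (a * d - b * c)"
    have "(1 - mob a b c d z * w0) * q = 1"
      unfolding w0 mob_def q_def using nz M0 by (simp add: divide_simps) (simp add: algebra_simps)
    then have q: "(1 - mob a b c d z * w0) ^ m * q ^ m = 1" by (simp add: power_mult_distrib[symmetric])
    have "G (z, 0) = F (mob a b c d z, w0)" using z by (simp add: G_def restrict_bidisk_def bidisk_def w0_def)
    also have "\<dots> = ((1 - mob a b c d z * w0) ^ m * q ^ m) * F (mob a b c d z, w0)" unfolding q by simp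
    also have "\<dots> = q ^ m * ((1 - mob a b c d z * w0) ^ m * F (mob a b c d z, w0))" by simp
    also have "\<dots> = (\<Sum>i\<le>m. q ^ m * (k i * mob a b c d z ^ i))"
      unfolding weighted[OF mz] sum_distrib_left ..
    also have "\<dots> = poly p z"
      unfolding p_def poly_sum
    proof (rule sum.cong[OF refl])
      fix i assume "i \<in> {..m}"
      then have "(c * z + d) ^ m = (c * z + d) ^ (m - i) * (c * z + d) ^ i" by (simp add: power_add[symmetric])
      then have X: "(c * z + d) ^ m * ((a * z + b) / (c * z + d)) ^ i = (a * z + b) ^ i * (c * z + d) ^ (m - i)"
        using nz by (simp add: power_divide)
      have q': "q ^ m = (a / (a * d - b * c)) ^ m * (c * z + d) ^ m"
        by (simp add: q_def power_mult_distrib[symmetric])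
      have P: "poly [:b, a:] z = a * z + b" "poly [:d, c:] z = c * z + d" by (simp_all add: algebra_simps)
      have "q ^ m * (k i * mob a b c d z ^ i) = k i * (a / (a * d - b * c)) ^ m * ((c * z + d) ^ m * ((a * z + b) / (c * z + d)) ^ i)"
        unfolding q' mob_def by (simp only: mult_ac)
      then show "q ^ m * (k i * mob a b c d z ^ i) =
          poly (smult (k i * (a / (a * d - b * c)) ^ m) ([:b, a:] ^ i * [:d, c:] ^ (m - i))) z"
        unfolding X poly_smult poly_mult poly_power P .
    qed
    finally show ?thesis .
  qed
  moreover have "degree p \<le> m"
    unfolding p_def
  proof (rule degree_sum_le)
    fix i assume i: "i \<in> {..m}"
    have l: "degree ([:x, y:] ^ l) \<le> l" for x y :: complex and l
      using degree_power_le[of "[:x, y:]" l] by (rule order_trans) (simp add: degree_pCons_eq_if)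
    have "degree ([:b, a:] ^ i * [:d, c:] ^ (m - i)) \<le> i + (m - i)"
      by (rule order_trans[OF degree_mult_le add_mono[OF l l]])
    also have "i + (m - i) = m" using i by simp
    finally have "degree ([:b, a:] ^ i * [:d, c:] ^ (m - i)) \<le> m" .
    then show "degree (smult (k i * (a / (a * d - b * c)) ^ m) ([:b, a:] ^ i * [:d, c:] ^ (m - i))) \<le> m"
      by (rule order_trans[OF degree_smult_le])
  qed simp
  ultimately have tcG: "taylor_coeff (\<lambda>z. G (z, 0)) n = 0" if "n > m" for n
    using that by (intro taylor_coeff_poly[of _ p m])
  have "lead k G = 0" if "k \<notin> {- int m..}" for k
  proof -
    define n where "n = nat (- k)"
    have "k = - int n" "n > m" using that by (auto simp: n_def)
    then show ?thesis using tcG[of n] lead_nonpos[of n G] by simp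
  qed
  then show ?thesis unfolding G_def[symmetric] using eigenspace_moebius[OF Fe M] by (simp add: spectral_space_def G_def)
qed

lemma spectral_space_swap:
  "F \<circ> prod.swap \<in> spectral_space lam N \<longleftrightarrow> F \<in> spectral_space lam (uminus ` N)"
proof -
  have "F \<circ> prod.swap \<in> eigenspace lam \<longleftrightarrow> F \<in> eigenspace lam"
  proof
    assume "F \<circ> prod.swap \<in> eigenspace lam"
    then have "(F \<circ> prod.swap) \<circ> prod.swap \<in> eigenspace lam" by (rule eigenspace_swap)
    then show "F \<in> eigenspace lam" by (simp add: comp_assoc)
  qed (rule eigenspace_swap)
  moreover have "(\<forall>k. k \<notin> N \<longrightarrow> lead (- k) F = 0) \<longleftrightarrow> (\<forall>k. k \<notin> uminus ` N \<longrightarrow> lead k F = 0)"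
  proof -
    have mem: "k \<in> uminus ` N \<longleftrightarrow> - k \<in> N" for k
      by (auto simp: image_iff intro: bexI[of _ "- k"])
    show ?thesis unfolding mem by (metis add.inverse_inverse)
  qed
  ultimately show ?thesis by (simp add: spectral_space_def lead_swap)
qed

text \<open>The flip exchanges the two coordinate maps, that is, the parameters
  \<open>a b c d\<close> and \<open>d c b a\<close>, and reduces the claim to the other half-line of
  indices.\<close>

lemma spectral_space_minus_moebius:
  assumes F: "F \<in> spectral_space (4 * of_nat m * (of_nat m + 1)) {..int m}" and M: "disc_moebius a b c d"
  shows "restrict_bidisk (F \<circ> map_prod (mob a b c d) (mob d c b a)) \<in> spectral_space (4 * of_nat m * (of_nat m + 1)) {..int m}"
proof -
  have im: "uminus ` {- int m..} = {..int m}" by simp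
  have M': "disc_moebius d c b a" using M disc_moebius_swap by blast
  have "F \<circ> prod.swap \<in> spectral_space (4 * of_nat m * (of_nat m + 1)) {- int m..}"
    using F unfolding spectral_space_swap im .
  from spectral_space_plus_moebius[OF this M']
  have "restrict_bidisk ((F \<circ> prod.swap) \<circ> map_prod (mob d c b a) (mob a b c d)) \<in>
     spectral_space (4 * of_nat m * (of_nat m + 1)) {- int m..}" .
  also have "restrict_bidisk ((F \<circ> prod.swap) \<circ> map_prod (mob d c b a) (mob a b c d)) =
      restrict_bidisk (F \<circ> map_prod (mob a b c d) (mob d c b a)) \<circ> prod.swap"
    unfolding restrict_swap[symmetric] by (auto simp: fun_eq_iff restrict_bidisk_def)
  finally show ?thesis unfolding spectral_space_swap im .
qed

lemma invariant_spectral_spaceI: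
  assumes "\<And>F a b c d. F \<in> spectral_space lam N \<Longrightarrow> disc_moebius a b c d \<Longrightarrow>
    restrict_bidisk (F \<circ> map_prod (mob a b c d) (mob d c b a)) \<in> spectral_space lam N"
  shows "invariant_subspace moebius_group_bidisk_direct lam (spectral_space lam N)"
  unfolding invariant_subspace_def
proof (intro conjI ballI)
  show "closedin (subtopology holo_topology (eigenspace lam)) (spectral_space lam N)"
    unfolding closedin_closed_subtopology[OF closedin_eigenspace]
    using closedin_spectral_space by (auto simp: spectral_space_def)
  fix F T assume F: "F \<in> spectral_space lam N" and "T \<in> moebius_group_bidisk_direct"
  then obtain a b c d where M: "disc_moebius a b c d"
    and T: "\<And>p. p \<in> bidisk \<Longrightarrow> T p = map_prod (mob a b c d) (mob d c b a) p"
    using direct_automorphism_form by blast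
  have "restrict_bidisk (F \<circ> T) = restrict_bidisk (F \<circ> map_prod (mob a b c d) (mob d c b a))"
    using T by (auto simp: restrict_bidisk_def fun_eq_iff)
  then show "restrict_bidisk (F \<circ> T) \<in> spectral_space lam N" using assms[OF F M] by simp
qed (rule subspace_spectral_space)

text \<open>The space of the bounded index set is the intersection of the two others, so its
  invariance is inherited.\<close>

lemma invariant_spectral_spaces:
  assumes "N \<in> {{- int m..}, {..int m}, {- int m..int m}}"
  shows "invariant_subspace moebius_group_bidisk_direct (4 * of_nat m * (of_nat m + 1))
    (spectral_space (4 * of_nat m * (of_nat m + 1)) N)"
proof (rule invariant_spectral_spaceI)
  have int: "spectral_space lam {- int m..int m} = spectral_space lam {- int m..} \<inter> spectral_space lam {..int m}" for lam
    by (auto simp: spectral_space_def)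
  fix F a b c d
  assume "F \<in> spectral_space (4 * of_nat m * (of_nat m + 1)) N" "disc_moebius a b c d"
  then show "restrict_bidisk (F \<circ> map_prod (mob a b c d) (mob d c b a)) \<in> spectral_space (4 * of_nat m * (of_nat m + 1)) N"
    using assms spectral_space_plus_moebius[of F m a b c d] spectral_space_minus_moebius[of F m a b c d]
    unfolding insert_iff empty_iff int by (elim disjE) (simp_all only: int Int_iff simp_thms)
qed

section \<open>Index sets of invariant subspaces\<close>

lemma invariant_subspace_spectral:
  assumes Y: "invariant_subspace moebius_group_bidisk_direct lam Y"
  obtains N where "Y = spectral_space lam N"
    "\<And>k. k \<in> N \<Longrightarrow> \<not> (k \<ge> 0 \<and> lam = 4 * of_int k * (of_int k + 1)) \<Longrightarrow> k + 1 \<in> N"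
    "\<And>k. k \<in> N \<Longrightarrow> \<not> (k \<le> 0 \<and> lam = 4 * of_int k * (of_int k - 1)) \<Longrightarrow> k - 1 \<in> N"
proof -
  have c: "cfun.subspace Y" "closedin holo_topology Y" "Y \<subseteq> eigenspace lam"
    using Y unfolding invariant_subspace_def closedin_closed_subtopology[OF closedin_eigenspace] by auto
  have inv: "restrict_bidisk (G \<circ> T) \<in> Y" if "G \<in> Y" "T \<in> moebius_group_bidisk_direct" for G T
    using Y that unfolding invariant_subspace_def by blast
  have rot: "G \<circ> rot t \<in> Y" if "G \<in> Y" for G t
  proof -
    have "G \<in> holo_bidisk" using that c(3) eigenspaceD(1) by blast
    then show ?thesis using inv[OF that rot_in_direct_group, of t] by (simp only: restrict_bidisk_rot)
  qed
  have tau: "restrict_bidisk (G \<circ> map_prod (tau s) (tau s)) \<in> Y" if "G \<in> Y" "\<bar>s\<bar> < 1" for G s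
    using inv[OF that(1) tau_in_direct_group[OF that(2)]] .
  show ?thesis
  proof (rule that)
    show "Y = spectral_space lam {k. \<exists>G\<in>Y. lead k G \<noteq> 0}"
      by (rule closed_rotation_invariant_subspace[OF c rot])
    show "k + 1 \<in> {k. \<exists>G\<in>Y. lead k G \<noteq> 0}"
      if "k \<in> {k. \<exists>G\<in>Y. lead k G \<noteq> 0}" "\<not> (k \<ge> 0 \<and> lam = 4 * of_int k * (of_int k + 1))" for k
      using spectrum_shift(1)[OF c rot tau _ that(2)] that(1) by simp
    show "k - 1 \<in> {k. \<exists>G\<in>Y. lead k G \<noteq> 0}"
      if "k \<in> {k. \<exists>G\<in>Y. lead k G \<noteq> 0}" "\<not> (k \<le> 0 \<and> lam = 4 * of_int k * (of_int k - 1))" for k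
      using spectrum_shift(2)[OF c rot tau _ that(2)] that(1) by simp
  qed
qed

lemma spectral_space_empty: "spectral_space lam {} = {0}"
  using eigenspace_eq_0[of _ lam] cfun.subspace_0[OF subspace_eigenspace] by (auto simp: spectral_space_def)

lemma spectral_space_UNIV: "spectral_space lam UNIV = eigenspace lam"
  by (simp add: spectral_space_def)

lemma int_set_up:
  assumes "a \<in> N" "a \<le> (l::int)" "\<And>x. x \<in> N \<Longrightarrow> a \<le> x \<Longrightarrow> x < l \<Longrightarrow> x + 1 \<in> N"
  shows "l \<in> N"
  using assms(2,3)
proof (induction l rule: int_ge_induct)
  case (step i)
  have "i \<in> N" by (rule step.IH) (use step.prems in auto)
  then show ?case using step by auto
qed (use assms in auto)

lemma int_set_down:
  assumes "a \<in> N" "(l::int) \<le> a" "\<And>x. x \<in> N \<Longrightarrow> x \<le> a \<Longrightarrow> l < x \<Longrightarrow> x - 1 \<in> N"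
  shows "l \<in> N"
  using assms(2,3)
proof (induction l rule: int_le_induct)
  case (step i)
  have "i \<in> N" by (rule step.IH) (use step.prems in auto)
  then show ?case using step by auto
qed (use assms in auto)

text \<open>Steps up are blocked only at \<open>m\<close> and steps down only at \<open>- m\<close>.
  Any element can therefore reach all of \<open>{- m..m}\<close>, an element above \<open>m\<close>
  also reaches every larger integer, and an element below \<open>- m\<close> every smaller one.
  Which of the two outer ranges is met decides the set.\<close>

lemma shift_closed_int_sets:
  assumes up: "\<And>k. k \<in> N \<Longrightarrow> k \<noteq> m \<Longrightarrow> k + 1 \<in> N" and down: "\<And>k. k \<in> N \<Longrightarrow> k \<noteq> - m \<Longrightarrow> k - 1 \<in> N"
    and m: "m \<ge> (0::int)"
  shows "N \<in> {{}, UNIV, {- m..}, {..m}, {- m..m}}"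
proof -
  have U: "l \<in> N" if "k \<in> N" "k \<le> l" "m < k \<or> l \<le> m" for k l
    by (rule int_set_up[OF that(1,2)]) (use up that(3) in auto)
  have D: "l \<in> N" if "k \<in> N" "l \<le> k" "k < - m \<or> - m \<le> l" for k l
    by (rule int_set_down[OF that(1,2)]) (use down that(3) in auto)
  have A: "{- m..m} \<subseteq> N" if k: "k \<in> N" for k
  proof -
    \<comment> \<open>An element above \<open>m\<close> first descends to \<open>m\<close>, which is
      not blocked since \<open>- m \<le> m\<close>; from at most \<open>m\<close> one climbs to
      \<open>m\<close> and then descends to \<open>- m\<close>.\<close>
    have "min k m \<in> N" using D[OF k, of "min k m"] k m by (cases "k \<le> m") auto
    then have "m \<in> N" using U[of "min k m" m] by auto
    then show ?thesis using D[of m] by auto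
  qed
  have B: "{- m..} \<subseteq> N" if k: "k \<in> N" "m < k" for k
  proof
    fix l assume "l \<in> {- m..}"
    then show "l \<in> N" using U[OF k(1), of l] D[OF k(1), of l] k(2) by (cases "k \<le> l") auto
  qed
  have C: "{..m} \<subseteq> N" if k: "k \<in> N" "k < - m" for k
  proof
    fix l assume "l \<in> {..m}"
    then show "l \<in> N" using U[OF k(1), of l] D[OF k(1), of l] k(2) by (cases "k \<le> l") auto
  qed
  show ?thesis
  proof (cases "\<exists>k\<in>N. m < k"; cases "\<exists>k\<in>N. k < - m")
    assume "\<exists>k\<in>N. m < k" "\<exists>k\<in>N. k < - m"
    then have "{- m..} \<subseteq> N" "{..m} \<subseteq> N" using B C by blast+
    moreover have "{- m..} \<union> {..m} = UNIV" using m by auto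
    ultimately show ?thesis by blast
  next
    assume 1: "\<exists>k\<in>N. m < k" "\<not> (\<exists>k\<in>N. k < - m)"
    then have "{- m..} \<subseteq> N" using B by blast
    then have "N = {- m..}" using 1(2) by (auto simp: not_less)
    then show ?thesis by simp
  next
    assume 1: "\<not> (\<exists>k\<in>N. m < k)" "\<exists>k\<in>N. k < - m"
    then have "{..m} \<subseteq> N" using C by blast
    then have "N = {..m}" using 1(1) by (auto simp: not_less)
    then show ?thesis by simp
  next
    assume 1: "\<not> (\<exists>k\<in>N. m < k)" "\<not> (\<exists>k\<in>N. k < - m)"
    then have "N \<subseteq> {- m..m}" by (auto simp: not_less)
    then show ?thesis using A by (cases "N = {}") auto
  qed
qed

section \<open>Classification\<close>

definition exc_eigenvalue :: "nat \<Rightarrow> complex" where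
  "exc_eigenvalue m = 4 * of_nat m * (of_nat m + 1)"

definition poisson_modes :: "nat \<Rightarrow> int \<Rightarrow> complex \<times> complex \<Rightarrow> complex" where
  "poisson_modes m = poisson_mode (of_nat (m + 1))"

lemma poisson_modes_eigenspace: "poisson_modes m n \<in> eigenspace (exc_eigenvalue m)"
  unfolding poisson_modes_def exc_eigenvalue_def by (rule poisson_mode_eigenspace)

lemma lead_poisson_modes: "lead k (poisson_modes m n) = 0 \<longleftrightarrow> k \<noteq> n"
  unfolding poisson_modes_def by (rule lead_poisson_mode)

lemma poisson_modes_in_spectral_space: "poisson_modes m n \<in> spectral_space (exc_eigenvalue m) N \<longleftrightarrow> n \<in> N"
  using poisson_modes_eigenspace by (auto simp: spectral_space_def lead_poisson_modes)

lemma inj_poisson_modes: "inj (poisson_modes m)"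
  by (rule injI) (metis lead_poisson_modes)

text \<open>For these eigenvalues every index carries a nonzero mode, so the index set can be
  recovered from the space. This yields distinctness of the three spaces and their
  nontriviality.\<close>

lemma spectral_space_eq_iff: "spectral_space (exc_eigenvalue m) N = spectral_space (exc_eigenvalue m) N' \<longleftrightarrow> N = N'"
  using poisson_modes_in_spectral_space by blast

lemma mode_part_in_span:
  assumes F: "F \<in> spectral_space (exc_eigenvalue m) N"
  shows "mode_part k F \<in> cfun.span (poisson_modes m ` N)"
proof (cases "k \<in> N")
  case True
  have Fe: "F \<in> eigenspace (exc_eigenvalue m)" using F by (simp add: spectral_space_def)
  have "mode_part k F = fun_scale (lead k F / lead k (poisson_modes m k)) (poisson_modes m k)"
  proof (rule eigenspace_eqI[OF mode_part_eigenspace[OF Fe]])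
    show "fun_scale (lead k F / lead k (poisson_modes m k)) (poisson_modes m k) \<in> eigenspace (exc_eigenvalue m)"
      by (intro cfun.subspace_scale[OF subspace_eigenspace] poisson_modes_eigenspace)
    show "lead n (mode_part k F) = lead n (fun_scale (lead k F / lead k (poisson_modes m k)) (poisson_modes m k))" for n
      unfolding lead_mode_part[OF Fe] lead_fun_scale[OF eigenspaceD(2)[OF poisson_modes_eigenspace]]
      using lead_poisson_modes[of n m k] by auto
  qed
  then show ?thesis using True by (simp add: cfun.span_scale cfun.span_base)
next
  case False
  have Fe: "F \<in> eigenspace (exc_eigenvalue m)" using F by (simp add: spectral_space_def)
  have "mode_part k F = 0"
    by (rule eigenspace_eq_0[OF mode_part_eigenspace[OF Fe]])
      (use F False in \<open>auto simp: lead_mode_part[OF Fe] spectral_space_def\<close>)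
  then show ?thesis by (simp add: cfun.span_zero)
qed

lemma span_poisson_modes_subset: "cfun.span (poisson_modes m ` N) \<subseteq> spectral_space (exc_eigenvalue m) N"
  by (rule cfun.span_minimal[OF _ subspace_spectral_space]) (auto simp: poisson_modes_in_spectral_space)

text \<open>The right-hand side is closed and contains the modes; conversely the partial sums of the
  mode series of a member lie in the span, since each of its modes is a multiple of a Poisson
  mode.\<close>

lemma closure_of_span_poisson_modes:
  "holo_topology closure_of cfun.span (poisson_modes m ` N) = spectral_space (exc_eigenvalue m) N"
proof
  show "holo_topology closure_of cfun.span (poisson_modes m ` N) \<subseteq> spectral_space (exc_eigenvalue m) N"
    by (rule closure_of_minimal[OF span_poisson_modes_subset closedin_spectral_space])
  show "spectral_space (exc_eigenvalue m) N \<subseteq> holo_topology closure_of cfun.span (poisson_modes m ` N)"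
  proof
    fix F assume F: "F \<in> spectral_space (exc_eigenvalue m) N"
    then have Fe: "F \<in> eigenspace (exc_eigenvalue m)" by (simp add: spectral_space_def)
    have "cfun.span (poisson_modes m ` N) \<subseteq> topspace holo_topology"
      using span_poisson_modes_subset[of m N] eigenspaceD(1) by (auto simp: topspace_holo_topology spectral_space_def)
    then have sub: "cfun.span (poisson_modes m ` N) \<subseteq> holo_topology closure_of cfun.span (poisson_modes m ` N)"
      by (rule closure_of_subset)
    show "F \<in> holo_topology closure_of cfun.span (poisson_modes m ` N)"
    proof (rule closedin_holo_topologyD[OF closedin_closure_of _ _ mode_part_series[OF Fe] eigenspaceD(1)[OF Fe]])
      show "\<forall>\<^sub>F n in sequentially. (\<Sum>i<n. mode_part (int i) F + mode_part (- int i - 1) F) \<in> holo_topology closure_of cfun.span (poisson_modes m ` N)"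
        by (intro always_eventually allI subsetD[OF sub] cfun.span_sum cfun.span_add mode_part_in_span F)
    qed simp
  qed
qed

text \<open>No closure is required for finitely many indices: \<open>F\<close> and the finite sum of
  its modes have the same leads.\<close>

lemma span_poisson_modes_finite:
  assumes N: "finite N"
  shows "cfun.span (poisson_modes m ` N) = spectral_space (exc_eigenvalue m) N"
proof
  show "spectral_space (exc_eigenvalue m) N \<subseteq> cfun.span (poisson_modes m ` N)"
  proof
    fix F assume F: "F \<in> spectral_space (exc_eigenvalue m) N"
    then have Fe: "F \<in> eigenspace (exc_eigenvalue m)" by (simp add: spectral_space_def)
    have "F = (\<Sum>k\<in>N. mode_part k F)"
    proof (rule eigenspace_eqI[OF Fe])
      show "(\<Sum>k\<in>N. mode_part k F) \<in> eigenspace (exc_eigenvalue m)"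
        by (intro cfun.subspace_sum[OF subspace_eigenspace] mode_part_eigenspace Fe)
      show "lead n F = lead n (\<Sum>k\<in>N. mode_part k F)" for n
        using F N by (subst lead_sum) (auto simp: lead_mode_part[OF Fe] spectral_space_def intro: eigenspaceD(2)[OF mode_part_eigenspace[OF Fe]])
    qed
    also have "\<dots> \<in> cfun.span (poisson_modes m ` N)"
      by (intro cfun.span_sum mode_part_in_span F)
    finally show "F \<in> cfun.span (poisson_modes m ` N)" .
  qed
qed (rule span_poisson_modes_subset)

text \<open>The functionals \<open>lead n\<close> form a dual system up to nonzero factors:
  \<open>lead n\<close> vanishes on every mode except the \<open>n\<close>-th.\<close>

lemma independent_poisson_modes:
  assumes N: "finite N"
  shows "\<not> cfun.dependent (poisson_modes m ` N)"
proof (rule cfun.independent_if_scalars_zero)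
  fix f x assume s: "(\<Sum>x\<in>poisson_modes m ` N. fun_scale (f x) x) = 0" and "x \<in> poisson_modes m ` N"
  then obtain n where n: "n \<in> N" "x = poisson_modes m n" by blast
  have "lead n (\<Sum>x\<in>poisson_modes m ` N. fun_scale (f x) x) = (\<Sum>x\<in>poisson_modes m ` N. f x * lead n x)"
    by (subst lead_sum) (auto simp: lead_fun_scale eigenspaceD(2)[OF poisson_modes_eigenspace] intro!: jointly_holomorphic_fun_scale sum.cong)
  also have "\<dots> = (\<Sum>k\<in>N. f (poisson_modes m k) * lead n (poisson_modes m k))"
    by (subst sum.reindex) (auto intro: inj_on_subset[OF inj_poisson_modes])
  also have "\<dots> = (\<Sum>k\<in>{n}. f (poisson_modes m k) * lead n (poisson_modes m k))"
    by (rule sum.mono_neutral_right) (use N n lead_poisson_modes in auto)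
  finally have "f x * lead n (poisson_modes m n) = 0" using s n by simp
  then show "f x = 0" using lead_poisson_modes[of n m n] by simp
qed (use N in simp)

lemma card_poisson_modes: "card (poisson_modes m ` N) = card N"
  by (rule card_image) (rule inj_on_subset[OF inj_poisson_modes], simp)

lemma infinite_dimensional_spectral_space:
  assumes "infinite N" shows "\<not> finite_dimensional (spectral_space (exc_eigenvalue m) N)"
proof
  assume "finite_dimensional (spectral_space (exc_eigenvalue m) N)"
  then obtain B where B: "finite B" "cfun.span B = spectral_space (exc_eigenvalue m) N"
    by (auto simp: finite_dimensional_def)
  obtain M where M: "M \<subseteq> N" "finite M" "card M = Suc (card B)"
    using infinite_arbitrarily_large[OF assms] by blast
  have "poisson_modes m ` M \<subseteq> cfun.span B" using M(1) by (auto simp: B poisson_modes_in_spectral_space)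
  then have "card (poisson_modes m ` M) \<le> card B"
    using cfun.independent_span_bound[OF B(1) independent_poisson_modes[OF M(2)]] by blast
  then show False using M(3) by (simp add: card_poisson_modes)
qed

lemma X_spaces:
  "X_plus m = spectral_space (exc_eigenvalue m) {- int m..}"
  "X_minus m = spectral_space (exc_eigenvalue m) {..int m}"
  "X_zero m = spectral_space (exc_eigenvalue m) {- int m..int m}"
proof -
  have img: "{poisson_mode (of_nat (m + 1)) n | n. P n} = poisson_modes m ` {n. P n}" for P
    by (auto simp: poisson_modes_def)
  have sets: "{n. - int m \<le> n} = {- int m..}" "{n. n \<le> int m} = {..int m}"
    "{n. - int m \<le> n \<and> n \<le> int m} = {- int m..int m}" by auto
  show "X_plus m = spectral_space (exc_eigenvalue m) {- int m..}"
    unfolding X_plus_def img sets by (rule closure_of_span_poisson_modes)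
  show "X_minus m = spectral_space (exc_eigenvalue m) {..int m}"
    unfolding X_minus_def img sets by (rule closure_of_span_poisson_modes)
  show "X_zero m = spectral_space (exc_eigenvalue m) {- int m..int m}"
    unfolding X_zero_def img sets by (rule span_poisson_modes_finite) simp
qed

lemma dim_X_zero: "cfun.dim (X_zero m) = 2 * m + 1"
proof -
  have "X_zero m = cfun.span (poisson_modes m ` {- int m..int m})"
    unfolding X_spaces by (rule span_poisson_modes_finite[symmetric]) simp
  then have "cfun.dim (X_zero m) = card (poisson_modes m ` {- int m..int m})"
    using cfun.dim_span_eq_card_independent[OF independent_poisson_modes[of "{- int m..int m}" m]] by simp
  then show ?thesis by (simp add: card_poisson_modes)
qed

lemma finite_dimensional_X_zero: "finite_dimensional (X_zero m)"
  unfolding X_spaces finite_dimensional_def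
  by (intro exI[of _ "poisson_modes m ` {- int m..int m}"] conjI span_poisson_modes_finite) auto

lemma spectral_sets_distinct:
  "{- int m..} \<noteq> {..int m}" "{- int m..} \<noteq> {- int m..int m}" "{..int m} \<noteq> {- int m..int m}"
  "{- int m..} \<noteq> {}" "{..int m} \<noteq> {}" "{- int m..int m} \<noteq> {}"
  "{- int m..} \<noteq> UNIV" "{..int m} \<noteq> UNIV" "{- int m..int m} \<noteq> UNIV"
proof -
  have "int m + 1 \<in> {- int m..}" "int m + 1 \<notin> {..int m}" "int m + 1 \<notin> {- int m..int m}"
    "- int m - 1 \<in> {..int m}" "- int m - 1 \<notin> {- int m..}" "- int m - 1 \<notin> {- int m..int m}" by auto
  then show "{- int m..} \<noteq> {..int m}" "{- int m..} \<noteq> {- int m..int m}" "{..int m} \<noteq> {- int m..int m}"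
    "{- int m..} \<noteq> UNIV" "{..int m} \<noteq> UNIV" "{- int m..int m} \<noteq> UNIV" by blast+
qed auto

lemma exc_eigenvalue_int:
  assumes "k \<ge> 0" "exc_eigenvalue m = 4 * of_int k * (of_int k + 1)" shows "k = int m"
proof -
  have "complex_of_int (4 * int m * (int m + 1)) = complex_of_int (4 * k * (k + 1))"
    using assms(2) by (simp add: exc_eigenvalue_def)
  then have "4 * int m * (int m + 1) = 4 * k * (k + 1)" by (simp only: of_int_eq_iff)
  \<comment> \<open>The second factor is positive for \<open>k \<ge> 0\<close>, so the exceptional
    eigenvalue determines \<open>m\<close>.\<close>
  then have "(k - int m) * (k + int m + 1) = 0" by (simp add: algebra_simps)
  then show ?thesis using assms(1) by auto
qed

lemma nontrivial_invariant_subspaces_exceptional: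
  "nontrivial_invariant_subspaces moebius_group_bidisk_direct (exc_eigenvalue m) = {X_plus m, X_minus m, X_zero m}"
proof
  let ?S = "spectral_space (exc_eigenvalue m)"
  show "nontrivial_invariant_subspaces moebius_group_bidisk_direct (exc_eigenvalue m) \<subseteq> {X_plus m, X_minus m, X_zero m}"
  proof
    fix Y assume "Y \<in> nontrivial_invariant_subspaces moebius_group_bidisk_direct (exc_eigenvalue m)"
    then have Y: "invariant_subspace moebius_group_bidisk_direct (exc_eigenvalue m) Y" "Y \<noteq> {0}" "Y \<noteq> eigenspace (exc_eigenvalue m)"
      by (auto simp: nontrivial_invariant_subspaces_def)
    from Y(1) obtain N where N: "Y = ?S N"
      and up: "\<And>k. k \<in> N \<Longrightarrow> \<not> (k \<ge> 0 \<and> exc_eigenvalue m = 4 * of_int k * (of_int k + 1)) \<Longrightarrow> k + 1 \<in> N"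
      and down: "\<And>k. k \<in> N \<Longrightarrow> \<not> (k \<le> 0 \<and> exc_eigenvalue m = 4 * of_int k * (of_int k - 1)) \<Longrightarrow> k - 1 \<in> N"
      by (rule invariant_subspace_spectral) blast
    have "N \<in> {{}, UNIV, {- int m..}, {..int m}, {- int m..int m}}"
    proof (rule shift_closed_int_sets)
      show "k + 1 \<in> N" if "k \<in> N" "k \<noteq> int m" for k
        using up[OF that(1)] exc_eigenvalue_int[of k m] that(2) by blast
      show "k - 1 \<in> N" if k: "k \<in> N" "k \<noteq> - int m" for k
      proof (rule down[OF k(1)], safe)
        assume "k \<le> 0" "exc_eigenvalue m = 4 * of_int k * (of_int k - 1)"
        \<comment> \<open>The downward condition at \<open>k\<close> is the upward condition at
          \<open>- k\<close>, since k (k - 1) = (- k) (- k + 1).\<close>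
        then have "- k = int m" by (intro exc_eigenvalue_int) (auto simp: algebra_simps)
        then show False using k(2) by simp
      qed
    qed simp
    moreover have "N \<noteq> {}" "N \<noteq> UNIV"
      using Y(2,3) spectral_space_empty spectral_space_UNIV by (auto simp: N)
    ultimately show "Y \<in> {X_plus m, X_minus m, X_zero m}" by (auto simp: N X_spaces)
  qed
  have "?S N \<in> nontrivial_invariant_subspaces moebius_group_bidisk_direct (exc_eigenvalue m)"
    if "N \<in> {{- int m..}, {..int m}, {- int m..int m}}" for N
  proof -
    have "N \<noteq> {}" "N \<noteq> UNIV" using that spectral_sets_distinct(4-9)[of m] by blast+
    then have "?S N \<noteq> ?S {}" "?S N \<noteq> ?S UNIV" unfolding spectral_space_eq_iff by auto
    then show ?thesis
      using invariant_spectral_spaces[OF that]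
      by (simp add: nontrivial_invariant_subspaces_def spectral_space_empty spectral_space_UNIV exc_eigenvalue_def)
  qed
  then show "{X_plus m, X_minus m, X_zero m} \<subseteq> nontrivial_invariant_subspaces moebius_group_bidisk_direct (exc_eigenvalue m)"
    unfolding X_spaces by blast
qed

lemma nontrivial_invariant_subspaces_generic:
  assumes lam: "\<And>m::nat. lam \<noteq> 4 * of_nat m * (of_nat m + 1)"
  shows "nontrivial_invariant_subspaces moebius_group_bidisk_direct lam = {}"
proof -
  have "Y = {0} \<or> Y = eigenspace lam" if Y: "invariant_subspace moebius_group_bidisk_direct lam Y" for Y
  proof -
    from Y obtain N where N: "Y = spectral_space lam N"
      and up: "\<And>k. k \<in> N \<Longrightarrow> \<not> (k \<ge> 0 \<and> lam = 4 * of_int k * (of_int k + 1)) \<Longrightarrow> k + 1 \<in> N"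
      and down: "\<And>k. k \<in> N \<Longrightarrow> \<not> (k \<le> 0 \<and> lam = 4 * of_int k * (of_int k - 1)) \<Longrightarrow> k - 1 \<in> N"
      by (rule invariant_subspace_spectral) blast
    have up': "k + 1 \<in> N" if "k \<in> N" for k
      by (rule up[OF that]) (metis lam nonneg_int_cases of_int_of_nat_eq)
    have down': "k - 1 \<in> N" if "k \<in> N" for k
    proof (rule down[OF that], safe)
      assume "k \<le> 0" "lam = 4 * of_int k * (of_int k - 1)"
      moreover from \<open>k \<le> 0\<close> obtain n where "k = - int n" by (metis nonpos_int_cases)
      ultimately show False using lam[of n] by (simp add: algebra_simps)
    qed
    have "N = UNIV" if "k \<in> N" for k
    proof -
      have "l \<in> N" for l
        using int_set_up[OF that, of l] int_set_down[OF that, of l] up' down' by (cases "k \<le> l") auto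
      then show ?thesis by auto
    qed
    then have "N = {} \<or> N = UNIV" by blast
    then show ?thesis by (elim disjE) (simp_all add: N spectral_space_empty spectral_space_UNIV)
  qed
  then show ?thesis by (auto simp: nontrivial_invariant_subspaces_def)
qed

lemma direct_group_subset: "moebius_group_bidisk_direct \<subseteq> moebius_group_bidisk"
  unfolding moebius_group_bidisk_direct_def moebius_group_bidisk_def bidisk_automorphisms_from_def moebius_group_def
  by blast

theorem theorem8p1:
  fixes lam :: complex
  shows "((\<forall>m::nat. lam \<noteq> 4 * of_nat m * (of_nat m + 1)) \<longrightarrow>
            nontrivial_invariant_subspaces moebius_group_bidisk lam = {} \<and>
            nontrivial_invariant_subspaces moebius_group_bidisk_direct lam = {}) \<and>
         (\<forall>m::nat. lam = 4 * of_nat m * (of_nat m + 1) \<longrightarrow>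
            nontrivial_invariant_subspaces moebius_group_bidisk_direct lam =
              {X_plus m, X_minus m, X_zero m} \<and>
            card {X_plus m, X_minus m, X_zero m} = 3 \<and>
            (\<forall>Y \<in> {X_plus m, X_minus m, X_zero m}. finite_dimensional Y \<longleftrightarrow> Y = X_zero m) \<and>
            cfun.dim (X_zero m) = 2 * m + 1)"
proof (intro conjI allI impI)
  assume "\<forall>m::nat. lam \<noteq> 4 * of_nat m * (of_nat m + 1)"
  then show generic: "nontrivial_invariant_subspaces moebius_group_bidisk_direct lam = {}"
    by (intro nontrivial_invariant_subspaces_generic) blast
  \<comment> \<open>Invariance under the larger group implies invariance under the subgroup, so
    enlarging the group can only shorten the list.\<close>
  have "nontrivial_invariant_subspaces moebius_group_bidisk lam \<subseteq>
      nontrivial_invariant_subspaces moebius_group_bidisk_direct lam"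
    using direct_group_subset unfolding nontrivial_invariant_subspaces_def invariant_subspace_def by blast
  then show "nontrivial_invariant_subspaces moebius_group_bidisk lam = {}" using generic by simp
next
  fix m :: nat assume lam: "lam = 4 * of_nat m * (of_nat m + 1)"
  show "nontrivial_invariant_subspaces moebius_group_bidisk_direct lam = {X_plus m, X_minus m, X_zero m}"
    using nontrivial_invariant_subspaces_exceptional[of m] by (simp add: lam exc_eigenvalue_def)
  show "card {X_plus m, X_minus m, X_zero m} = 3"
    using spectral_sets_distinct[of m] by (simp add: X_spaces spectral_space_eq_iff)
  show "\<forall>Y \<in> {X_plus m, X_minus m, X_zero m}. finite_dimensional Y \<longleftrightarrow> Y = X_zero m"
  proof -
    have "\<not> finite_dimensional (X_plus m)" "\<not> finite_dimensional (X_minus m)"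
      unfolding X_spaces by (intro infinite_dimensional_spectral_space; simp add: infinite_Ici infinite_Iic)+
    then show ?thesis using finite_dimensional_X_zero by auto
  qed
  show "cfun.dim (X_zero m) = 2 * m + 1" by (rule dim_X_zero)
qed

end
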